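(* For every small category $\mathcal{A}$ with binary products, the following conditions are equivalent: (1) $\mathbf{Set}^{\mathcal{A}^{\mathrm{op}}}$ is graduated; (2) $\mathbf{Set}^{\mathcal{A}^{\mathrm{op}}}$ is a DCC category; (3) every object of $\mathcal{A}$ carries only finitely many sieves.
   Context: A sieve on an object $a$ is a collection of morphisms with codomain $a$ closed under precomposition. An object is finitely presentable if its covariant hom-functor preserves directed colimits. A locally finitely presentable category is graduated if every finitely presentable object $X$ carries a grade, a natural number, such that all subobjects and all strong quotients of $X$ are also finitely presentable and have grades lower than or equal to that of $X$, and all proper subobjects and all proper strong quotients of $X$ have grades strictly lower than that of $X$. A locally finitely presentable category is a DCC category if for every finitely presentable object $A$: (a) every subobject of $A$ is finitely presentable, and all (strictly) descending chains of subobjects of $A$ are finite; (b) every strong quotient of $A$ is finitely presentable, and all (strictly) descending chains of strong quotients of $A$ are finite. Quotients are ordered by: $e\le e'$ for $e\colon A\twoheadrightarrow Q$, $e'\colon A\twoheadrightarrow Q'$ iff $e'=h\cdot e$ for some $h\colon Q\to Q'$. In presheaf categories all quotients (epimorphisms) are strong. *)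

theory Defs
  imports Complex_Main "HOL-Library.FuncSet" "HOL-Library.Equipollence"
begin

text \<open>
  The base category of sets is formed inside a type \<open>'u\<close> playing the role of the universe: a set of
  any type is small if it has strictly smaller cardinality than \<open>'u\<close>. The cardinality of \<open>'u\<close> is
  required to be uncountable and regular. If it is moreover a strong limit, the small subsets of
  \<open>'u\<close> are, up to isomorphism, the members of a Grothendieck universe, and all notions below are the
  usual ones relative to that universe. The strong limit property is deliberately not assumed: this
  covers more universes, and such types (e.g. of successor cardinality) exist in HOL, whereas the
  existence of an inaccessible one is not provable.
\<close>

definition small :: "'u itself \<Rightarrow> 'a set \<Rightarrow> bool" where
  "small U X \<longleftrightarrow> X \<prec> (UNIV :: 'u set)"

definition regular_universe :: "'u itself \<Rightarrow> bool" where
  "regular_universe U \<longleftrightarrow>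
     small U (UNIV :: nat set) \<and>
     (\<forall>(I :: 'u set) (F :: 'u \<Rightarrow> 'u set).
        small U I \<and> (\<forall>i\<in>I. small U (F i)) \<longrightarrow> small U (\<Union>i\<in>I. F i))"

text \<open>\<open>Comp C g f\<close> is the composite ``\<open>g\<close> after \<open>f\<close>''; its value is irrelevant unless
  \<open>Cod C f = Dom C g\<close>.\<close>

record ('o, 'm) cat =
  Obj :: "'o set"
  Mor :: "'m set"
  Dom :: "'m \<Rightarrow> 'o"
  Cod :: "'m \<Rightarrow> 'o"
  Id :: "'o \<Rightarrow> 'm"
  Comp :: "'m \<Rightarrow> 'm \<Rightarrow> 'm"

definition hom :: "('o, 'm) cat \<Rightarrow> 'o \<Rightarrow> 'o \<Rightarrow> 'm set" where
  "hom C X Y = {f \<in> Mor C. Dom C f = X \<and> Cod C f = Y}"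

locale category =
  fixes C :: "('o, 'm) cat"
  assumes Dom_in: "f \<in> Mor C \<Longrightarrow> Dom C f \<in> Obj C"
    and Cod_in: "f \<in> Mor C \<Longrightarrow> Cod C f \<in> Obj C"
    and Id_in: "X \<in> Obj C \<Longrightarrow> Id C X \<in> hom C X X"
    and Comp_in: "f \<in> hom C X Y \<Longrightarrow> g \<in> hom C Y Z \<Longrightarrow> Comp C g f \<in> hom C X Z"
    and Id_left: "f \<in> hom C X Y \<Longrightarrow> Comp C (Id C Y) f = f"
    and Id_right: "f \<in> hom C X Y \<Longrightarrow> Comp C f (Id C X) = f"
    and Comp_assoc: "f \<in> hom C W X \<Longrightarrow> g \<in> hom C X Y \<Longrightarrow> h \<in> hom C Y Z \<Longrightarrow>
           Comp C h (Comp C g f) = Comp C (Comp C h g) f"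

definition small_category :: "'u itself \<Rightarrow> ('o, 'm) cat \<Rightarrow> bool" where
  "small_category U C \<longleftrightarrow> category C \<and> small U (Obj C) \<and> small U (Mor C)"

definition op_cat :: "('o, 'm) cat \<Rightarrow> ('o, 'm) cat" where
  "op_cat C = \<lparr>Obj = Obj C, Mor = Mor C, Dom = Cod C, Cod = Dom C, Id = Id C,
     Comp = (\<lambda>g f. Comp C f g)\<rparr>"

definition has_binary_products :: "('o, 'm) cat \<Rightarrow> bool" where
  "has_binary_products C \<longleftrightarrow>
     (\<forall>a\<in>Obj C. \<forall>b\<in>Obj C. \<exists>p\<in>Obj C. \<exists>\<pi>\<^sub>1\<in>hom C p a. \<exists>\<pi>\<^sub>2\<in>hom C p b.
        \<forall>x\<in>Obj C. \<forall>f\<in>hom C x a. \<forall>g\<in>hom C x b.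
          \<exists>!h. h \<in> hom C x p \<and> Comp C \<pi>\<^sub>1 h = f \<and> Comp C \<pi>\<^sub>2 h = g)"

definition sieve :: "('o, 'm) cat \<Rightarrow> 'o \<Rightarrow> 'm set \<Rightarrow> bool" where
  "sieve C a S \<longleftrightarrow>
     S \<subseteq> {f \<in> Mor C. Cod C f = a} \<and>
     (\<forall>f\<in>S. \<forall>g\<in>Mor C. Cod C g = Dom C f \<longrightarrow> Comp C f g \<in> S)"

text \<open>Functors and natural transformations are required to be extensional (\<open>undefined\<close> outside
  the source category), so that HOL equality is equality of functors resp. transformations.\<close>

record ('o1, 'm1, 'o2, 'm2) ftor =
  omap :: "'o1 \<Rightarrow> 'o2"
  mmap :: "'m1 \<Rightarrow> 'm2"

definition is_functor ::
    "('o1, 'm1) cat \<Rightarrow> ('o2, 'm2) cat \<Rightarrow> ('o1, 'm1, 'o2, 'm2) ftor \<Rightarrow> bool" where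
  "is_functor A B F \<longleftrightarrow>
     category A \<and> category B \<and>
     omap F \<in> Obj A \<rightarrow>\<^sub>E Obj B \<and> mmap F \<in> Mor A \<rightarrow>\<^sub>E Mor B \<and>
     (\<forall>f\<in>Mor A. mmap F f \<in> hom B (omap F (Dom A f)) (omap F (Cod A f))) \<and>
     (\<forall>a\<in>Obj A. mmap F (Id A a) = Id B (omap F a)) \<and>
     (\<forall>f\<in>Mor A. \<forall>g\<in>Mor A. Cod A f = Dom A g \<longrightarrow>
        mmap F (Comp A g f) = Comp B (mmap F g) (mmap F f))"

definition comp_ftor ::
    "('o1, 'm1) cat \<Rightarrow> ('o2, 'm2, 'o3, 'm3) ftor \<Rightarrow> ('o1, 'm1, 'o2, 'm2) ftor
      \<Rightarrow> ('o1, 'm1, 'o3, 'm3) ftor" where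
  "comp_ftor A G F = \<lparr>omap = (\<lambda>a\<in>Obj A. omap G (omap F a)),
                      mmap = (\<lambda>f\<in>Mor A. mmap G (mmap F f))\<rparr>"

text \<open>Arrows that carry their source and target: maps between sets, and natural transformations
  between functors.\<close>

datatype ('x, 'f) arrow = Arrow (src: 'x) (fn: 'f) (tgt: 'x)

definition set_cat :: "'x set set \<Rightarrow> ('x set, ('x set, 'x \<Rightarrow> 'x) arrow) cat" where
  "set_cat \<U> = \<lparr>Obj = \<U>,
     Mor = {Arrow X f Y | X f Y. X \<in> \<U> \<and> Y \<in> \<U> \<and> f \<in> X \<rightarrow>\<^sub>E Y},
     Dom = src, Cod = tgt,
     Id = (\<lambda>X. Arrow X (\<lambda>x\<in>X. x) X),
     Comp = (\<lambda>g f. Arrow (src f) (\<lambda>x\<in>src f. fn g (fn f x)) (tgt g))\<rparr>"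

definition Set_cat :: "'u itself \<Rightarrow> ('u set, ('u set, 'u \<Rightarrow> 'u) arrow) cat" where
  "Set_cat U = set_cat {X. small U X}"

definition nat_trans ::
    "('o1, 'm1) cat \<Rightarrow> ('o2, 'm2) cat \<Rightarrow> ('o1, 'm1, 'o2, 'm2) ftor \<Rightarrow> ('o1 \<Rightarrow> 'm2)
      \<Rightarrow> ('o1, 'm1, 'o2, 'm2) ftor \<Rightarrow> bool" where
  "nat_trans A B F \<eta> G \<longleftrightarrow>
     is_functor A B F \<and> is_functor A B G \<and> \<eta> \<in> extensional (Obj A) \<and>
     (\<forall>a\<in>Obj A. \<eta> a \<in> hom B (omap F a) (omap G a)) \<and>
     (\<forall>f\<in>Mor A. Comp B (\<eta> (Cod A f)) (mmap F f) = Comp B (mmap G f) (\<eta> (Dom A f)))"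

definition functor_cat ::
    "('o1, 'm1) cat \<Rightarrow> ('o2, 'm2) cat
      \<Rightarrow> (('o1, 'm1, 'o2, 'm2) ftor, (('o1, 'm1, 'o2, 'm2) ftor, 'o1 \<Rightarrow> 'm2) arrow) cat" where
  "functor_cat A B = \<lparr>Obj = {F. is_functor A B F},
     Mor = {Arrow F \<eta> G | F \<eta> G. nat_trans A B F \<eta> G},
     Dom = src, Cod = tgt,
     Id = (\<lambda>F. Arrow F (\<lambda>a\<in>Obj A. Id B (omap F a)) F),
     Comp = (\<lambda>\<tau> \<sigma>. Arrow (src \<sigma>) (\<lambda>a\<in>Obj A. Comp B (fn \<tau> a) (fn \<sigma> a)) (tgt \<tau>))\<rparr>"

definition presheaf_cat ::
    "'u itself \<Rightarrow> ('o, 'm) cat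
      \<Rightarrow> (('o, 'm, 'u set, ('u set, 'u \<Rightarrow> 'u) arrow) ftor,
          (('o, 'm, 'u set, ('u set, 'u \<Rightarrow> 'u) arrow) ftor,
           'o \<Rightarrow> ('u set, 'u \<Rightarrow> 'u) arrow) arrow) cat" where
  "presheaf_cat U A = functor_cat (op_cat A) (Set_cat U)"

definition cocone ::
    "('i, 'k) cat \<Rightarrow> ('o, 'm) cat \<Rightarrow> ('i, 'k, 'o, 'm) ftor \<Rightarrow> 'o \<Rightarrow> ('i \<Rightarrow> 'm) \<Rightarrow> bool" where
  "cocone J C D L c \<longleftrightarrow>
     L \<in> Obj C \<and> (\<forall>i\<in>Obj J. c i \<in> hom C (omap D i) L) \<and>
     (\<forall>k\<in>Mor J. Comp C (c (Cod J k)) (mmap D k) = c (Dom J k))"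

definition is_colimit ::
    "('i, 'k) cat \<Rightarrow> ('o, 'm) cat \<Rightarrow> ('i, 'k, 'o, 'm) ftor \<Rightarrow> 'o \<Rightarrow> ('i \<Rightarrow> 'm) \<Rightarrow> bool" where
  "is_colimit J C D L c \<longleftrightarrow>
     cocone J C D L c \<and>
     (\<forall>Y d. cocone J C D Y d \<longrightarrow>
        (\<exists>!h. h \<in> hom C L Y \<and> (\<forall>i\<in>Obj J. Comp C h (c i) = d i)))"

text \<open>Index categories of small diagrams may be taken inside \<open>'u\<close>, since every small set is
  equipollent to a subset of \<open>'u\<close>.\<close>

definition cocomplete :: "'u itself \<Rightarrow> ('o, 'm) cat \<Rightarrow> bool" where
  "cocomplete U C \<longleftrightarrow>
     (\<forall>(J :: ('u, 'u) cat) D. small_category U J \<and> is_functor J C D \<longrightarrow>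
        (\<exists>L c. is_colimit J C D L c))"

definition directed_poset :: "'i set \<Rightarrow> 'i rel \<Rightarrow> bool" where
  "directed_poset I r \<longleftrightarrow>
     partial_order_on I r \<and> I \<noteq> {} \<and> (\<forall>i\<in>I. \<forall>j\<in>I. \<exists>k\<in>I. (i, k) \<in> r \<and> (j, k) \<in> r)"

definition poset_cat :: "'i set \<Rightarrow> 'i rel \<Rightarrow> ('i, 'i \<times> 'i) cat" where
  "poset_cat I r = \<lparr>Obj = I, Mor = r, Dom = fst, Cod = snd, Id = (\<lambda>i. (i, i)),
     Comp = (\<lambda>g f. (fst f, snd g))\<rparr>"

text \<open>The covariant hom-functor of \<open>X\<close>, with values in the category of all subsets of the type of
  morphisms.\<close>

definition hom_ftor ::
    "('o, 'm) cat \<Rightarrow> 'o \<Rightarrow> ('o, 'm, 'm set, ('m set, 'm \<Rightarrow> 'm) arrow) ftor" where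
  "hom_ftor C X = \<lparr>
     omap = (\<lambda>Y\<in>Obj C. hom C X Y),
     mmap = (\<lambda>f\<in>Mor C. Arrow (hom C X (Dom C f)) (\<lambda>g\<in>hom C X (Dom C f). Comp C f g)
                              (hom C X (Cod C f)))\<rparr>"

definition preserves_directed_colimits ::
    "'u itself \<Rightarrow> ('o1, 'm1) cat \<Rightarrow> ('o2, 'm2) cat \<Rightarrow> ('o1, 'm1, 'o2, 'm2) ftor \<Rightarrow> bool" where
  "preserves_directed_colimits U C B F \<longleftrightarrow>
     (\<forall>(I :: 'u set) r D L c.
        small U I \<and> directed_poset I r \<and> is_functor (poset_cat I r) C D \<and>
        is_colimit (poset_cat I r) C D L c \<longrightarrow>
        is_colimit (poset_cat I r) B (comp_ftor (poset_cat I r) F D) (omap F L)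
          (\<lambda>i. mmap F (c i)))"

definition finitely_presentable :: "'u itself \<Rightarrow> ('o, 'm) cat \<Rightarrow> 'o \<Rightarrow> bool" where
  "finitely_presentable U C X \<longleftrightarrow>
     X \<in> Obj C \<and> preserves_directed_colimits U C (set_cat UNIV) (hom_ftor C X)"

definition locally_finitely_presentable :: "'u itself \<Rightarrow> ('o, 'm) cat \<Rightarrow> bool" where
  "locally_finitely_presentable U C \<longleftrightarrow>
     category C \<and> cocomplete U C \<and>
     (\<exists>G. small U G \<and> (\<forall>X\<in>G. finitely_presentable U C X) \<and>
        (\<forall>Y\<in>Obj C. \<exists>(I :: 'u set) r D c.
           small U I \<and> directed_poset I r \<and> is_functor (poset_cat I r) C D \<and>
           (\<forall>i\<in>I. omap D i \<in> G) \<and> is_colimit (poset_cat I r) C D Y c))"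

definition iso_mor :: "('o, 'm) cat \<Rightarrow> 'm \<Rightarrow> bool" where
  "iso_mor C f \<longleftrightarrow>
     f \<in> Mor C \<and>
     (\<exists>g\<in>hom C (Cod C f) (Dom C f). Comp C g f = Id C (Dom C f) \<and> Comp C f g = Id C (Cod C f))"

definition mono_mor :: "('o, 'm) cat \<Rightarrow> 'm \<Rightarrow> bool" where
  "mono_mor C m \<longleftrightarrow>
     m \<in> Mor C \<and>
     (\<forall>W\<in>Obj C. \<forall>f\<in>hom C W (Dom C m). \<forall>g\<in>hom C W (Dom C m). Comp C m f = Comp C m g \<longrightarrow> f = g)"

definition epi_mor :: "('o, 'm) cat \<Rightarrow> 'm \<Rightarrow> bool" where
  "epi_mor C e \<longleftrightarrow>
     e \<in> Mor C \<and>
     (\<forall>W\<in>Obj C. \<forall>f\<in>hom C (Cod C e) W. \<forall>g\<in>hom C (Cod C e) W. Comp C f e = Comp C g e \<longrightarrow> f = g)"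

definition strong_epi_mor :: "('o, 'm) cat \<Rightarrow> 'm \<Rightarrow> bool" where
  "strong_epi_mor C e \<longleftrightarrow>
     epi_mor C e \<and>
     (\<forall>m u v. mono_mor C m \<and> u \<in> hom C (Dom C e) (Dom C m) \<and> v \<in> hom C (Cod C e) (Cod C m) \<and>
        Comp C m u = Comp C v e \<longrightarrow>
        (\<exists>d\<in>hom C (Cod C e) (Dom C m). Comp C d e = u \<and> Comp C m d = v))"

text \<open>Subobjects and strong quotients are given by representatives; they are proper if the
  representing morphism is not an isomorphism.\<close>

definition subobject :: "('o, 'm) cat \<Rightarrow> 'o \<Rightarrow> 'm \<Rightarrow> bool" where
  "subobject C X m \<longleftrightarrow> mono_mor C m \<and> Cod C m = X"

definition strong_quotient :: "('o, 'm) cat \<Rightarrow> 'o \<Rightarrow> 'm \<Rightarrow> bool" where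
  "strong_quotient C X e \<longleftrightarrow> strong_epi_mor C e \<and> Dom C e = X"

definition subobject_le :: "('o, 'm) cat \<Rightarrow> 'm \<Rightarrow> 'm \<Rightarrow> bool" where
  "subobject_le C m m' \<longleftrightarrow> (\<exists>h\<in>hom C (Dom C m) (Dom C m'). m = Comp C m' h)"

text \<open>Note the direction of the order on quotients: the identity is the least quotient.\<close>

definition quotient_le :: "('o, 'm) cat \<Rightarrow> 'm \<Rightarrow> 'm \<Rightarrow> bool" where
  "quotient_le C e e' \<longleftrightarrow> (\<exists>h\<in>hom C (Cod C e) (Cod C e'). e' = Comp C h e)"

text \<open>All strictly descending chains of elements satisfying \<open>P\<close> are finite, for a preorder \<open>le\<close>.\<close>

definition descending_chains_finite :: "('x \<Rightarrow> 'x \<Rightarrow> bool) \<Rightarrow> ('x \<Rightarrow> bool) \<Rightarrow> bool" where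
  "descending_chains_finite le P \<longleftrightarrow>
     \<not> (\<exists>s :: nat \<Rightarrow> 'x. \<forall>n. P (s n) \<and> le (s (Suc n)) (s n) \<and> \<not> le (s n) (s (Suc n)))"

definition graduated :: "'u itself \<Rightarrow> ('o, 'm) cat \<Rightarrow> bool" where
  "graduated U C \<longleftrightarrow>
     locally_finitely_presentable U C \<and>
     (\<exists>gr :: 'o \<Rightarrow> nat. \<forall>X. finitely_presentable U C X \<longrightarrow>
        (\<forall>m. subobject C X m \<longrightarrow>
           finitely_presentable U C (Dom C m) \<and> gr (Dom C m) \<le> gr X \<and>
           (\<not> iso_mor C m \<longrightarrow> gr (Dom C m) < gr X)) \<and>
        (\<forall>e. strong_quotient C X e \<longrightarrow>
           finitely_presentable U C (Cod C e) \<and> gr (Cod C e) \<le> gr X \<and>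
           (\<not> iso_mor C e \<longrightarrow> gr (Cod C e) < gr X)))"

definition dcc_category :: "'u itself \<Rightarrow> ('o, 'm) cat \<Rightarrow> bool" where
  "dcc_category U C \<longleftrightarrow>
     locally_finitely_presentable U C \<and>
     (\<forall>X. finitely_presentable U C X \<longrightarrow>
        (\<forall>m. subobject C X m \<longrightarrow> finitely_presentable U C (Dom C m)) \<and>
        descending_chains_finite (subobject_le C) (subobject C X) \<and>
        (\<forall>e. strong_quotient C X e \<longrightarrow> finitely_presentable U C (Cod C e)) \<and>
        descending_chains_finite (quotient_le C) (strong_quotient C X))"

end

theory Submission
  imports Defs
begin

text \<open>
  A graduated category is a DCC category because a strict descent of subobjects, or of strong
  quotients, strictly changes the grade. In a DCC presheaf category the sieves on \<open>a\<close> are the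
  subobjects of the representable presheaf of \<open>a\<close>: they satisfy DCC by hypothesis, and ACC because
  the union of a chain of sieves is a finitely presentable presheaf, so its identity factors through
  a member of the chain. A distributive lattice with both chain conditions is finite.

  Conversely, let all sieve lattices be finite. The subobjects of a product of two representables
  are the sieves on a product in \<open>A\<close>, so the square of a finite coproduct of representables has only
  finitely many subpresheaves, and hence so has \<open>P \<times> P\<close> for every finitely generated \<open>P\<close>. Thus
  congruences are finitely generated, finitely generated presheaves are finitely presentable, and
  the number of subpresheaves of \<open>P \<times> P\<close> is a grade: it drops for a proper subpresheaf \<open>Z\<close>, since
  \<open>P \<times> P\<close> is not contained in \<open>Z \<times> Z\<close>, and for a proper quotient, since the diagonal of \<open>P\<close> is not
  a preimage.
\<close>

subsection \<open>Small sets\<close>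

text \<open>The universe is only regular and uncountable, so the power set of a small set need not
  be small. This shapes the constructions: presheaf values are small subsets of \<open>'u\<close>,
  hence morphisms of \<open>A\<close>, congruence classes and index posets all have to be injected
  into \<open>'u\<close>, and large index sets are built from finite lists and finite subsets only.
  Conditions (1) and (2) contain local finite presentability, which is established in the step from
  (3). A finitely generated presheaf is described up to isomorphism by a finite list of objects and
  a relation between the corresponding generators; the descriptions form a small set because (3)
  leaves only finitely many relations for each list. The square of \<open>P\<close> is used rather
  than \<open>P\<close> itself because congruences live there, while a subpresheaf of
  \<open>P\<close> can be read as a set of diagonal pairs. One finiteness statement thus controls
  relations between generators, subobjects and quotients alike.\<close>

lemma small_lepoll: "X \<lesssim> Y \<Longrightarrow> small U Y \<Longrightarrow> small U X"
  unfolding small_def by (rule lesspoll_trans1)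

lemma small_image: "small U X \<Longrightarrow> small U (f ` X)"
  by (rule small_lepoll[OF image_lepoll])

lemma small_subset: "small U Y \<Longrightarrow> X \<subseteq> Y \<Longrightarrow> small U X"
  by (rule small_lepoll[OF subset_imp_lepoll])

lemma small_embedding:
  assumes "small (U :: 'u itself) X"
  obtains e :: "'a \<Rightarrow> 'u" where "inj_on e X"
  using assms unfolding small_def lesspoll_def lepoll_def by blast

lemma infinite_universe: "regular_universe (U :: 'u itself) \<Longrightarrow> infinite (UNIV :: 'u set)"
  unfolding regular_universe_def small_def lesspoll_def
  using infinite_le_lepoll by blast

lemma small_finite: "regular_universe U \<Longrightarrow> finite X \<Longrightarrow> small U X"
  unfolding small_def by (intro finite_lesspoll_infinite infinite_universe)

lemma small_nat: "regular_universe U \<Longrightarrow> small U (X :: nat set)"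
  unfolding regular_universe_def using small_subset by blast

text \<open>\<open>regular_universe\<close> only speaks of unions of subsets of \<open>'u\<close>
  indexed inside \<open>'u\<close>. The index set is moved there by \<open>e\<close>, the fibres by
  \<open>d i\<close>, and an injective pairing \<open>p\<close> on \<open>'u\<close> keeps the
  fibres apart inside one union.\<close>

lemma small_Sigma:
  assumes U: "regular_universe (U :: 'u itself)"
    and I: "small U I" and F: "\<And>i. i \<in> I \<Longrightarrow> small U (F i)"
  shows "small U (Sigma I F)"
proof -
  obtain e :: "'a \<Rightarrow> 'u" where e: "inj_on e I"
    using I by (rule small_embedding)
  have "\<forall>i. \<exists>d :: 'b \<Rightarrow> 'u. i \<in> I \<longrightarrow> inj_on d (F i)"
    by (metis F small_embedding)
  then obtain d :: "'a \<Rightarrow> 'b \<Rightarrow> 'u" where d: "\<And>i. i \<in> I \<Longrightarrow> inj_on (d i) (F i)"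
    by metis
  obtain p :: "'u \<times> 'u \<Rightarrow> 'u" where p: "inj p"
    using card_of_Times_same_infinite[OF infinite_universe[OF U]]
    unfolding card_of_ordIso[symmetric] bij_betw_def by auto
  define H where "H j = (\<lambda>x. p (j, d (inv_into I e j) x)) ` F (inv_into I e j)" for j
  have H: "small U (H (e i))" if "i \<in> I" for i
    unfolding H_def using that e by (auto intro: small_image F)
  have "small U (\<Union>j\<in>e ` I. H j)"
    using U H small_image[OF I] unfolding regular_universe_def by blast
  moreover have "(\<lambda>(i, x). p (e i, d i x)) ` Sigma I F \<subseteq> (\<Union>j\<in>e ` I. H j)"
    using e by (auto simp: H_def)
  moreover have "inj_on (\<lambda>(i, x). p (e i, d i x)) (Sigma I F)"
  proof (rule inj_onI, clarify)
    fix i x j y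
    assume *: "i \<in> I" "x \<in> F i" "j \<in> I" "y \<in> F j" "p (e i, d i x) = p (e j, d j y)"
    then have "e i = e j" "d i x = d j y"
      by (auto dest: injD[OF p])
    then show "i = j \<and> x = y"
      using * inj_onD[OF e] inj_onD[OF d] by metis
  qed
  ultimately have "Sigma I F \<lesssim> (\<Union>j\<in>e ` I. H j)"
    unfolding lepoll_def by blast
  then show ?thesis
    using \<open>small U (\<Union>j\<in>e ` I. H j)\<close> by (rule small_lepoll)
qed

lemma small_UN:
  assumes "regular_universe U" "small U I" "\<And>i. i \<in> I \<Longrightarrow> small U (F i)"
  shows "small U (\<Union>i\<in>I. F i)"
proof -
  have "(\<Union>i\<in>I. F i) = snd ` Sigma I F"
    by (auto simp: image_iff)
  then show ?thesis
    by (simp only: small_image small_Sigma assms)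
qed

text \<open>Lists are a countable union over their lengths, so the uncountability of the universe
  enters here.\<close>

lemma small_lists:
  assumes U: "regular_universe U" and X: "small U X"
  shows "small U (lists X)"
proof -
  have len: "small U {l \<in> lists X. length l = n}" for n
  proof (induction n)
    case 0
    have "{l \<in> lists X. length l = 0} = {[]}" by auto
    then show ?case by (simp add: small_finite[OF U])
  next
    case (Suc n)
    have "{l \<in> lists X. length l = Suc n} \<subseteq>
        (\<lambda>(x, l). x # l) ` (X \<times> {l \<in> lists X. length l = n})"
      by (auto simp: length_Suc_conv image_iff)
    then show ?case
      by (rule small_subset[OF small_image[OF small_Sigma[OF U X Suc]]])
  qed
  have "lists X \<subseteq> (\<Union>n. {l \<in> lists X. length l = n})" by auto
  then show ?thesis
    by (rule small_subset[OF small_UN[OF U small_nat[OF U] len]])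
qed

text \<open>Provides the index set of the directed diagram in
  \<open>directed_colimit_of_presented\<close>; the full power set might fail to be small.\<close>

lemma small_finite_subsets:
  assumes "regular_universe U" "small U X"
  shows "small U {F. finite F \<and> F \<subseteq> X}"
proof -
  have "{F. finite F \<and> F \<subseteq> X} \<subseteq> set ` lists X"
    using finite_list by (fastforce simp: lists_eq_set)
  then show ?thesis
    by (rule small_subset[OF small_image[OF small_lists[OF assms]]])
qed

subsection \<open>Presheaves in terms of elements\<close>

lemma category_op_cat: "category A \<Longrightarrow> category (op_cat A)"
  unfolding category_def by (simp add: op_cat_def hom_def)

lemma category_set_cat: "category (set_cat \<U>)"
  by standard (auto simp: set_cat_def hom_def extensional_def PiE_iff intro!: ext)

lemma category_Set_cat: "category (Set_cat U)"
  unfolding Set_cat_def by (rule category_set_cat)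

type_synonym ('o, 'm, 'u) psh = "('o, 'm, 'u set, ('u set, 'u \<Rightarrow> 'u) arrow) ftor"

type_synonym ('o, 'm, 'u) psh_mor =
  "(('o, 'm, 'u) psh, 'o \<Rightarrow> ('u set, 'u \<Rightarrow> 'u) arrow) arrow"

text \<open>A presheaf is a functor on \<open>op_cat A\<close>, so \<open>act P f\<close> restricts
  elements from \<open>Cod A f\<close> to \<open>Dom A f\<close>.\<close>

definition act :: "('o, 'm, 'u) psh \<Rightarrow> 'm \<Rightarrow> 'u \<Rightarrow> 'u" where
  "act P f x = fn (mmap P f) x"

definition app :: "('o, 'm, 'u) psh_mor \<Rightarrow> 'o \<Rightarrow> 'u \<Rightarrow> 'u" where
  "app \<sigma> a x = fn (fn \<sigma> a) x"

locale presheaves = category A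
  for A :: "('o, 'm) cat" +
  fixes U :: "'u itself"
  assumes regular: "regular_universe U"
    and small_Obj: "small U (Obj A)"
    and small_Mor: "small U (Mor A)"
begin

abbreviation "PSh \<equiv> presheaf_cat U A"

text \<open>Together, \<open>mkpsh\<close> and \<open>mknt\<close> absorb the extensionality
  demanded of functors and transformations; constructed presheaves and morphisms go through them, so
  that later arguments can speak of elements only.\<close>

definition mkpsh :: "('o \<Rightarrow> 'u set) \<Rightarrow> ('m \<Rightarrow> 'u \<Rightarrow> 'u) \<Rightarrow> ('o, 'm, 'u) psh" where
  "mkpsh X \<alpha> = \<lparr>omap = (\<lambda>a\<in>Obj A. X a),
     mmap = (\<lambda>f\<in>Mor A. Arrow (X (Cod A f)) (\<lambda>x\<in>X (Cod A f). \<alpha> f x) (X (Dom A f)))\<rparr>"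

definition mknt ::
    "('o, 'm, 'u) psh \<Rightarrow> ('o \<Rightarrow> 'u \<Rightarrow> 'u) \<Rightarrow> ('o, 'm, 'u) psh \<Rightarrow> ('o, 'm, 'u) psh_mor" where
  "mknt P \<eta> Q = Arrow P (\<lambda>a\<in>Obj A. Arrow (omap P a) (\<lambda>x\<in>omap P a. \<eta> a x) (omap Q a)) Q"

lemma Comp_Mor: "f \<in> Mor A \<Longrightarrow> g \<in> Mor A \<Longrightarrow> Cod A f = Dom A g \<Longrightarrow> Comp A g f \<in> Mor A"
  and Dom_Comp: "f \<in> Mor A \<Longrightarrow> g \<in> Mor A \<Longrightarrow> Cod A f = Dom A g \<Longrightarrow> Dom A (Comp A g f) = Dom A f"
  and Cod_Comp: "f \<in> Mor A \<Longrightarrow> g \<in> Mor A \<Longrightarrow> Cod A f = Dom A g \<Longrightarrow> Cod A (Comp A g f) = Cod A g"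
  using Comp_in[of f "Dom A f" "Dom A g" g "Cod A g"] by (auto simp: hom_def)

lemma Id_Mor: "a \<in> Obj A \<Longrightarrow> Id A a \<in> Mor A"
  and Dom_Id: "a \<in> Obj A \<Longrightarrow> Dom A (Id A a) = a"
  and Cod_Id: "a \<in> Obj A \<Longrightarrow> Cod A (Id A a) = a"
  using Id_in[of a] by (auto simp: hom_def)

lemmas cat_simps = Comp_Mor Dom_Comp Cod_Comp Id_Mor Dom_Id Cod_Id Dom_in Cod_in

lemma Obj_PSh: "P \<in> Obj PSh \<longleftrightarrow> is_functor (op_cat A) (Set_cat U) P"
  by (simp add: presheaf_cat_def functor_cat_def)

lemma mkpsh_Obj:
  assumes "\<And>a. a \<in> Obj A \<Longrightarrow> small U (X a)"
    and "\<And>f x. f \<in> Mor A \<Longrightarrow> x \<in> X (Cod A f) \<Longrightarrow> \<alpha> f x \<in> X (Dom A f)"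
    and "\<And>a x. a \<in> Obj A \<Longrightarrow> x \<in> X a \<Longrightarrow> \<alpha> (Id A a) x = x"
    and "\<And>f g x. f \<in> Mor A \<Longrightarrow> g \<in> Mor A \<Longrightarrow> Cod A f = Dom A g \<Longrightarrow> x \<in> X (Cod A g) \<Longrightarrow>
           \<alpha> (Comp A g f) x = \<alpha> f (\<alpha> g x)"
  shows "mkpsh X \<alpha> \<in> Obj PSh"
proof -
  have "\<alpha> f x \<in> X b" if "f \<in> Mor A" "x \<in> X (Cod A f)" "Dom A f = b" for f x b
    using assms(2) that by blast
  then show ?thesis
    unfolding Obj_PSh is_functor_def
    using assms(1,3,4) category_op_cat[OF category_axioms] category_Set_cat[of U]
    by (auto simp: op_cat_def Set_cat_def set_cat_def mkpsh_def hom_def cat_simps)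
qed

lemma omap_mkpsh: "a \<in> Obj A \<Longrightarrow> omap (mkpsh X \<alpha>) a = X a"
  by (simp add: mkpsh_def)

lemma act_mkpsh: "f \<in> Mor A \<Longrightarrow> x \<in> X (Cod A f) \<Longrightarrow> act (mkpsh X \<alpha>) f x = \<alpha> f x"
  by (simp add: mkpsh_def act_def)

context
  fixes P assumes P: "P \<in> Obj PSh"
begin

lemma mmap_psh:
  assumes "f \<in> Mor A"
  obtains h where "mmap P f = Arrow (omap P (Cod A f)) h (omap P (Dom A f))"
    "h \<in> omap P (Cod A f) \<rightarrow>\<^sub>E omap P (Dom A f)"
  using P assms unfolding Obj_PSh is_functor_def
  by (fastforce simp: op_cat_def Set_cat_def set_cat_def hom_def)

lemma small_psh: "a \<in> Obj A \<Longrightarrow> small U (omap P a)"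
  using P unfolding Obj_PSh is_functor_def
  by (auto simp: op_cat_def Set_cat_def set_cat_def)

lemma act_in: "f \<in> Mor A \<Longrightarrow> x \<in> omap P (Cod A f) \<Longrightarrow> act P f x \<in> omap P (Dom A f)"
  by (rule mmap_psh[of f]) (auto simp: act_def)

lemma act_Id: "a \<in> Obj A \<Longrightarrow> x \<in> omap P a \<Longrightarrow> act P (Id A a) x = x"
  using P unfolding Obj_PSh is_functor_def
  by (auto simp: op_cat_def Set_cat_def set_cat_def act_def)

lemma act_Comp:
  assumes "f \<in> Mor A" "g \<in> Mor A" "Cod A f = Dom A g" "x \<in> omap P (Cod A g)"
  shows "act P (Comp A g f) x = act P f (act P g x)"
proof -
  have "mmap P (Comp A g f) = Comp (Set_cat U) (mmap P f) (mmap P g)"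
    using P assms unfolding Obj_PSh is_functor_def by (simp add: op_cat_def)
  then show ?thesis
    using assms by (auto simp: act_def Set_cat_def set_cat_def elim: mmap_psh[of g])
qed

end

lemma psh_mor_components:
  assumes "\<sigma> \<in> hom PSh P Q"
  shows "P \<in> Obj PSh" "Q \<in> Obj PSh" "src \<sigma> = P" "tgt \<sigma> = Q" "fn \<sigma> \<in> extensional (Obj A)"
    "\<And>a. a \<in> Obj A \<Longrightarrow> \<exists>h\<in>omap P a \<rightarrow>\<^sub>E omap Q a. fn \<sigma> a = Arrow (omap P a) h (omap Q a)"
    "\<And>f. f \<in> Mor A \<Longrightarrow>
       Comp (Set_cat U) (fn \<sigma> (Dom A f)) (mmap P f) = Comp (Set_cat U) (mmap Q f) (fn \<sigma> (Cod A f))"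
proof -
  obtain \<eta> where \<sigma>: "\<sigma> = Arrow P \<eta> Q" and nt: "nat_trans (op_cat A) (Set_cat U) P \<eta> Q"
    using assms by (auto simp: hom_def presheaf_cat_def functor_cat_def)
  show "P \<in> Obj PSh" "Q \<in> Obj PSh" "src \<sigma> = P" "tgt \<sigma> = Q" "fn \<sigma> \<in> extensional (Obj A)"
    using nt \<sigma> by (auto simp: nat_trans_def Obj_PSh op_cat_def)
  show "\<exists>h\<in>omap P a \<rightarrow>\<^sub>E omap Q a. fn \<sigma> a = Arrow (omap P a) h (omap Q a)" if "a \<in> Obj A" for a
    using nt \<sigma> that
    by (fastforce simp: nat_trans_def op_cat_def Set_cat_def set_cat_def hom_def)
  show "Comp (Set_cat U) (fn \<sigma> (Dom A f)) (mmap P f) = Comp (Set_cat U) (mmap Q f) (fn \<sigma> (Cod A f))"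
    if "f \<in> Mor A" for f
    using nt \<sigma> that by (simp add: nat_trans_def op_cat_def)
qed

lemmas psh_mor_Dom = psh_mor_components(1)
lemmas psh_mor_Cod = psh_mor_components(2)

lemma app_in: "\<sigma> \<in> hom PSh P Q \<Longrightarrow> a \<in> Obj A \<Longrightarrow> x \<in> omap P a \<Longrightarrow> app \<sigma> a x \<in> omap Q a"
  by (drule (1) psh_mor_components(6)) (auto simp: app_def)

lemma app_act:
  assumes \<sigma>: "\<sigma> \<in> hom PSh P Q" and f: "f \<in> Mor A" and x: "x \<in> omap P (Cod A f)"
  shows "app \<sigma> (Dom A f) (act P f x) = act Q f (app \<sigma> (Cod A f) x)"
proof -
  note c = psh_mor_components[OF \<sigma>]
  obtain h where h: "mmap P f = Arrow (omap P (Cod A f)) h (omap P (Dom A f))"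
    using mmap_psh[OF c(1) f] by metis
  obtain k where k: "fn \<sigma> (Cod A f) = Arrow (omap P (Cod A f)) k (omap Q (Cod A f))"
    using c(6)[of "Cod A f"] f by (auto simp: Cod_in)
  have "fn (Comp (Set_cat U) (fn \<sigma> (Dom A f)) (mmap P f)) x
      = fn (Comp (Set_cat U) (mmap Q f) (fn \<sigma> (Cod A f))) x"
    using c(7)[OF f] by simp
  then show ?thesis
    using x h k by (simp add: Set_cat_def set_cat_def act_def app_def)
qed

lemma psh_mor_eqI:
  assumes \<sigma>: "\<sigma> \<in> hom PSh P Q" and \<tau>: "\<tau> \<in> hom PSh P Q"
    and eq: "\<And>a x. a \<in> Obj A \<Longrightarrow> x \<in> omap P a \<Longrightarrow> app \<sigma> a x = app \<tau> a x"
  shows "\<sigma> = \<tau>"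
proof -
  have "fn \<sigma> a = fn \<tau> a" if a: "a \<in> Obj A" for a
  proof -
    obtain h k where hk: "h \<in> omap P a \<rightarrow>\<^sub>E omap Q a" "k \<in> omap P a \<rightarrow>\<^sub>E omap Q a"
      "fn \<sigma> a = Arrow (omap P a) h (omap Q a)" "fn \<tau> a = Arrow (omap P a) k (omap Q a)"
      using psh_mor_components(6)[OF \<sigma> a] psh_mor_components(6)[OF \<tau> a] by blast
    have "h = k"
      using hk eq[OF a] by (intro PiE_ext[OF hk(1,2)]) (auto simp: app_def)
    then show ?thesis using hk by simp
  qed
  then have "fn \<sigma> = fn \<tau>"
    using psh_mor_components(5)[OF \<sigma>] psh_mor_components(5)[OF \<tau>] by (meson extensionalityI)
  then show ?thesis
    using psh_mor_components(3,4)[OF \<sigma>] psh_mor_components(3,4)[OF \<tau>] by (metis arrow.expand)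
qed

lemma app_mknt: "a \<in> Obj A \<Longrightarrow> x \<in> omap P a \<Longrightarrow> app (mknt P \<eta> Q) a x = \<eta> a x"
  by (simp add: app_def mknt_def)

lemma mknt_hom:
  assumes P: "P \<in> Obj PSh" and Q: "Q \<in> Obj PSh"
    and map: "\<And>a x. a \<in> Obj A \<Longrightarrow> x \<in> omap P a \<Longrightarrow> \<eta> a x \<in> omap Q a"
    and nat: "\<And>f x. f \<in> Mor A \<Longrightarrow> x \<in> omap P (Cod A f) \<Longrightarrow>
           \<eta> (Dom A f) (act P f x) = act Q f (\<eta> (Cod A f) x)"
  shows "mknt P \<eta> Q \<in> hom PSh P Q"
proof -
  let ?n = "\<lambda>a\<in>Obj A. Arrow (omap P a) (\<lambda>x\<in>omap P a. \<eta> a x) (omap Q a)"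
  have "nat_trans (op_cat A) (Set_cat U) P ?n Q"
    unfolding nat_trans_def
  proof (intro conjI ballI)
    show "is_functor (op_cat A) (Set_cat U) P" "is_functor (op_cat A) (Set_cat U) Q"
      using P Q by (simp_all add: Obj_PSh)
    show "?n \<in> extensional (Obj (op_cat A))"
      by (simp add: op_cat_def)
    show "?n a \<in> hom (Set_cat U) (omap P a) (omap Q a)" if "a \<in> Obj (op_cat A)" for a
      using that map small_psh[OF P] small_psh[OF Q]
      by (auto simp: op_cat_def Set_cat_def set_cat_def hom_def)
    show "Comp (Set_cat U) (?n (Cod (op_cat A) f)) (mmap P f) =
        Comp (Set_cat U) (mmap Q f) (?n (Dom (op_cat A) f))" if "f \<in> Mor (op_cat A)" for f
    proof -
      have f: "f \<in> Mor A" using that by (simp add: op_cat_def)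
      obtain h k where hk: "mmap P f = Arrow (omap P (Cod A f)) h (omap P (Dom A f))"
        "h \<in> omap P (Cod A f) \<rightarrow>\<^sub>E omap P (Dom A f)"
        "mmap Q f = Arrow (omap Q (Cod A f)) k (omap Q (Dom A f))"
        using mmap_psh[OF P f] mmap_psh[OF Q f] by metis
      show ?thesis
        using f hk nat[OF f]
        by (auto simp: op_cat_def Set_cat_def set_cat_def cat_simps act_def intro!: ext)
    qed
  qed
  then show ?thesis
    by (auto simp: mknt_def hom_def presheaf_cat_def functor_cat_def)
qed

lemma app_Comp:
  assumes \<sigma>: "\<sigma> \<in> hom PSh P Q" and a: "a \<in> Obj A" and x: "x \<in> omap P a"
  shows "app (Comp PSh \<tau> \<sigma>) a x = app \<tau> a (app \<sigma> a x)"
  using a x psh_mor_components(6)[OF \<sigma> a]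
  by (auto simp: presheaf_cat_def functor_cat_def op_cat_def Set_cat_def set_cat_def app_def)

lemma Comp_PSh_mknt:
  assumes \<sigma>: "\<sigma> \<in> hom PSh P Q" and \<tau>: "\<tau> \<in> hom PSh Q R"
  shows "Comp PSh \<tau> \<sigma> = mknt P (\<lambda>a x. app \<tau> a (app \<sigma> a x)) R"
proof -
  have "Comp (Set_cat U) (fn \<tau> a) (fn \<sigma> a) =
      Arrow (omap P a) (\<lambda>x\<in>omap P a. app \<tau> a (app \<sigma> a x)) (omap R a)" if "a \<in> Obj A" for a
    using psh_mor_components(6)[OF \<sigma> that] psh_mor_components(6)[OF \<tau> that]
    by (auto simp: Set_cat_def set_cat_def app_def intro!: ext)
  then show ?thesis
    using psh_mor_components(3,4)[OF \<sigma>] psh_mor_components(3,4)[OF \<tau>]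
    by (auto simp: mknt_def presheaf_cat_def functor_cat_def op_cat_def intro!: ext)
qed

lemma Comp_PSh_hom:
  assumes \<sigma>: "\<sigma> \<in> hom PSh P Q" and \<tau>: "\<tau> \<in> hom PSh Q R"
  shows "Comp PSh \<tau> \<sigma> \<in> hom PSh P R"
  unfolding Comp_PSh_mknt[OF assms]
  by (rule mknt_hom)
    (auto simp: psh_mor_Dom[OF \<sigma>] psh_mor_Cod[OF \<tau>] app_in[OF \<sigma>] app_in[OF \<tau>]
       app_act[OF \<sigma>] app_act[OF \<tau>] Cod_in)

lemma Id_PSh_mknt: "Id PSh P = mknt P (\<lambda>a x. x) P"
  by (auto simp: mknt_def presheaf_cat_def functor_cat_def op_cat_def Set_cat_def set_cat_def)

lemma app_Id: "a \<in> Obj A \<Longrightarrow> x \<in> omap P a \<Longrightarrow> app (Id PSh P) a x = x"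
  by (simp add: Id_PSh_mknt app_mknt)

lemma Id_PSh_hom: "P \<in> Obj PSh \<Longrightarrow> Id PSh P \<in> hom PSh P P"
  unfolding Id_PSh_mknt by (rule mknt_hom) auto

lemma Mor_PSh_hom: "\<sigma> \<in> Mor PSh \<Longrightarrow> \<sigma> \<in> hom PSh (Dom PSh \<sigma>) (Cod PSh \<sigma>)"
  by (simp add: hom_def)

lemma category_PSh: "category PSh"
proof
  show "Dom PSh f \<in> Obj PSh" "Cod PSh f \<in> Obj PSh" if "f \<in> Mor PSh" for f
    using Mor_PSh_hom[OF that] by (auto dest: psh_mor_Dom psh_mor_Cod)
  show "Id PSh P \<in> hom PSh P P" if "P \<in> Obj PSh" for P
    using that by (rule Id_PSh_hom)
  show "Comp PSh \<tau> \<sigma> \<in> hom PSh P R" if "\<sigma> \<in> hom PSh P Q" "\<tau> \<in> hom PSh Q R" for \<sigma> \<tau> P Q R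
    using that by (rule Comp_PSh_hom)
  show "Comp PSh (Id PSh Q) \<sigma> = \<sigma>" if \<sigma>: "\<sigma> \<in> hom PSh P Q" for \<sigma> P Q
    by (rule psh_mor_eqI[OF Comp_PSh_hom[OF \<sigma> Id_PSh_hom[OF psh_mor_Cod[OF \<sigma>]]] \<sigma>])
      (simp add: app_Comp[OF \<sigma>] app_Id app_in[OF \<sigma>])
  show "Comp PSh \<sigma> (Id PSh P) = \<sigma>" if \<sigma>: "\<sigma> \<in> hom PSh P Q" for \<sigma> P Q
    by (rule psh_mor_eqI[OF Comp_PSh_hom[OF Id_PSh_hom[OF psh_mor_Dom[OF \<sigma>]] \<sigma>] \<sigma>])
      (simp add: app_Comp[OF Id_PSh_hom[OF psh_mor_Dom[OF \<sigma>]]] app_Id)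
  show "Comp PSh \<upsilon> (Comp PSh \<tau> \<sigma>) = Comp PSh (Comp PSh \<upsilon> \<tau>) \<sigma>"
    if "\<sigma> \<in> hom PSh P Q" "\<tau> \<in> hom PSh Q R" "\<upsilon> \<in> hom PSh R T" for \<sigma> \<tau> \<upsilon> P Q R T
  proof (rule psh_mor_eqI[of _ P T])
    show "Comp PSh \<upsilon> (Comp PSh \<tau> \<sigma>) \<in> hom PSh P T" "Comp PSh (Comp PSh \<upsilon> \<tau>) \<sigma> \<in> hom PSh P T"
      using that by (blast intro: Comp_PSh_hom)+
    note maps = that
    show "app (Comp PSh \<upsilon> (Comp PSh \<tau> \<sigma>)) a x = app (Comp PSh (Comp PSh \<upsilon> \<tau>) \<sigma>) a x"
      if ax: "a \<in> Obj A" "x \<in> omap P a" for a x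
      using ax app_in[OF maps(1) ax]
      by (simp add: app_Comp[OF maps(1)] app_Comp[OF maps(2)]
          app_Comp[OF Comp_PSh_hom[OF maps(1,2)]])
  qed
qed

end

subsection \<open>Diagrams over directed posets\<close>

lemma is_functor_Obj: "is_functor J C D \<Longrightarrow> i \<in> Obj J \<Longrightarrow> omap D i \<in> Obj C"
  unfolding is_functor_def by auto

lemma is_functor_hom:
  "is_functor J C D \<Longrightarrow> k \<in> Mor J \<Longrightarrow> mmap D k \<in> hom C (omap D (Dom J k)) (omap D (Cod J k))"
  unfolding is_functor_def by auto

lemma directed_posetD:
  assumes "directed_poset I r"
  shows "r \<subseteq> I \<times> I" "i \<in> I \<Longrightarrow> (i, i) \<in> r" "(i, j) \<in> r \<Longrightarrow> (j, k) \<in> r \<Longrightarrow> (i, k) \<in> r"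
    "i \<in> I \<Longrightarrow> j \<in> I \<Longrightarrow> \<exists>k\<in>I. (i, k) \<in> r \<and> (j, k) \<in> r" "I \<noteq> {}"
  using assms
  unfolding directed_poset_def partial_order_on_def preorder_on_def refl_on_def trans_def
  by blast+

lemma directed_poset_finite_bound:
  assumes "directed_poset I r" "finite F" "F \<subseteq> I"
  shows "\<exists>k\<in>I. \<forall>i\<in>F. (i, k) \<in> r"
  using assms(2,3)
proof (induction F)
  case empty
  then show ?case using directed_posetD(5)[OF assms(1)] by auto
next
  case (insert i F)
  then obtain k where "k \<in> I" "\<forall>i\<in>F. (i, k) \<in> r" by auto
  moreover obtain l where "l \<in> I" "(i, l) \<in> r" "(k, l) \<in> r"
    using insert.prems directed_posetD(4)[OF assms(1), of i k] \<open>k \<in> I\<close> by auto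
  ultimately show ?case
    using directed_posetD(3)[OF assms(1), of _ k l] by blast
qed

lemma poset_cat_simps [simp]:
  "Obj (poset_cat I r) = I" "Mor (poset_cat I r) = r"
  "Dom (poset_cat I r) = fst" "Cod (poset_cat I r) = snd"
  "Id (poset_cat I r) i = (i, i)" "Comp (poset_cat I r) g f = (fst f, snd g)"
  by (simp_all add: poset_cat_def)

lemma category_poset_cat:
  assumes "directed_poset I r"
  shows "category (poset_cat I r)"
proof -
  note r = directed_posetD(1-3)[OF assms]
  show ?thesis
    using r(1) by unfold_locales (auto simp: hom_def intro: r(2) r(3))
qed

lemma poset_functor_Comp:
  assumes D: "is_functor (poset_cat I r) C D" and "(i, j) \<in> r" "(j, k) \<in> r"
  shows "mmap D (i, k) = Comp C (mmap D (j, k)) (mmap D (i, j))"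
proof -
  have "\<forall>f\<in>r. \<forall>g\<in>r. snd f = fst g \<longrightarrow> mmap D (fst f, snd g) = Comp C (mmap D g) (mmap D f)"
    using D unfolding is_functor_def by simp
  from this[rule_format, of "(i, j)" "(j, k)"] show ?thesis
    using assms by simp
qed

lemma directed_functorI:
  assumes "directed_poset I r" "category C"
    and "\<And>i. i \<in> I \<Longrightarrow> P i \<in> Obj C"
    and "\<And>i j. (i, j) \<in> r \<Longrightarrow> \<mu> i j \<in> hom C (P i) (P j)"
    and "\<And>i. i \<in> I \<Longrightarrow> \<mu> i i = Id C (P i)"
    and "\<And>i j k. (i, j) \<in> r \<Longrightarrow> (j, k) \<in> r \<Longrightarrow> \<mu> i k = Comp C (\<mu> j k) (\<mu> i j)"
  shows "is_functor (poset_cat I r) C \<lparr>omap = restrict P I, mmap = (\<lambda>k\<in>r. \<mu> (fst k) (snd k))\<rparr>"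
proof -
  note r = directed_posetD[OF assms(1)]
  have "\<mu> i j \<in> Mor C" if "(i, j) \<in> r" for i j
    using assms(4)[OF that] by (simp add: hom_def)
  then show ?thesis
    unfolding is_functor_def
    using assms(2-5) category_poset_cat[OF assms(1)] r(1,2)
    by (auto intro: assms(6) r(3) simp: subset_iff)
qed

subsection \<open>Preservation of directed colimits by hom-functors\<close>

lemma set_cat_simps:
  "Obj (set_cat \<U>) = \<U>"
  "Id (set_cat \<U>) X = Arrow X (\<lambda>x\<in>X. x) X"
  "Comp (set_cat \<U>) g f = Arrow (src f) (\<lambda>x\<in>src f. fn g (fn f x)) (tgt g)"
  "f \<in> hom (set_cat \<U>) X Y \<longleftrightarrow> X \<in> \<U> \<and> Y \<in> \<U> \<and> (\<exists>h\<in>X \<rightarrow>\<^sub>E Y. f = Arrow X h Y)"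
  by (auto simp: set_cat_def hom_def)

locale directed_colimit = category C
  for C :: "('o, 'm) cat" +
  fixes I :: "'i set" and r D L c
  assumes directed: "directed_poset I r"
    and diagram: "is_functor (poset_cat I r) C D"
    and colimit: "is_colimit (poset_cat I r) C D L c"
begin

abbreviation "hom_diagram X \<equiv> comp_ftor (poset_cat I r) (hom_ftor C X) D"

lemma colimit_Obj: "L \<in> Obj C"
  and cocone_hom: "\<And>i. i \<in> I \<Longrightarrow> c i \<in> hom C (omap D i) L"
  and cocone_comp: "\<And>i k. (i, k) \<in> r \<Longrightarrow> Comp C (c k) (mmap D (i, k)) = c i"
  using colimit by (force simp: is_colimit_def cocone_def)+

lemma diagram_hom: "(i, k) \<in> r \<Longrightarrow> mmap D (i, k) \<in> hom C (omap D i) (omap D k)"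
  using is_functor_hom[OF diagram, of "(i, k)"] by simp

lemma hom_diagram_omap: "i \<in> I \<Longrightarrow> omap (hom_diagram X) i = hom C X (omap D i)"
  using is_functor_Obj[OF diagram] by (simp add: comp_ftor_def hom_ftor_def)

lemma hom_diagram_mmap: "(i, k) \<in> r \<Longrightarrow> mmap (hom_diagram X) (i, k) = Arrow (hom C X (omap D i))
    (\<lambda>g\<in>hom C X (omap D i). Comp C (mmap D (i, k)) g) (hom C X (omap D k))"
  using diagram_hom[of i k] by (simp add: comp_ftor_def hom_ftor_def hom_def)

lemma hom_cocone: "i \<in> I \<Longrightarrow> mmap (hom_ftor C X) (c i) = Arrow (hom C X (omap D i))
    (\<lambda>g\<in>hom C X (omap D i). Comp C (c i) g) (hom C X L)"
  using cocone_hom[of i] by (simp add: hom_ftor_def hom_def)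

lemma hom_colimit: "omap (hom_ftor C X) L = hom C X L"
  using colimit_Obj by (simp add: hom_ftor_def)

lemma cocone_comp_assoc:
  assumes "(i, k) \<in> r" and g: "g \<in> hom C X (omap D i)"
  shows "Comp C (c k) (Comp C (mmap D (i, k)) g) = Comp C (c i) g"
proof -
  have "k \<in> I" using assms(1) directed_posetD(1)[OF directed] by auto
  then show ?thesis
    using Comp_assoc[OF g diagram_hom[OF assms(1)] cocone_hom] cocone_comp[OF assms(1)] by simp
qed

end

text \<open>The two parts of \<open>lift\<close> say that the maps between hom-sets are jointly onto
  and that elements with equal image are already identified at a later stage. For a directed diagram
  of sets this makes a cocone a colimit: the comparison map is defined on any chosen factorization,
  and the choice is irrelevant.\<close>

lemma (in category) finitely_presentableI:
  assumes X: "X \<in> Obj C"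
    and lift: "\<And>(I :: 'u set) r D L c. \<lbrakk>small U I; directed_poset I r;
      is_functor (poset_cat I r) C D; is_colimit (poset_cat I r) C D L c\<rbrakk> \<Longrightarrow>
      (\<forall>\<phi>\<in>hom C X L. \<exists>i\<in>I. \<exists>\<psi>\<in>hom C X (omap D i). Comp C (c i) \<psi> = \<phi>) \<and>
      (\<forall>i\<in>I. \<forall>\<alpha>\<in>hom C X (omap D i). \<forall>\<beta>\<in>hom C X (omap D i).
         Comp C (c i) \<alpha> = Comp C (c i) \<beta> \<longrightarrow>
         (\<exists>k. (i, k) \<in> r \<and> Comp C (mmap D (i, k)) \<alpha> = Comp C (mmap D (i, k)) \<beta>))"
  shows "finitely_presentable (U :: 'u itself) C X"
  unfolding finitely_presentable_def preserves_directed_colimits_def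
proof (intro conjI X allI impI, elim conjE)
  fix I :: "'u set" and r D L c
  assume small: "small U I" and dir: "directed_poset I r"
    and D: "is_functor (poset_cat I r) C D" and colim: "is_colimit (poset_cat I r) C D L c"
  note r = directed_posetD[OF dir]
  note lift = lift[OF small dir D colim]
  let ?J = "poset_cat I r" and ?S = "set_cat UNIV" and ?H = "hom_ftor C X"
  let ?HD = "comp_ftor ?J ?H D"
  interpret directed_colimit C I r D L c
    by unfold_locales fact+
  note L = colimit_Obj and c = cocone_hom and c_comp = cocone_comp and Dm = diagram_hom
    and HDo = hom_diagram_omap and HDm = hom_diagram_mmap and Hc = hom_cocone and HL = hom_colimit
  show "is_colimit ?J ?S ?HD (omap ?H L) (\<lambda>i. mmap ?H (c i))"
    unfolding is_colimit_def
  proof (intro conjI allI impI)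
    show "cocone ?J ?S ?HD (omap ?H L) (\<lambda>i. mmap ?H (c i))"
      unfolding cocone_def
    proof (intro conjI ballI)
      show "omap ?H L \<in> Obj ?S" by (simp add: set_cat_simps)
      show "mmap ?H (c i) \<in> hom ?S (omap ?HD i) (omap ?H L)" if "i \<in> Obj ?J" for i
        using that by (auto simp: HDo Hc HL set_cat_simps intro: Comp_in c)
      show "Comp ?S (mmap ?H (c (Cod ?J k))) (mmap ?HD k) = mmap ?H (c (Dom ?J k))"
        if "k \<in> Mor ?J" for k
      proof -
        obtain i j where k: "k = (i, j)" "(i, j) \<in> r" "i \<in> I" "j \<in> I"
          using \<open>k \<in> Mor ?J\<close> r(1) by (cases k) auto
        show ?thesis
          using k Dm[OF k(2)] by (auto simp: HDm Hc set_cat_simps Comp_in cocone_comp_assoc intro!: restrict_ext)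
      qed
    qed
  next
    fix Y d assume cc: "cocone ?J ?S ?HD Y d"
    have d: "\<exists>h\<in>hom C X (omap D i) \<rightarrow>\<^sub>E Y. d i = Arrow (hom C X (omap D i)) h Y" if "i \<in> I" for i
      using cc that HDo[OF that] by (fastforce simp: cocone_def set_cat_simps)
    have d_in: "fn (d i) g \<in> Y" if "i \<in> I" "g \<in> hom C X (omap D i)" for i g
      using d[OF that(1)] that(2) by auto
    have d_comp: "fn (d k) (Comp C (mmap D (i, k)) g) = fn (d i) g"
      if "(i, k) \<in> r" "g \<in> hom C X (omap D i)" for i k g
    proof -
      have "Comp ?S (d k) (mmap ?HD (i, k)) = d i"
        using cc that(1) by (force simp: cocone_def)
      then have "fn (Comp ?S (d k) (mmap ?HD (i, k))) g = fn (d i) g" by simp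
      then show ?thesis using that by (simp add: set_cat_simps HDm)
    qed
    \<comment> \<open>Independence of the factorization: both are moved to a common stage
      \<open>k\<close>, where they have the same image in the colimit, and then to a stage
      \<open>l\<close> where they coincide.\<close>
    have d_eq: "fn (d i) g = fn (d j) g'"
      if ij: "i \<in> I" "j \<in> I" and g: "g \<in> hom C X (omap D i)" and g': "g' \<in> hom C X (omap D j)"
        and eq: "Comp C (c i) g = Comp C (c j) g'" for i j g g'
    proof -
      obtain k where k: "k \<in> I" "(i, k) \<in> r" "(j, k) \<in> r"
        using r(4)[OF ij] by blast
      let ?g = "Comp C (mmap D (i, k)) g" and ?g' = "Comp C (mmap D (j, k)) g'"
      have in_hom: "?g \<in> hom C X (omap D k)" "?g' \<in> hom C X (omap D k)"
        using Comp_in[OF g Dm[OF k(2)]] Comp_in[OF g' Dm[OF k(3)]] .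
      have "Comp C (c k) ?g = Comp C (c k) ?g'"
        using cocone_comp_assoc[OF k(2) g] cocone_comp_assoc[OF k(3) g'] eq by simp
      then obtain l where l: "(k, l) \<in> r" "Comp C (mmap D (k, l)) ?g = Comp C (mmap D (k, l)) ?g'"
        using lift in_hom k(1) by blast
      have "fn (d i) g = fn (d l) (Comp C (mmap D (k, l)) ?g)"
        using d_comp[OF k(2) g] d_comp[OF l(1) in_hom(1)] by simp
      also have "\<dots> = fn (d j) g'"
        using d_comp[OF k(3) g'] d_comp[OF l(1) in_hom(2)] l(2) by simp
      finally show ?thesis .
    qed
    have "\<forall>\<phi>\<in>hom C X L. \<exists>p. fst p \<in> I \<and> snd p \<in> hom C X (omap D (fst p)) \<and> Comp C (c (fst p)) (snd p) = \<phi>"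
      using lift by force
    then obtain p where p: "\<And>\<phi>. \<phi> \<in> hom C X L \<Longrightarrow>
        fst (p \<phi>) \<in> I \<and> snd (p \<phi>) \<in> hom C X (omap D (fst (p \<phi>))) \<and> Comp C (c (fst (p \<phi>))) (snd (p \<phi>)) = \<phi>"
      by metis
    define h where "h = Arrow (hom C X L) (\<lambda>\<phi>\<in>hom C X L. fn (d (fst (p \<phi>))) (snd (p \<phi>))) Y"
    have h_hom: "h \<in> hom ?S (omap ?H L) Y"
      using p d_in by (auto simp: h_def HL set_cat_simps)
    have h_app: "fn h (Comp C (c i) g) = fn (d i) g" if i: "i \<in> I" and g: "g \<in> hom C X (omap D i)" for i g
    proof -
      have *: "Comp C (c i) g \<in> hom C X L" using g c[OF i] by (rule Comp_in)
      from p[OF *] have "fn (d (fst (p (Comp C (c i) g)))) (snd (p (Comp C (c i) g))) = fn (d i) g"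
        by (intro d_eq i g) auto
      then show ?thesis
        using * by (simp add: h_def)
    qed
    have h_c: "Comp ?S h (mmap ?H (c i)) = d i" if i: "i \<in> I" for i
    proof -
      obtain q where q: "q \<in> hom C X (omap D i) \<rightarrow>\<^sub>E Y" "d i = Arrow (hom C X (omap D i)) q Y"
        using d[OF i] by blast
      have "(\<lambda>g\<in>hom C X (omap D i). fn h (Comp C (c i) g)) = q"
        using h_app[OF i] q by (intro PiE_ext[OF _ q(1)]) auto
      moreover have "tgt h = Y" by (simp add: h_def)
      ultimately show ?thesis
        using q i by (simp add: Hc set_cat_simps cong: restrict_cong)
    qed
    show "\<exists>!h. h \<in> hom ?S (omap ?H L) Y \<and> (\<forall>i\<in>Obj ?J. Comp ?S h (mmap ?H (c i)) = d i)"
    proof (intro ex1I[of _ h] conjI ballI)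
      show "h \<in> hom ?S (omap ?H L) Y" by (rule h_hom)
      show "Comp ?S h (mmap ?H (c i)) = d i" if "i \<in> Obj ?J" for i
        using that h_c by simp
      fix h' assume h': "h' \<in> hom ?S (omap ?H L) Y \<and> (\<forall>i\<in>Obj ?J. Comp ?S h' (mmap ?H (c i)) = d i)"
      have "fn h' \<phi> = fn h \<phi>" if \<phi>: "\<phi> \<in> hom C X L" for \<phi>
      proof -
        have "fn (Comp ?S h' (mmap ?H (c (fst (p \<phi>))))) (snd (p \<phi>)) =
            fn (Comp ?S h (mmap ?H (c (fst (p \<phi>))))) (snd (p \<phi>))"
          using h' h_c p[OF \<phi>] by simp
        then show ?thesis using p[OF \<phi>] by (simp add: set_cat_simps Hc)
      qed
      moreover have "fn h \<in> hom C X L \<rightarrow>\<^sub>E Y" "fn h' \<in> hom C X L \<rightarrow>\<^sub>E Y"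
        "src h = hom C X L" "src h' = hom C X L" "tgt h = Y" "tgt h' = Y"
        using h_hom h' by (auto simp: HL set_cat_simps)
      ultimately show "h' = h"
        by (metis PiE_ext arrow.expand)
    qed
  qed
qed

text \<open>In sets, a colimit is the union of the images of its cocone maps. The applications take
  an identity for \<phi>, so that the object becomes a retract of a stage of the diagram.\<close>

lemma (in category) finitely_presentable_factor:
  assumes fp: "finitely_presentable (U :: 'u itself) C X"
    and I: "small U (I :: 'u set)" "directed_poset I r"
    and D: "is_functor (poset_cat I r) C D" and colim: "is_colimit (poset_cat I r) C D L c"
    and \<phi>: "\<phi> \<in> hom C X L"
  shows "\<exists>i\<in>I. \<exists>\<psi>\<in>hom C X (omap D i). Comp C (c i) \<psi> = \<phi>"
proof -
  let ?J = "poset_cat I r" and ?S = "set_cat UNIV" and ?H = "hom_ftor C X"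
  let ?HD = "comp_ftor ?J ?H D"
  have Hcolim: "is_colimit ?J ?S ?HD (omap ?H L) (\<lambda>i. mmap ?H (c i))"
    using fp I D colim unfolding finitely_presentable_def preserves_directed_colimits_def by blast
  interpret directed_colimit C I r D L c
    by unfold_locales fact+
  note L = colimit_Obj and c = cocone_hom and c_comp = cocone_comp and Dm = diagram_hom
    and HDo = hom_diagram_omap and HDm = hom_diagram_mmap and Hc = hom_cocone and HL = hom_colimit
  define M where "M = (\<Union>i\<in>I. Comp C (c i) ` hom C X (omap D i))"
  have M: "M \<subseteq> hom C X L"
    using c Comp_in by (fastforce simp: M_def)
  define d where "d i = Arrow (hom C X (omap D i)) (\<lambda>g\<in>hom C X (omap D i). Comp C (c i) g) M" for i
  have "cocone ?J ?S ?HD M d"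
    unfolding cocone_def
  proof (intro conjI ballI)
    show "M \<in> Obj ?S" by (simp add: set_cat_simps)
    show "d i \<in> hom ?S (omap ?HD i) M" if "i \<in> Obj ?J" for i
      using that by (auto simp: HDo d_def M_def set_cat_simps)
    show "Comp ?S (d (Cod ?J k)) (mmap ?HD k) = d (Dom ?J k)" if "k \<in> Mor ?J" for k
    proof -
      obtain i j where k: "k = (i, j)" "(i, j) \<in> r" "i \<in> I" "j \<in> I"
        using \<open>k \<in> Mor ?J\<close> directed_posetD(1)[OF I(2)] by (cases k) auto
      show ?thesis
        using k Dm[OF k(2)] by (auto simp: HDm d_def set_cat_simps Comp_in cocone_comp_assoc intro!: restrict_ext)
    qed
  qed
  then obtain h where h: "h \<in> hom ?S (hom C X L) M" "\<And>i. i \<in> I \<Longrightarrow> Comp ?S h (mmap ?H (c i)) = d i"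
    using Hcolim unfolding is_colimit_def by (metis HL poset_cat_simps(1))
  \<comment> \<open>Composing with the inclusion of the joint image \<open>M\<close> gives an endomorphism of the colimit
    cocone, which must be the identity.\<close>
  define h' where "h' = Arrow (hom C X L) (fn h) (hom C X L)"
  have h': "h' \<in> hom ?S (hom C X L) (hom C X L)"
    using h(1) M by (auto simp: h'_def set_cat_simps)
  have "Comp ?S h' (mmap ?H (c i)) = mmap ?H (c i)" if "i \<in> I" for i
    using h(2)[OF that] that by (simp add: Hc d_def h'_def set_cat_simps)
  moreover have "Id ?S (hom C X L) \<in> hom ?S (hom C X L) (hom C X L)"
    by (auto simp: set_cat_simps)
  moreover have "Comp ?S (Id ?S (hom C X L)) (mmap ?H (c i)) = mmap ?H (c i)" if "i \<in> I" for i
    using that c[OF that] by (auto simp: Hc set_cat_simps Comp_in intro!: restrict_ext)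
  moreover have "cocone ?J ?S ?HD (hom C X L) (\<lambda>i. mmap ?H (c i))"
    using Hcolim by (simp add: is_colimit_def HL)
  ultimately have "h' = Id ?S (hom C X L)"
    using Hcolim h' unfolding is_colimit_def HL by (metis poset_cat_simps(1))
  then have "fn h \<phi> = \<phi>"
    using \<phi> by (simp add: h'_def set_cat_simps)
  moreover have "fn h \<phi> \<in> M"
    using h(1) \<phi> by (auto simp: set_cat_simps)
  ultimately show ?thesis
    by (auto simp: M_def)
qed

subsection \<open>Colimits of presheaves\<close>

context presheaves
begin

lemma cocone_app_comp:
  assumes "cocone J PSh D L c" and D: "is_functor J PSh D"
    and k: "k \<in> Mor J" and "a \<in> Obj A" "x \<in> omap (omap D (Dom J k)) a"
  shows "app (c (Cod J k)) a (app (mmap D k) a x) = app (c (Dom J k)) a x"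
  using assms app_Comp[OF is_functor_hom[OF D k]] unfolding cocone_def by metis

text \<open>\<open>sep\<close> refers to all competing cocones instead of a generated equivalence
  relation. In this form it serves both the explicit quotient in \<open>colimit_exists\<close> and
  the directed unions in \<open>directed_colimitI\<close>.\<close>

lemma presheaf_colimitI:
  assumes D: "is_functor J PSh D" and cc: "cocone J PSh D L c"
    and surj: "\<And>a z. a \<in> Obj A \<Longrightarrow> z \<in> omap L a \<Longrightarrow>
           \<exists>i\<in>Obj J. \<exists>x\<in>omap (omap D i) a. app (c i) a x = z"
    and sep: "\<And>a i j x y Y d. \<lbrakk>a \<in> Obj A; i \<in> Obj J; j \<in> Obj J; x \<in> omap (omap D i) a;
           y \<in> omap (omap D j) a; app (c i) a x = app (c j) a y; cocone J PSh D Y d\<rbrakk> \<Longrightarrow>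
           app (d i) a x = app (d j) a y"
  shows "is_colimit J PSh D L c"
  unfolding is_colimit_def
proof (intro conjI allI impI cc)
  fix Y d assume dc: "cocone J PSh D Y d"
  have L: "L \<in> Obj PSh" and Y: "Y \<in> Obj PSh"
    and c: "\<And>i. i \<in> Obj J \<Longrightarrow> c i \<in> hom PSh (omap D i) L"
    and d: "\<And>i. i \<in> Obj J \<Longrightarrow> d i \<in> hom PSh (omap D i) Y"
    using cc dc by (auto simp: cocone_def)
  have "\<forall>a z. \<exists>p. a \<in> Obj A \<longrightarrow> z \<in> omap L a \<longrightarrow>
      fst p \<in> Obj J \<and> snd p \<in> omap (omap D (fst p)) a \<and> app (c (fst p)) a (snd p) = z"
    using surj by fastforce
  then obtain p where p: "\<And>a z. a \<in> Obj A \<Longrightarrow> z \<in> omap L a \<Longrightarrow>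
      fst (p a z) \<in> Obj J \<and> snd (p a z) \<in> omap (omap D (fst (p a z))) a \<and>
      app (c (fst (p a z))) a (snd (p a z)) = z"
    by metis
  let ?\<eta> = "\<lambda>a z. app (d (fst (p a z))) a (snd (p a z))"
  have \<eta>_c: "?\<eta> a (app (c i) a x) = app (d i) a x"
    if "a \<in> Obj A" "i \<in> Obj J" "x \<in> omap (omap D i) a" for a i x
    using p[OF that(1) app_in[OF c[OF that(2)] that(1,3)]] that by (intro sep[OF _ _ _ _ _ _ dc]) auto
  have h: "mknt L ?\<eta> Y \<in> hom PSh L Y"
  proof (rule mknt_hom[OF L Y])
    show "?\<eta> a z \<in> omap Y a" if "a \<in> Obj A" "z \<in> omap L a" for a z
      using p[OF that] app_in[OF d that(1)] by blast
    show "?\<eta> (Dom A f) (act L f z) = act Y f (?\<eta> (Cod A f) z)"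
      if f: "f \<in> Mor A" and z: "z \<in> omap L (Cod A f)" for f z
    proof -
      obtain i x where ix: "i \<in> Obj J" "x \<in> omap (omap D i) (Cod A f)" "z = app (c i) (Cod A f) x"
        using surj[OF Cod_in[OF f] z] by blast
      have "act L f z = app (c i) (Dom A f) (act (omap D i) f x)"
        using app_act[OF c[OF ix(1)] f ix(2)] ix(3) by simp
      moreover have "act (omap D i) f x \<in> omap (omap D i) (Dom A f)"
        by (rule act_in[OF is_functor_Obj[OF D ix(1)] f ix(2)])
      ultimately have "?\<eta> (Dom A f) (act L f z) = app (d i) (Dom A f) (act (omap D i) f x)"
        using \<eta>_c[OF Dom_in[OF f] ix(1)] by simp
      also have "\<dots> = act Y f (?\<eta> (Cod A f) z)"
        using app_act[OF d[OF ix(1)] f ix(2)] \<eta>_c[OF Cod_in[OF f] ix(1,2)] ix(3) by simp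
      finally show ?thesis .
    qed
  qed
  have h_app: "app (mknt L ?\<eta> Y) a (app (c i) a x) = app (d i) a x"
    if "a \<in> Obj A" "i \<in> Obj J" "x \<in> omap (omap D i) a" for a i x
    using \<eta>_c[OF that] app_mknt[OF that(1) app_in[OF c[OF that(2)] that(1,3)]] by simp
  show "\<exists>!h. h \<in> hom PSh L Y \<and> (\<forall>i\<in>Obj J. Comp PSh h (c i) = d i)"
  proof (intro ex1I[of _ "mknt L ?\<eta> Y"] conjI ballI h)
    show "Comp PSh (mknt L ?\<eta> Y) (c i) = d i" if "i \<in> Obj J" for i
      by (rule psh_mor_eqI[OF Comp_PSh_hom[OF c h] d]) (simp_all add: that app_Comp[OF c] h_app)
    fix h' assume h': "h' \<in> hom PSh L Y \<and> (\<forall>i\<in>Obj J. Comp PSh h' (c i) = d i)"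
    show "h' = mknt L ?\<eta> Y"
    proof (rule psh_mor_eqI[OF conjunct1[OF h'] h])
      fix a z assume a: "a \<in> Obj A" and "z \<in> omap L a"
      then obtain i x where ix: "i \<in> Obj J" "x \<in> omap (omap D i) a" "z = app (c i) a x"
        using surj by blast
      have "app (Comp PSh h' (c i)) a x = app (d i) a x"
        using h' ix(1) by simp
      then show "app h' a z = app (mknt L ?\<eta> Y) a z"
        using app_Comp[OF c[OF ix(1)] a ix(2)] h_app[OF a ix(1,2)] ix(3) by simp
    qed
  qed
qed

definition diagram_elements ::
    "('i, 'k) cat \<Rightarrow> ('i, 'k, ('o, 'm, 'u) psh, ('o, 'm, 'u) psh_mor) ftor \<Rightarrow> 'o \<Rightarrow> ('i \<times> 'u) set" where
  "diagram_elements J D a = Sigma (Obj J) (\<lambda>i. omap (omap D i) a)"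

text \<open>The intersection of these relations is the identification made by the colimit at
  \<open>a\<close>. Quantifying over all of them replaces any description by zigzags.\<close>

definition diagram_congruence ::
    "('i, 'k) cat \<Rightarrow> ('i, 'k, ('o, 'm, 'u) psh, ('o, 'm, 'u) psh_mor) ftor \<Rightarrow> 'o \<Rightarrow>
      ('i \<times> 'u) rel \<Rightarrow> bool" where
  "diagram_congruence J D a R \<longleftrightarrow> equiv (diagram_elements J D a) R \<and>
     (\<forall>k\<in>Mor J. \<forall>x\<in>omap (omap D (Dom J k)) a.
        ((Dom J k, x), (Cod J k, app (mmap D k) a x)) \<in> R)"

lemma equiv_Inter:
  assumes "\<And>R. R \<in> \<R> \<Longrightarrow> equiv X R" "\<R> \<noteq> {}"
  shows "equiv X (\<Inter>\<R>)"
  using assms unfolding equiv_def refl_on_def sym_def trans_def by blast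

lemma equiv_preimage:
  "equiv Y R \<Longrightarrow> f ` X \<subseteq> Y \<Longrightarrow> equiv X {(p, q). p \<in> X \<and> q \<in> X \<and> (f p, f q) \<in> R}"
  unfolding equiv_def refl_on_def sym_def trans_def by blast

lemma diagram_congruence_full:
  assumes "category J" "is_functor J PSh D" "a \<in> Obj A"
  shows "diagram_congruence J D a (diagram_elements J D a \<times> diagram_elements J D a)"
  using assms(3) category.Dom_in[OF assms(1)] category.Cod_in[OF assms(1)]
    app_in[OF is_functor_hom[OF assms(2)]]
  by (auto simp: diagram_congruence_def diagram_elements_def equiv_def refl_on_def sym_def trans_def)

text \<open>Colimits are pointwise: the disjoint union of the values modulo the least congruence.
  The last conclusion keeps the leastness available, so that identifications can be bounded by
  exhibiting any convenient congruence.\<close>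

lemma colimit_exists:
  assumes J: "category J" and small_J: "small U (Obj J)" and D: "is_functor J PSh D"
  obtains L c where "is_colimit J PSh D L c"
    "\<And>a z. a \<in> Obj A \<Longrightarrow> z \<in> omap L a \<Longrightarrow> \<exists>i\<in>Obj J. \<exists>x\<in>omap (omap D i) a. app (c i) a x = z"
    "\<And>a i j x y R. \<lbrakk>a \<in> Obj A; i \<in> Obj J; j \<in> Obj J; x \<in> omap (omap D i) a;
       y \<in> omap (omap D j) a; app (c i) a x = app (c j) a y; diagram_congruence J D a R\<rbrakk> \<Longrightarrow>
       ((i, x), (j, y)) \<in> R"
proof -
  let ?T = "diagram_elements J D"
  define E where "E a = \<Inter>{R. diagram_congruence J D a R}" for a
  define m where "m f p = (fst p, act (omap D (fst p)) f (snd p))" for f and p :: "'a \<times> 'u"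
  have Dobj: "\<And>i. i \<in> Obj J \<Longrightarrow> omap D i \<in> Obj PSh"
    by (rule is_functor_Obj[OF D])
  have E_equiv: "equiv (?T a) (E a)" if "a \<in> Obj A" for a
    unfolding E_def using diagram_congruence_full[OF J D that]
    by (intro equiv_Inter) (auto simp: diagram_congruence_def)
  have E_step: "((Dom J k, x), (Cod J k, app (mmap D k) a x)) \<in> E a"
    if "k \<in> Mor J" "x \<in> omap (omap D (Dom J k)) a" for k x a
    using that by (auto simp: E_def diagram_congruence_def)
  have E_least: "diagram_congruence J D a R \<Longrightarrow> E a \<subseteq> R" for a R
    by (auto simp: E_def)
  have m_in: "m f p \<in> ?T (Dom A f)" if "f \<in> Mor A" "p \<in> ?T (Cod A f)" for f p
    using that act_in[OF Dobj] by (auto simp: m_def diagram_elements_def)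
  have m_cong: "(m f p, m f q) \<in> E (Dom A f)" if f: "f \<in> Mor A" and "(p, q) \<in> E (Cod A f)" for f p q
  proof -
    \<comment> \<open>Pulling the least congruence at \<open>Dom A f\<close> back along restriction
      gives a congruence at \<open>Cod A f\<close>, which therefore contains the least one there.
      Hence restriction descends to classes.\<close>
    let ?R = "{(p, q). p \<in> ?T (Cod A f) \<and> q \<in> ?T (Cod A f) \<and> (m f p, m f q) \<in> E (Dom A f)}"
    have "diagram_congruence J D (Cod A f) ?R"
      unfolding diagram_congruence_def
    proof (intro conjI ballI)
      show "equiv (?T (Cod A f)) ?R"
        by (rule equiv_preimage[OF E_equiv]) (use f m_in in \<open>auto simp: Dom_in\<close>)
      fix k x assume k: "k \<in> Mor J" and x: "x \<in> omap (omap D (Dom J k)) (Cod A f)"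
      note kk = category.Dom_in[OF J k] category.Cod_in[OF J k] is_functor_hom[OF D k]
      have "((Dom J k, act (omap D (Dom J k)) f x),
          (Cod J k, app (mmap D k) (Dom A f) (act (omap D (Dom J k)) f x))) \<in> E (Dom A f)"
        by (rule E_step[OF k act_in[OF Dobj[OF kk(1)] f x]])
      then show "((Dom J k, x), (Cod J k, app (mmap D k) (Cod A f) x)) \<in> ?R"
        using kk(1,2) x app_in[OF kk(3) Cod_in[OF f] x]
        by (simp add: m_def app_act[OF kk(3) f x] diagram_elements_def)
    qed
    from E_least[OF this] show ?thesis using that(2) by blast
  qed
  have small_T: "small U (?T a)" if "a \<in> Obj A" for a
    unfolding diagram_elements_def by (intro small_Sigma regular small_J small_psh Dobj that)
  have "\<exists>e :: 'a \<times> 'u \<Rightarrow> 'u. a \<in> Obj A \<longrightarrow> inj_on e (?T a)" for a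
    using small_T[of a] small_embedding by metis
  then obtain e :: "'o \<Rightarrow> 'a \<times> 'u \<Rightarrow> 'u" where e: "\<And>a. a \<in> Obj A \<Longrightarrow> inj_on (e a) (?T a)"
    by metis
  \<comment> \<open>The class of \<open>p\<close>, represented inside \<open>'u\<close> by the encode of a chosen member.\<close>
  define q where "q a p = e a (SOME p'. (p, p') \<in> E a)" for a p
  have q_eq: "q a p = q a p' \<longleftrightarrow> (p, p') \<in> E a" if a: "a \<in> Obj A" and p: "p \<in> ?T a" "p' \<in> ?T a" for a p p'
  proof
    note E = E_equiv[OF a]
    assume "(p, p') \<in> E a"
    then have "(p, s) \<in> E a \<longleftrightarrow> (p', s) \<in> E a" for s
      using E unfolding equiv_def sym_def trans_def by blast
    then show "q a p = q a p'" by (simp add: q_def)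
  next
    note E = E_equiv[OF a]
    have some: "(s, SOME p'. (s, p') \<in> E a) \<in> E a" if "s \<in> ?T a" for s
      using E that by (intro someI[of "\<lambda>p'. (s, p') \<in> E a" s]) (simp add: equiv_def refl_on_def)
    have some_in: "(SOME p'. (s, p') \<in> E a) \<in> ?T a" if "s \<in> ?T a" for s
      using some[OF that] E unfolding equiv_def by blast
    assume "q a p = q a p'"
    then have "(SOME s. (p, s) \<in> E a) = (SOME s. (p', s) \<in> E a)"
      unfolding q_def by (rule inj_onD[OF e[OF a]]) (use p some_in in auto)
    then have "(p', SOME s. (p, s) \<in> E a) \<in> E a"
      using some[OF p(2)] by simp
    then show "(p, p') \<in> E a"
      using some[OF p(1)] E unfolding equiv_def by (meson symE transE)
  qed
  define X where "X a = q a ` ?T a" for a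
  define rep where "rep a z = (SOME p. p \<in> ?T a \<and> q a p = z)" for a z
  have rep: "rep a z \<in> ?T a \<and> q a (rep a z) = z" if "z \<in> X a" for a z
    unfolding rep_def by (rule someI_ex) (use that in \<open>auto simp: X_def\<close>)
  define \<alpha> where "\<alpha> f z = q (Dom A f) (m f (rep (Cod A f) z))" for f z
  have \<alpha>_q: "\<alpha> f (q (Cod A f) p) = q (Dom A f) (m f p)" if f: "f \<in> Mor A" and p: "p \<in> ?T (Cod A f)" for f p
  proof -
    have "q (Cod A f) p \<in> X (Cod A f)" using p by (simp add: X_def)
    note r = rep[OF this]
    then have "(rep (Cod A f) (q (Cod A f) p), p) \<in> E (Cod A f)"
      using q_eq[OF Cod_in[OF f]] p by blast
    then have "(m f (rep (Cod A f) (q (Cod A f) p)), m f p) \<in> E (Dom A f)"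
      by (rule m_cong[OF f])
    then show ?thesis
      unfolding \<alpha>_def using q_eq[OF Dom_in[OF f] m_in[OF f] m_in[OF f p]] r by blast
  qed
  define L where "L = mkpsh X \<alpha>"
  have L: "L \<in> Obj PSh"
    unfolding L_def
  proof (rule mkpsh_Obj)
    show "small U (X a)" if "a \<in> Obj A" for a
      unfolding X_def by (rule small_image[OF small_T[OF that]])
    show "\<alpha> f z \<in> X (Dom A f)" if "f \<in> Mor A" "z \<in> X (Cod A f)" for f z
      using that by (auto simp: X_def \<alpha>_q m_in)
    show "\<alpha> (Id A a) z = z" if a: "a \<in> Obj A" and "z \<in> X a" for a z
    proof -
      obtain p where p: "p \<in> ?T a" "z = q a p" using \<open>z \<in> X a\<close> by (auto simp: X_def)
      have "m (Id A a) p = p"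
        using p(1) a act_Id[OF Dobj] by (auto simp: m_def diagram_elements_def)
      then show ?thesis
        using \<alpha>_q[OF Id_Mor[OF a], of p] p a by (simp add: cat_simps)
    qed
    show "\<alpha> (Comp A g f) z = \<alpha> f (\<alpha> g z)"
      if fg: "f \<in> Mor A" "g \<in> Mor A" "Cod A f = Dom A g" and "z \<in> X (Cod A g)" for f g z
    proof -
      obtain p where p: "p \<in> ?T (Cod A g)" "z = q (Cod A g) p"
        using \<open>z \<in> X (Cod A g)\<close> by (auto simp: X_def)
      have "m (Comp A g f) p = m f (m g p)"
        using p(1) fg act_Comp[OF Dobj] by (auto simp: m_def diagram_elements_def)
      then show ?thesis
        using \<alpha>_q[OF Comp_Mor[OF fg], of p] \<alpha>_q[OF fg(2) p(1)] \<alpha>_q[OF fg(1), of "m g p"] m_in[OF fg(2) p(1)]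
          p fg by (simp add: cat_simps)
    qed
  qed
  define c where "c i = mknt (omap D i) (\<lambda>a x. q a (i, x)) L" for i
  have X_L: "omap L a = X a" if "a \<in> Obj A" for a
    using that by (simp add: L_def omap_mkpsh)
  have c: "c i \<in> hom PSh (omap D i) L" if i: "i \<in> Obj J" for i
    unfolding c_def
  proof (rule mknt_hom[OF Dobj[OF i] L])
    show "q a (i, x) \<in> omap L a" if "a \<in> Obj A" "x \<in> omap (omap D i) a" for a x
      using that i by (auto simp: X_L X_def diagram_elements_def)
    show "q (Dom A f) (i, act (omap D i) f x) = act L f (q (Cod A f) (i, x))"
      if f: "f \<in> Mor A" and x: "x \<in> omap (omap D i) (Cod A f)" for f x
    proof -
      have p: "(i, x) \<in> ?T (Cod A f)" using i x by (simp add: diagram_elements_def)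
      then have "act L f (q (Cod A f) (i, x)) = \<alpha> f (q (Cod A f) (i, x))"
        unfolding L_def using f by (intro act_mkpsh) (auto simp: X_def)
      then show ?thesis
        by (simp add: \<alpha>_q[OF f p]) (simp add: m_def)
    qed
  qed
  have c_app: "app (c i) a x = q a (i, x)" if "a \<in> Obj A" "x \<in> omap (omap D i) a" for i a x
    using that by (simp add: c_def app_mknt)
  have surj: "\<exists>i\<in>Obj J. \<exists>x\<in>omap (omap D i) a. app (c i) a x = z" if "a \<in> Obj A" "z \<in> omap L a" for a z
    using that by (auto simp: X_L X_def diagram_elements_def c_app)
  have sep: "((i, x), (j, y)) \<in> R"
    if "a \<in> Obj A" "i \<in> Obj J" "j \<in> Obj J" "x \<in> omap (omap D i) a"
       "y \<in> omap (omap D j) a" "app (c i) a x = app (c j) a y" "diagram_congruence J D a R" for a i j x y R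
    using that q_eq[OF that(1), of "(i, x)" "(j, y)"] E_least[OF that(7)]
    by (auto simp: c_app diagram_elements_def)
  have "is_colimit J PSh D L c"
  proof (rule presheaf_colimitI[OF D _ surj])
    show "cocone J PSh D L c"
      unfolding cocone_def
    proof (intro conjI ballI L c)
      fix k assume k: "k \<in> Mor J"
      note kk = category.Dom_in[OF J k] category.Cod_in[OF J k] is_functor_hom[OF D k]
      show "Comp PSh (c (Cod J k)) (mmap D k) = c (Dom J k)"
      proof (rule psh_mor_eqI[OF Comp_PSh_hom[OF kk(3) c[OF kk(2)]] c[OF kk(1)]])
        fix a x assume a: "a \<in> Obj A" and x: "x \<in> omap (omap D (Dom J k)) a"
        note y = app_in[OF kk(3) a x]
        have "q a (Dom J k, x) = q a (Cod J k, app (mmap D k) a x)"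
          using E_step[OF k x] kk(1,2) x y by (subst q_eq[OF a]) (auto simp: diagram_elements_def)
        then show "app (Comp PSh (c (Cod J k)) (mmap D k)) a x = app (c (Dom J k)) a x"
          by (simp add: app_Comp[OF kk(3) a x] c_app a x y)
      qed
    qed
    show "app (d i) a x = app (d j) a y"
      if *: "a \<in> Obj A" "i \<in> Obj J" "j \<in> Obj J" "x \<in> omap (omap D i) a"
           "y \<in> omap (omap D j) a" "app (c i) a x = app (c j) a y" and dc: "cocone J PSh D Y d"
      for a i j x y Y d
    proof -
      \<comment> \<open>Having the same image under a given cocone is a congruence, so elements
        identified in \<open>L\<close> agree in every cocone.\<close>
      let ?R = "{(p, p'). p \<in> ?T a \<and> p' \<in> ?T a \<and> app (d (fst p)) a (snd p) = app (d (fst p')) a (snd p')}"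
      have "diagram_congruence J D a ?R"
        unfolding diagram_congruence_def
      proof (intro conjI ballI)
        show "equiv (?T a) ?R"
          unfolding equiv_def refl_on_def sym_def trans_def by auto
        show "((Dom J k, x), (Cod J k, app (mmap D k) a x)) \<in> ?R"
          if k: "k \<in> Mor J" and x: "x \<in> omap (omap D (Dom J k)) a" for k x
          using cocone_app_comp[OF dc D k *(1) x] category.Dom_in[OF J k] category.Cod_in[OF J k]
            x app_in[OF is_functor_hom[OF D k] *(1) x]
          by (simp add: diagram_elements_def)
      qed
      from sep[OF * this] show ?thesis by simp
    qed
  qed
  with surj sep show ?thesis using that by blast
qed

lemma cocomplete_PSh: "cocomplete U PSh"
  unfolding cocomplete_def
proof (intro allI impI, elim conjE)
  fix J :: "('u, 'u) cat" and D
  assume "small_category U J" "is_functor J PSh D"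
  then show "\<exists>L c. is_colimit J PSh D L c"
    using colimit_exists[of J D] unfolding small_category_def by metis
qed

text \<open>The given colimit is compared with the one constructed in \<open>colimit_exists\<close>,
  where elements are known explicitly; the comparison maps \<open>h\<close> and \<open>g\<close>
  carry the description over.\<close>

lemma directed_colimit_elements:
  assumes small_I: "small U (I :: 'i set)" and dir: "directed_poset I r"
    and D: "is_functor (poset_cat I r) PSh D"
    and colim: "is_colimit (poset_cat I r) PSh D L c" and a: "a \<in> Obj A"
  shows "z \<in> omap L a \<Longrightarrow> \<exists>i\<in>I. \<exists>x\<in>omap (omap D i) a. app (c i) a x = z"
    and "\<lbrakk>i \<in> I; j \<in> I; x \<in> omap (omap D i) a; y \<in> omap (omap D j) a;
      app (c i) a x = app (c j) a y\<rbrakk> \<Longrightarrow>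
      \<exists>k. (i, k) \<in> r \<and> (j, k) \<in> r \<and> app (mmap D (i, k)) a x = app (mmap D (j, k)) a y"
proof -
  let ?J = "poset_cat I r"
  note r = directed_posetD[OF dir]
  interpret PSh: category PSh by (rule category_PSh)
  obtain L' c' where colim': "is_colimit ?J PSh D L' c'"
    and surj: "\<And>a z. a \<in> Obj A \<Longrightarrow> z \<in> omap L' a \<Longrightarrow> \<exists>i\<in>I. \<exists>x\<in>omap (omap D i) a. app (c' i) a x = z"
    and sep: "\<And>a i j x y R. \<lbrakk>a \<in> Obj A; i \<in> I; j \<in> I; x \<in> omap (omap D i) a;
       y \<in> omap (omap D j) a; app (c' i) a x = app (c' j) a y; diagram_congruence ?J D a R\<rbrakk> \<Longrightarrow>
       ((i, x), (j, y)) \<in> R"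
    using colimit_exists[OF category_poset_cat[OF dir] _ D] small_I by (metis poset_cat_simps(1))
  have L: "L \<in> Obj PSh" and c: "\<And>i. i \<in> I \<Longrightarrow> c i \<in> hom PSh (omap D i) L"
    and cc: "cocone ?J PSh D L c" and cc': "cocone ?J PSh D L' c'"
    and c': "\<And>i. i \<in> I \<Longrightarrow> c' i \<in> hom PSh (omap D i) L'"
    using colim colim' by (auto simp: is_colimit_def cocone_def)
  obtain h where h: "h \<in> hom PSh L L'" "\<And>i. i \<in> I \<Longrightarrow> Comp PSh h (c i) = c' i"
    using colim cc' unfolding is_colimit_def by (metis poset_cat_simps(1))
  obtain g where g: "g \<in> hom PSh L' L" "\<And>i. i \<in> I \<Longrightarrow> Comp PSh g (c' i) = c i"
    using colim' cc unfolding is_colimit_def by (metis poset_cat_simps(1))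
  have gh: "Comp PSh g h = Id PSh L"
  proof -
    have "Comp PSh (Comp PSh g h) (c i) = c i" if "i \<in> I" for i
      using PSh.Comp_assoc[OF c[OF that] h(1) g(1)] h(2) g(2) that by simp
    moreover have "Comp PSh (Id PSh L) (c i) = c i" if "i \<in> I" for i
      using PSh.Id_left[OF c[OF that]] .
    ultimately show ?thesis
      using colim cc PSh.Comp_in[OF h(1) g(1)] PSh.Id_in[OF L]
      unfolding is_colimit_def by (metis poset_cat_simps(1))
  qed
  show "\<exists>i\<in>I. \<exists>x\<in>omap (omap D i) a. app (c i) a x = z" if z: "z \<in> omap L a"
  proof -
    obtain i x where ix: "i \<in> I" "x \<in> omap (omap D i) a" "app (c' i) a x = app h a z"
      using surj[OF a app_in[OF h(1) a z]] by blast
    have "app (c i) a x = app (Comp PSh g (c' i)) a x"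
      using g(2)[OF ix(1)] by simp
    also have "\<dots> = app (Comp PSh g h) a z"
      by (simp add: app_Comp[OF c'[OF ix(1)] a ix(2)] app_Comp[OF h(1) a z] ix(3))
    also have "\<dots> = z"
      by (simp add: gh app_Id a z)
    finally show ?thesis using ix by blast
  qed
  show "\<exists>k. (i, k) \<in> r \<and> (j, k) \<in> r \<and> app (mmap D (i, k)) a x = app (mmap D (j, k)) a y"
    if ij: "i \<in> I" "j \<in> I" and x: "x \<in> omap (omap D i) a" and y: "y \<in> omap (omap D j) a"
      and eq: "app (c i) a x = app (c j) a y"
  proof -
    have "app (c' i) a x = app (c' j) a y"
      using eq app_Comp[OF c[OF ij(1)] a x, of h] app_Comp[OF c[OF ij(2)] a y, of h] h(2) ij by simp
    moreover
    let ?T = "diagram_elements ?J D a"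
    let ?t = "\<lambda>p k. app (mmap D (fst p, k)) a (snd p)"
    \<comment> \<open>Directedness makes the relation of becoming equal at a later stage transitive.
      It is then a congruence and contains all identifications of the constructed colimit.\<close>
    let ?R = "{(p, q). p \<in> ?T \<and> q \<in> ?T \<and> (\<exists>k. (fst p, k) \<in> r \<and> (fst q, k) \<in> r \<and> ?t p k = ?t q k)}"
    have Dhom: "mmap D (i, k) \<in> hom PSh (omap D i) (omap D k)" if "(i, k) \<in> r" for i k
      using is_functor_hom[OF D, of "(i, k)"] that by simp
    have t_trans: "app (mmap D (k, l)) a (?t p k) = ?t p l"
      if "p \<in> ?T" "(fst p, k) \<in> r" "(k, l) \<in> r" for p k l
      using that poset_functor_Comp[OF D that(2,3)] app_Comp[OF Dhom[OF that(2)] a]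
      by (auto simp: diagram_elements_def)
    have "diagram_congruence ?J D a ?R"
      unfolding diagram_congruence_def
    proof (intro conjI ballI)
      show "equiv ?T ?R"
      proof (rule equivI)
        show "?R \<subseteq> ?T \<times> ?T" by auto
        show "refl_on ?T ?R"
          using r(2) by (auto simp: refl_on_def diagram_elements_def)
        show "sym ?R" unfolding sym_def by auto
        show "trans ?R"
        proof (rule transI)
          fix p q s assume "(p, q) \<in> ?R" "(q, s) \<in> ?R"
          then obtain k l where pqs: "p \<in> ?T" "q \<in> ?T" "s \<in> ?T"
            and k: "(fst p, k) \<in> r" "(fst q, k) \<in> r" "?t p k = ?t q k"
            and l: "(fst q, l) \<in> r" "(fst s, l) \<in> r" "?t q l = ?t s l" by auto
          obtain n where n: "(k, n) \<in> r" "(l, n) \<in> r"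
            using r(1) r(4)[of k l] k(1) l(1) by blast
          have "?t p n = ?t s n"
            using t_trans[OF pqs(1) k(1) n(1)] t_trans[OF pqs(2) k(2) n(1)]
              t_trans[OF pqs(2) l(1) n(2)] t_trans[OF pqs(3) l(2) n(2)] k(3) l(3) by simp
          then show "(p, s) \<in> ?R"
            using pqs r(3)[OF k(1) n(1)] r(3)[OF l(2) n(2)] by blast
        qed
      qed
      fix k x assume k: "k \<in> Mor ?J" and x: "x \<in> omap (omap D (Dom ?J k)) a"
      obtain i j where ij: "k = (i, j)" "(i, j) \<in> r" "i \<in> I" "j \<in> I"
        using k r(1) by (cases k) auto
      have "mmap D (j, j) = Id PSh (omap D j)"
        using D ij(4) unfolding is_functor_def by simp
      moreover have "app (mmap D (i, j)) a x \<in> omap (omap D j) a"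
        using app_in[OF Dhom[OF ij(2)] a] x ij(1) by simp
      ultimately have "?t (j, app (mmap D (i, j)) a x) j = ?t (i, x) j"
        using a by (simp add: app_Id)
      then show "((Dom ?J k, x), (Cod ?J k, app (mmap D k) a x)) \<in> ?R"
        using ij x r(2)[OF ij(4)] \<open>app (mmap D (i, j)) a x \<in> omap (omap D j) a\<close>
        by (auto simp: diagram_elements_def)
    qed
    ultimately have "((i, x), (j, y)) \<in> ?R"
      using sep[OF a ij x y] by blast
    then show ?thesis by auto
  qed
qed

text \<open>The case of a directed union: elements with equal image in \<open>L\<close> are moved to
  a common stage, and injectivity of its cocone map shows that they are equal there.\<close>

lemma directed_colimitI:
  assumes dir: "directed_poset I r" and D: "is_functor (poset_cat I r) PSh D"
    and cc: "cocone (poset_cat I r) PSh D L c"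
    and surj: "\<And>a z. a \<in> Obj A \<Longrightarrow> z \<in> omap L a \<Longrightarrow> \<exists>i\<in>I. \<exists>x\<in>omap (omap D i) a. app (c i) a x = z"
    and inj: "\<And>a i x y. \<lbrakk>a \<in> Obj A; i \<in> I; x \<in> omap (omap D i) a; y \<in> omap (omap D i) a;
           app (c i) a x = app (c i) a y\<rbrakk> \<Longrightarrow> x = y"
  shows "is_colimit (poset_cat I r) PSh D L c"
proof (rule presheaf_colimitI[OF D cc])
  show "\<exists>i\<in>Obj (poset_cat I r). \<exists>x\<in>omap (omap D i) a. app (c i) a x = z"
    if "a \<in> Obj A" "z \<in> omap L a" for a z
    using surj[OF that] by simp
  fix a i j x y Y d
  assume a: "a \<in> Obj A" and "i \<in> Obj (poset_cat I r)" "j \<in> Obj (poset_cat I r)"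
    and x: "x \<in> omap (omap D i) a" and y: "y \<in> omap (omap D j) a"
    and eq: "app (c i) a x = app (c j) a y" and dc: "cocone (poset_cat I r) PSh D Y d"
  then obtain k where k: "k \<in> I" "(i, k) \<in> r" "(j, k) \<in> r"
    using directed_posetD(4)[OF dir] by auto
  have Dhom: "mmap D (i, k) \<in> hom PSh (omap D i) (omap D k)" if "(i, k) \<in> r" for i k
    using is_functor_hom[OF D, of "(i, k)"] that by simp
  have "app (c k) a (app (mmap D (i, k)) a x) = app (c k) a (app (mmap D (j, k)) a y)"
    using cocone_app_comp[OF cc D, of "(i, k)" a x] cocone_app_comp[OF cc D, of "(j, k)" a y] k a x y eq
    by simp
  then have "app (mmap D (i, k)) a x = app (mmap D (j, k)) a y"
    by (rule inj[OF a k(1) app_in[OF Dhom[OF k(2)] a x] app_in[OF Dhom[OF k(3)] a y]])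
  then show "app (d i) a x = app (d j) a y"
    using cocone_app_comp[OF dc D, of "(i, k)" a x] cocone_app_comp[OF dc D, of "(j, k)" a y] k a x y
    by simp
qed

end

subsection \<open>Graduated categories are DCC categories\<close>

lemma (in category) mono_mor_cancel:
  assumes m: "m \<in> hom C Y Z" and h: "h \<in> hom C X Y" and mono: "mono_mor C (Comp C m h)"
  shows "mono_mor C h"
  unfolding mono_mor_def
proof (intro conjI ballI impI)
  show "h \<in> Mor C" using h by (simp add: hom_def)
  have X: "Dom C h = X" "Dom C (Comp C m h) = X"
    using h Comp_in[OF h m] by (simp_all add: hom_def)
  fix W f g assume W: "W \<in> Obj C" and fg: "f \<in> hom C W (Dom C h)" "g \<in> hom C W (Dom C h)"
    and "Comp C h f = Comp C h g"
  then have "Comp C (Comp C m h) f = Comp C (Comp C m h) g"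
    using Comp_assoc[of f W X h Y m Z] Comp_assoc[of g W X h Y m Z] h m X by simp
  then show "f = g"
    using mono W fg unfolding mono_mor_def X by blast
qed

lemma (in category) epi_mor_cancel:
  assumes e: "e \<in> hom C X Y" and h: "h \<in> hom C Y Z" and epi: "epi_mor C (Comp C h e)"
  shows "epi_mor C h"
  unfolding epi_mor_def
proof (intro conjI ballI impI)
  show "h \<in> Mor C" using h by (simp add: hom_def)
  have Z: "Cod C h = Z" "Cod C (Comp C h e) = Z"
    using h Comp_in[OF e h] by (simp_all add: hom_def)
  fix W f g assume W: "W \<in> Obj C" and fg: "f \<in> hom C (Cod C h) W" "g \<in> hom C (Cod C h) W"
    and "Comp C f h = Comp C g h"
  then have "Comp C f (Comp C h e) = Comp C g (Comp C h e)"
    using Comp_assoc[of e X Y h Z f W] Comp_assoc[of e X Y h Z g W] h e Z by simp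
  then show "f = g"
    using epi W fg unfolding epi_mor_def Z by blast
qed

text \<open>A square for \<open>h\<close> becomes a square for the composite after precomposition
  with \<open>e\<close>. The diagonal found there also fits the original square, as the epimorphism
  \<open>e\<close> can be cancelled.\<close>

lemma (in category) strong_epi_mor_cancel:
  assumes e: "e \<in> hom C X Y" and h: "h \<in> hom C Y Z"
    and epi_e: "epi_mor C e" and strong: "strong_epi_mor C (Comp C h e)"
  shows "strong_epi_mor C h"
  unfolding strong_epi_mor_def
proof (intro conjI allI impI, goal_cases)
  case 1
  show ?case using epi_mor_cancel[OF e h] strong by (simp add: strong_epi_mor_def)
next
  case (2 m u v)
  note he = Comp_in[OF e h]
  have dc: "Dom C h = Y" "Cod C h = Z" "Dom C (Comp C h e) = X" "Cod C (Comp C h e) = Z"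
    "Cod C e = Y"
    using h e he by (simp_all add: hom_def)
  have m: "m \<in> hom C (Dom C m) (Cod C m)" and u: "u \<in> hom C Y (Dom C m)"
    and v: "v \<in> hom C Z (Cod C m)" and sq: "Comp C m u = Comp C v h" and mono: "mono_mor C m"
    using 2 by (auto simp: dc mono_mor_def hom_def)
  have "Comp C m (Comp C u e) = Comp C v (Comp C h e)"
    using Comp_assoc[OF e u m] Comp_assoc[OF e h v] sq by simp
  then obtain d where d: "d \<in> hom C Z (Dom C m)" "Comp C d (Comp C h e) = Comp C u e" "Comp C m d = v"
    using strong mono Comp_in[OF e u] v unfolding strong_epi_mor_def dc by blast
  have "Comp C (Comp C d h) e = Comp C u e"
    using Comp_assoc[OF e h d(1)] d(2) by simp
  then have "Comp C d h = u"
    using epi_e Comp_in[OF h d(1)] u Dom_in[of m] m unfolding epi_mor_def dc by (auto simp: hom_def)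
  then show ?case using d by (auto simp: dc)
qed

lemma (in category) iso_mor_inverse:
  assumes "iso_mor C h" and h: "h \<in> hom C X Y"
  obtains k where "k \<in> hom C Y X" "Comp C k h = Id C X" "Comp C h k = Id C Y"
  using assms unfolding iso_mor_def hom_def by auto

lemma graduated_imp_dcc_category:
  assumes "graduated U C"
  shows "dcc_category U C"
proof -
  obtain gr :: "_ \<Rightarrow> nat" where lfp: "locally_finitely_presentable U C"
    and sub: "\<And>X m. finitely_presentable U C X \<Longrightarrow> subobject C X m \<Longrightarrow> finitely_presentable U C (Dom C m) \<and>
      gr (Dom C m) \<le> gr X \<and> (\<not> iso_mor C m \<longrightarrow> gr (Dom C m) < gr X)"
    and quot: "\<And>X e. finitely_presentable U C X \<Longrightarrow> strong_quotient C X e \<Longrightarrow> finitely_presentable U C (Cod C e) \<and>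
      gr (Cod C e) \<le> gr X \<and> (\<not> iso_mor C e \<longrightarrow> gr (Cod C e) < gr X)"
    using assms unfolding graduated_def by blast
  interpret category C using lfp by (simp add: locally_finitely_presentable_def)
  have "descending_chains_finite (subobject_le C) (subobject C X)" if fp: "finitely_presentable U C X" for X
    unfolding descending_chains_finite_def
  proof
    assume "\<exists>s. \<forall>n. subobject C X (s n) \<and> subobject_le C (s (Suc n)) (s n) \<and> \<not> subobject_le C (s n) (s (Suc n))"
    then obtain s where s: "\<And>n. subobject C X (s n)" "\<And>n. subobject_le C (s (Suc n)) (s n)"
      "\<And>n. \<not> subobject_le C (s n) (s (Suc n))" by blast
    have s_hom: "s n \<in> hom C (Dom C (s n)) X" for n
      using s(1)[of n] by (simp add: subobject_def mono_mor_def hom_def)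
    \<comment> \<open>The grade is compared along the connecting monomorphism \<open>h\<close>, a
      proper subobject of \<open>Dom C (s n)\<close>, which is finitely presentable as a subobject
      of \<open>X\<close>.\<close>
    have step: "gr (Dom C (s (Suc n))) < gr (Dom C (s n))" for n
    proof -
      obtain h where h: "h \<in> hom C (Dom C (s (Suc n))) (Dom C (s n))" "s (Suc n) = Comp C (s n) h"
        using s(2)[of n] unfolding subobject_le_def by blast
      have "mono_mor C h"
        using mono_mor_cancel[OF s_hom h(1)] s(1)[of "Suc n"] h(2) by (simp add: subobject_def)
      then have "subobject C (Dom C (s n)) h"
        using h(1) by (simp add: subobject_def hom_def)
      moreover have "\<not> iso_mor C h"
      proof
        assume "iso_mor C h"
        then obtain k where k: "k \<in> hom C (Dom C (s n)) (Dom C (s (Suc n)))" "Comp C h k = Id C (Dom C (s n))"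
          using iso_mor_inverse[OF _ h(1)] by metis
        have "s n = Comp C (s (Suc n)) k"
          using Comp_assoc[OF k(1) h(1) s_hom] h(2) k(2) Id_right[OF s_hom] by simp
        then show False using s(3)[of n] k(1) unfolding subobject_le_def by blast
      qed
      moreover have "Dom C h = Dom C (s (Suc n))" using h(1) by (simp add: hom_def)
      ultimately show ?thesis
        using sub[of "Dom C (s n)" h] sub[OF fp s(1)] by auto
    qed
    have "gr (Dom C (s n)) + n \<le> gr (Dom C (s 0))" for n
    proof (induction n)
      case (Suc n)
      then show ?case using step[of n] by linarith
    qed simp
    from this[of "Suc (gr (Dom C (s 0)))"] show False by simp
  qed
  moreover have "descending_chains_finite (quotient_le C) (strong_quotient C X)"
    if fp: "finitely_presentable U C X" for X
    unfolding descending_chains_finite_def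
  proof
    assume "\<exists>s. \<forall>n. strong_quotient C X (s n) \<and> quotient_le C (s (Suc n)) (s n) \<and> \<not> quotient_le C (s n) (s (Suc n))"
    then obtain s where s: "\<And>n. strong_quotient C X (s n)" "\<And>n. quotient_le C (s (Suc n)) (s n)"
      "\<And>n. \<not> quotient_le C (s n) (s (Suc n))" by blast
    have s_hom: "s n \<in> hom C X (Cod C (s n))" for n
      using s(1)[of n] by (simp add: strong_quotient_def strong_epi_mor_def epi_mor_def hom_def)
    \<comment> \<open>The identity is the least quotient, so descending means passing to finer
      quotients: \<open>s n\<close> is a proper quotient of \<open>s (Suc n)\<close>. Grades
      increase along the chain and the contradiction comes from the bound
      \<open>gr X\<close>.\<close>
    have step: "gr (Cod C (s n)) < gr (Cod C (s (Suc n)))" for n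
    proof -
      obtain h where h: "h \<in> hom C (Cod C (s (Suc n))) (Cod C (s n))" "s n = Comp C h (s (Suc n))"
        using s(2)[of n] unfolding quotient_le_def by blast
      have "strong_epi_mor C h"
        using strong_epi_mor_cancel[OF s_hom h(1)] s(1)[of "Suc n"] s(1)[of n] h(2)
        by (simp add: strong_quotient_def strong_epi_mor_def)
      then have "strong_quotient C (Cod C (s (Suc n))) h"
        using h(1) by (simp add: strong_quotient_def hom_def)
      moreover have "\<not> iso_mor C h"
      proof
        assume "iso_mor C h"
        then obtain k where k: "k \<in> hom C (Cod C (s n)) (Cod C (s (Suc n)))"
          "Comp C k h = Id C (Cod C (s (Suc n)))"
          using iso_mor_inverse[OF _ h(1)] by metis
        have "s (Suc n) = Comp C k (s n)"
          using Comp_assoc[OF s_hom h(1) k(1)] h(2) k(2) Id_left[OF s_hom] by simp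
        then show False using s(3)[of n] k(1) unfolding quotient_le_def by blast
      qed
      moreover have "Cod C h = Cod C (s n)" using h(1) by (simp add: hom_def)
      ultimately show ?thesis
        using quot[of "Cod C (s (Suc n))" h] quot[OF fp s(1)] by auto
    qed
    have "n \<le> gr (Cod C (s n))" for n
    proof (induction n)
      case (Suc n)
      then show ?case using step[of n] by linarith
    qed simp
    from this[of "Suc (gr X)"] show False
      using quot[OF fp s(1), of "Suc (gr X)"] by simp
  qed
  ultimately show ?thesis
    unfolding dcc_category_def using lfp sub quot by blast
qed

subsection \<open>Generators and relations for presheaves\<close>

context presheaves
begin

lemma act_hom:
  assumes "P \<in> Obj PSh" "f \<in> hom A b a" "x \<in> omap P a"
  shows "act P f x \<in> omap P b"
  using act_in[OF assms(1), of f x] assms(2,3) by (auto simp: hom_def)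

lemma act_Comp_hom:
  assumes "P \<in> Obj PSh" "f \<in> hom A c b" "g \<in> hom A b a" "x \<in> omap P a"
  shows "act P (Comp A g f) x = act P f (act P g x)"
  using act_Comp[OF assms(1), of f g x] assms(2-4) by (auto simp: hom_def)

lemma app_act_hom:
  assumes "\<sigma> \<in> hom PSh P Q" "f \<in> hom A b a" "x \<in> omap P a"
  shows "app \<sigma> b (act P f x) = act Q f (app \<sigma> a x)"
  using app_act[OF assms(1), of f x] assms(2,3) by (auto simp: hom_def)

lemma hom_Obj: "f \<in> hom A b a \<Longrightarrow> a \<in> Obj A" "f \<in> hom A b a \<Longrightarrow> b \<in> Obj A"
  by (auto simp: hom_def Dom_in Cod_in)

text \<open>Generators carry the object over which they live. By the Yoneda lemma, such a family is
  a pointwise surjection onto \<open>P\<close> from the coproduct of the representables on the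
  objects \<open>fst p\<close>.\<close>

definition generates :: "('o, 'm, 'u) psh \<Rightarrow> ('o \<times> 'u) set \<Rightarrow> bool" where
  "generates P G \<longleftrightarrow> G \<subseteq> Sigma (Obj A) (omap P) \<and>
     (\<forall>a\<in>Obj A. \<forall>z\<in>omap P a. \<exists>p\<in>G. \<exists>f\<in>hom A a (fst p). z = act P f (snd p))"

lemma generatesD:
  assumes "generates P G" "p \<in> G"
  shows "fst p \<in> Obj A" "snd p \<in> omap P (fst p)"
  using assms by (auto simp: generates_def)

lemma psh_mor_eq_on_generators:
  assumes G: "generates P G" and \<sigma>: "\<sigma> \<in> hom PSh P Q" and \<tau>: "\<tau> \<in> hom PSh P Q"
    and eq: "\<And>p. p \<in> G \<Longrightarrow> app \<sigma> (fst p) (snd p) = app \<tau> (fst p) (snd p)"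
  shows "\<sigma> = \<tau>"
proof (rule psh_mor_eqI[OF \<sigma> \<tau>])
  fix a z assume "a \<in> Obj A" "z \<in> omap P a"
  then obtain p f where "p \<in> G" "f \<in> hom A a (fst p)" "z = act P f (snd p)"
    using G unfolding generates_def by blast
  then show "app \<sigma> a z = app \<tau> a z"
    using eq generatesD[OF G] by (simp add: app_act_hom[OF \<sigma>] app_act_hom[OF \<tau>])
qed

text \<open>A value is computed from any expression of an element through a generator;
  \<open>rel\<close> is exactly the independence of that expression, and naturality follows from
  it.\<close>

lemma extend_from_generators:
  assumes G: "generates P G" and P: "P \<in> Obj PSh" and Q: "Q \<in> Obj PSh"
    and Y: "\<And>p. p \<in> G \<Longrightarrow> Y p \<in> omap Q (fst p)"
    and rel: "\<And>p q c f g. \<lbrakk>p \<in> G; q \<in> G; f \<in> hom A c (fst p); g \<in> hom A c (fst q);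
           act P f (snd p) = act P g (snd q)\<rbrakk> \<Longrightarrow> act Q f (Y p) = act Q g (Y q)"
  shows "\<exists>\<psi>\<in>hom PSh P Q. \<forall>p\<in>G. app \<psi> (fst p) (snd p) = Y p"
proof -
  have "\<forall>a z. \<exists>w. a \<in> Obj A \<longrightarrow> z \<in> omap P a \<longrightarrow>
      fst w \<in> G \<and> snd w \<in> hom A a (fst (fst w)) \<and> z = act P (snd w) (snd (fst w))"
    using G unfolding generates_def by fastforce
  then obtain w where w: "\<And>a z. a \<in> Obj A \<Longrightarrow> z \<in> omap P a \<Longrightarrow>
      fst (w a z) \<in> G \<and> snd (w a z) \<in> hom A a (fst (fst (w a z))) \<and>
      z = act P (snd (w a z)) (snd (fst (w a z)))"
    by metis
  let ?\<eta> = "\<lambda>a z. act Q (snd (w a z)) (Y (fst (w a z)))"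
  have \<eta>: "?\<eta> a (act P f (snd p)) = act Q f (Y p)" if p: "p \<in> G" and f: "f \<in> hom A a (fst p)" for a f p
  proof -
    have "act P f (snd p) \<in> omap P a"
      using act_hom[OF P f] generatesD[OF G p] by simp
    note w = w[OF hom_Obj(2)[OF f] this]
    then show ?thesis using rel[of "fst (w a (act P f (snd p)))" p] p f by metis
  qed
  have \<psi>: "mknt P ?\<eta> Q \<in> hom PSh P Q"
  proof (rule mknt_hom[OF P Q])
    show "?\<eta> a z \<in> omap Q a" if "a \<in> Obj A" "z \<in> omap P a" for a z
      using w[OF that] act_hom[OF Q] Y by blast
    fix f z assume f: "f \<in> Mor A" and z: "z \<in> omap P (Cod A f)"
    then obtain p g where p: "p \<in> G" "g \<in> hom A (Cod A f) (fst p)" "z = act P g (snd p)"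
      using G Cod_in[OF f] unfolding generates_def by blast
    have f': "f \<in> hom A (Dom A f) (Cod A f)" using f by (simp add: hom_def)
    have "act P f z = act P (Comp A g f) (snd p)"
      using act_Comp_hom[OF P f' p(2)] p generatesD[OF G] by simp
    then have "?\<eta> (Dom A f) (act P f z) = act Q (Comp A g f) (Y p)"
      using \<eta>[OF p(1) Comp_in[OF f' p(2)]] by simp
    also have "\<dots> = act Q f (?\<eta> (Cod A f) z)"
      using act_Comp_hom[OF Q f' p(2) Y[OF p(1)]] \<eta>[OF p(1,2)] p(3) by simp
    finally show "?\<eta> (Dom A f) (act P f z) = act Q f (?\<eta> (Cod A f) z)" .
  qed
  moreover have "app (mknt P ?\<eta> Q) (fst p) (snd p) = Y p" if p: "p \<in> G" for p
  proof -
    note g = generatesD[OF G p]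
    have "app (mknt P ?\<eta> Q) (fst p) (snd p) = ?\<eta> (fst p) (act P (Id A (fst p)) (snd p))"
      by (simp add: app_mknt g act_Id[OF P])
    also have "\<dots> = act Q (Id A (fst p)) (Y p)"
      by (rule \<eta>[OF p Id_in[OF g(1)]])
    also have "\<dots> = Y p"
      by (rule act_Id[OF Q g(1) Y[OF p]])
    finally show ?thesis .
  qed
  ultimately show ?thesis by blast
qed

text \<open>A quadruple \<open>(p, f, q, g)\<close> stands for the relation that \<open>p\<close>
  restricted along \<open>f\<close> equals \<open>q\<close> restricted along \<open>g\<close>. Each
  relation must arise from a member of \<open>R\<close> by restriction along a single
  \<open>t\<close>, without symmetric or transitive closure; this is what finite generation of the
  kernel as a subpresheaf of a square delivers.\<close>

lemma finitely_presentable_PShI: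
  assumes P: "P \<in> Obj PSh" and G: "generates P G" "finite G" and R: "finite R"
    and R_rel: "\<And>p f q g. (p, f, q, g) \<in> R \<Longrightarrow> p \<in> G \<and> q \<in> G \<and>
      (\<exists>c. f \<in> hom A c (fst p) \<and> g \<in> hom A c (fst q)) \<and> act P f (snd p) = act P g (snd q)"
    and R_gen: "\<And>p q c f g. \<lbrakk>p \<in> G; q \<in> G; f \<in> hom A c (fst p); g \<in> hom A c (fst q);
           act P f (snd p) = act P g (snd q)\<rbrakk> \<Longrightarrow>
           \<exists>f' g' t. (p, f', q, g') \<in> R \<and> t \<in> hom A c (Dom A f') \<and> f = Comp A f' t \<and> g = Comp A g' t"
  shows "finitely_presentable U PSh P"
proof (rule category.finitely_presentableI[OF category_PSh P], rule conjI; (intro ballI impI)?)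
  fix I :: "'u set" and r D L c
  assume I: "small U I" and dir: "directed_poset I r" and D: "is_functor (poset_cat I r) PSh D"
    and colim: "is_colimit (poset_cat I r) PSh D L c"
  note r = directed_posetD[OF dir]
  interpret colim: directed_colimit PSh I r D L c
    by (intro directed_colimit.intro category_PSh directed_colimit_axioms.intro dir D colim)
  note c = colim.cocone_hom and Dhom = colim.diagram_hom
  note elem = directed_colimit_elements[OF I dir D colim]
  have Dobj: "i \<in> I \<Longrightarrow> omap D i \<in> Obj PSh" for i
    using is_functor_Obj[OF D] by simp
  have c_D: "app (c k) a (app (mmap D (i, k)) a x) = app (c i) a x"
    if "(i, k) \<in> r" "a \<in> Obj A" "x \<in> omap (omap D i) a" for i k a x
    using colim.cocone_comp[OF that(1)] app_Comp[OF Dhom[OF that(1)] that(2,3)] by metis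
  have D_D: "app (mmap D (k, l)) a (app (mmap D (i, k)) a x) = app (mmap D (i, l)) a x"
    if "(i, k) \<in> r" "(k, l) \<in> r" "a \<in> Obj A" "x \<in> omap (omap D i) a" for i k l a x
    using poset_functor_Comp[OF D that(1,2)] app_Comp[OF Dhom[OF that(1)] that(3,4)] by simp
  {
    fix \<phi> assume \<phi>: "\<phi> \<in> hom PSh P L"
    have "\<forall>p. \<exists>w. p \<in> G \<longrightarrow> fst w \<in> I \<and> snd w \<in> omap (omap D (fst w)) (fst p) \<and>
        app (c (fst w)) (fst p) (snd w) = app \<phi> (fst p) (snd p)"
      using elem(1)[OF _ app_in[OF \<phi>]] generatesD[OF G(1)] by fastforce
    then obtain w where w: "\<And>p. p \<in> G \<Longrightarrow> fst (w p) \<in> I \<and> snd (w p) \<in> omap (omap D (fst (w p))) (fst p) \<and>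
        app (c (fst (w p))) (fst p) (snd (w p)) = app \<phi> (fst p) (snd p)"
      by metis
    \<comment> \<open>Preimages of the images of the finitely many generators are moved to one
      stage. There they need not yet satisfy the relations of \<open>P\<close>.\<close>
    obtain k where k: "k \<in> I" "\<And>p. p \<in> G \<Longrightarrow> (fst (w p), k) \<in> r"
      using directed_poset_finite_bound[OF dir, of "(\<lambda>p. fst (w p)) ` G"] G(2) w by blast
    define Y where "Y p = app (mmap D (fst (w p), k)) (fst p) (snd (w p))" for p
    have Y: "Y p \<in> omap (omap D k) (fst p)" "app (c k) (fst p) (Y p) = app \<phi> (fst p) (snd p)"
      if "p \<in> G" for p
      using w[OF that] generatesD[OF G(1) that] app_in[OF Dhom[OF k(2)[OF that]]] c_D[OF k(2)[OF that]]
      by (auto simp: Y_def)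
    have "\<exists>l. (k, l) \<in> r \<and> app (mmap D (k, l)) (Dom A f) (act (omap D k) f (Y p)) =
        app (mmap D (k, l)) (Dom A f) (act (omap D k) g (Y q))" if pfqg: "(p, f, q, g) \<in> R" for p f q g
    proof -
      obtain d where p: "p \<in> G" and q: "q \<in> G" and f: "f \<in> hom A d (fst p)" and g: "g \<in> hom A d (fst q)"
        and eq: "act P f (snd p) = act P g (snd q)"
        using R_rel[OF pfqg] by blast
      have d: "Dom A f = d" using f by (simp add: hom_def)
      have "app (c k) d (act (omap D k) f (Y p)) = app \<phi> d (act P f (snd p))"
        using app_act_hom[OF c[OF k(1)] f Y(1)[OF p]] app_act_hom[OF \<phi> f] generatesD[OF G(1) p] Y(2)[OF p]
        by simp
      also have "\<dots> = app (c k) d (act (omap D k) g (Y q))"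
        using app_act_hom[OF c[OF k(1)] g Y(1)[OF q]] app_act_hom[OF \<phi> g] generatesD[OF G(1) q] Y(2)[OF q] eq
        by simp
      finally show ?thesis
        using elem(2)[OF hom_Obj(2)[OF f] k(1) k(1) act_hom[OF Dobj[OF k(1)] f Y(1)[OF p]]
            act_hom[OF Dobj[OF k(1)] g Y(1)[OF q]]] d by blast
    qed
    then have "\<forall>\<rho>. \<exists>l. \<rho> \<in> R \<longrightarrow> (case \<rho> of (p, f, q, g) \<Rightarrow>
        (k, l) \<in> r \<and> app (mmap D (k, l)) (Dom A f) (act (omap D k) f (Y p)) =
        app (mmap D (k, l)) (Dom A f) (act (omap D k) g (Y q)))"
      by (simp split: prod.split)
    then obtain l where l: "\<And>p f q g. (p, f, q, g) \<in> R \<Longrightarrow> (k, l (p, f, q, g)) \<in> r \<and>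
        app (mmap D (k, l (p, f, q, g))) (Dom A f) (act (omap D k) f (Y p)) =
        app (mmap D (k, l (p, f, q, g))) (Dom A f) (act (omap D k) g (Y q))"
      by (drule_tac choice) fastforce
    \<comment> \<open>Each relation in \<open>R\<close> holds in the colimit and therefore at some
      later stage; finiteness of \<open>R\<close> gives one stage \<open>n\<close> at which all of
      them hold.\<close>
    obtain n where n: "n \<in> I" "(k, n) \<in> r" "\<And>\<rho>. \<rho> \<in> R \<Longrightarrow> (l \<rho>, n) \<in> r"
    proof -
      have "l \<rho> \<in> I" if "\<rho> \<in> R" for \<rho>
        using l r(1) that by (cases \<rho>) blast
      then have "insert k (l ` R) \<subseteq> I" using k(1) by blast
      from directed_poset_finite_bound[OF dir _ this] R that show thesis by auto
    qed
    define Z where "Z p = app (mmap D (k, n)) (fst p) (Y p)" for p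
    note Dn = Dobj[OF n(1)]
    have Z: "Z p \<in> omap (omap D n) (fst p)" "app (c n) (fst p) (Z p) = app \<phi> (fst p) (snd p)"
      if "p \<in> G" for p
      using Y[OF that] generatesD[OF G(1) that] app_in[OF Dhom[OF n(2)]] c_D[OF n(2)]
      by (auto simp: Z_def)
    have Z_R: "act (omap D n) f (Z p) = act (omap D n) g (Z q)" if pfqg: "(p, f, q, g) \<in> R" for p f q g
    proof -
      obtain d where p: "p \<in> G" and q: "q \<in> G" and f: "f \<in> hom A d (fst p)" and g: "g \<in> hom A d (fst q)"
        using R_rel[OF pfqg] by blast
      have d: "Dom A f = d" using f by (simp add: hom_def)
      let ?l = "l (p, f, q, g)"
      note kl = conjunct1[OF l[OF pfqg]] n(3)[OF pfqg]
      have "act (omap D n) f (Z p) = app (mmap D (?l, n)) d (app (mmap D (k, ?l)) d (act (omap D k) f (Y p)))"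
        using app_act_hom[OF Dhom[OF n(2)] f Y(1)[OF p]]
          D_D[OF kl hom_Obj(2)[OF f] act_hom[OF Dobj[OF k(1)] f Y(1)[OF p]]]
        by (simp add: Z_def)
      also have "\<dots> = act (omap D n) g (Z q)"
        using app_act_hom[OF Dhom[OF n(2)] g Y(1)[OF q]]
          D_D[OF kl hom_Obj(2)[OF g] act_hom[OF Dobj[OF k(1)] g Y(1)[OF q]]] l[OF pfqg] d
        by (simp add: Z_def)
      finally show ?thesis .
    qed
    have Z_rel: "act (omap D n) f (Z p) = act (omap D n) g (Z q)"
      if p: "p \<in> G" and q: "q \<in> G" and f: "f \<in> hom A d (fst p)" and g: "g \<in> hom A d (fst q)"
        and eq: "act P f (snd p) = act P g (snd q)" for p q d f g
    proof -
      obtain f' g' t where R: "(p, f', q, g') \<in> R" and t: "t \<in> hom A d (Dom A f')"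
        and fg: "f = Comp A f' t" "g = Comp A g' t"
        using R_gen[OF p q f g eq] by blast
      obtain d' where d': "f' \<in> hom A d' (fst p)" "g' \<in> hom A d' (fst q)"
        using R_rel[OF R] by blast
      have t': "t \<in> hom A d d'" using t d' by (simp add: hom_def)
      show ?thesis
        using act_Comp_hom[OF Dn t' d'(1) Z(1)[OF p]] act_Comp_hom[OF Dn t' d'(2) Z(1)[OF q]] Z_R[OF R] fg
        by simp
    qed
    obtain \<psi> where \<psi>: "\<psi> \<in> hom PSh P (omap D n)" "\<And>p. p \<in> G \<Longrightarrow> app \<psi> (fst p) (snd p) = Z p"
    proof -
      have "\<exists>\<psi>\<in>hom PSh P (omap D n). \<forall>p\<in>G. app \<psi> (fst p) (snd p) = Z p"
        by (rule extend_from_generators[OF G(1) P Dn]) (erule (4) Z(1) Z_rel | erule Z(1))+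
      then show thesis using that by blast
    qed
    have "Comp PSh (c n) \<psi> = \<phi>"
    proof (rule psh_mor_eq_on_generators[OF G(1) Comp_PSh_hom[OF \<psi>(1) c[OF n(1)]] \<phi>])
      show "app (Comp PSh (c n) \<psi>) (fst p) (snd p) = app \<phi> (fst p) (snd p)" if "p \<in> G" for p
        using generatesD[OF G(1) that] that by (simp add: app_Comp[OF \<psi>(1)] \<psi>(2) Z(2))
    qed
    then show "\<exists>i\<in>I. \<exists>\<psi>\<in>hom PSh P (omap D i). Comp PSh (c i) \<psi> = \<phi>"
      using n(1) \<psi>(1) by blast
  }
  fix i \<alpha> \<beta> assume i: "i \<in> I" and \<alpha>: "\<alpha> \<in> hom PSh P (omap D i)" and \<beta>: "\<beta> \<in> hom PSh P (omap D i)"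
    and eq: "Comp PSh (c i) \<alpha> = Comp PSh (c i) \<beta>"
  have "\<exists>k. p \<in> G \<longrightarrow> (i, k) \<in> r \<and> app (mmap D (i, k)) (fst p) (app \<alpha> (fst p) (snd p)) =
      app (mmap D (i, k)) (fst p) (app \<beta> (fst p) (snd p))" for p
  proof (cases "p \<in> G")
    case True
    note g = generatesD[OF G(1) True]
    have "app (c i) (fst p) (app \<alpha> (fst p) (snd p)) = app (c i) (fst p) (app \<beta> (fst p) (snd p))"
      using app_Comp[OF \<alpha> g] app_Comp[OF \<beta> g] eq by metis
    then show ?thesis
      using elem(2)[OF g(1) i i app_in[OF \<alpha> g] app_in[OF \<beta> g]] by blast
  qed simp
  then obtain k where k: "\<And>p. p \<in> G \<Longrightarrow> (i, k p) \<in> r \<and> app (mmap D (i, k p)) (fst p) (app \<alpha> (fst p) (snd p)) =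
      app (mmap D (i, k p)) (fst p) (app \<beta> (fst p) (snd p))"
    by metis
  obtain n where n: "(i, n) \<in> r" "\<And>p. p \<in> G \<Longrightarrow> (k p, n) \<in> r"
  proof -
    have "insert i (k ` G) \<subseteq> I" using k i r(1) by blast
    from directed_poset_finite_bound[OF dir _ this] G(2) that show thesis by auto
  qed
  have "Comp PSh (mmap D (i, n)) \<alpha> = Comp PSh (mmap D (i, n)) \<beta>"
  proof (rule psh_mor_eq_on_generators[OF G(1) Comp_PSh_hom[OF \<alpha> Dhom[OF n(1)]] Comp_PSh_hom[OF \<beta> Dhom[OF n(1)]]])
    fix p assume p: "p \<in> G"
    note g = generatesD[OF G(1) p]
    show "app (Comp PSh (mmap D (i, n)) \<alpha>) (fst p) (snd p) = app (Comp PSh (mmap D (i, n)) \<beta>) (fst p) (snd p)"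
      using k[OF p] D_D[OF _ n(2)[OF p] g(1) app_in[OF \<alpha> g]] D_D[OF _ n(2)[OF p] g(1) app_in[OF \<beta> g]]
      by (simp add: app_Comp[OF \<alpha> g] app_Comp[OF \<beta> g])
  qed
  then show "\<exists>k. (i, k) \<in> r \<and> Comp PSh (mmap D (i, k)) \<alpha> = Comp PSh (mmap D (i, k)) \<beta>"
    using n(1) by blast
qed

end

lemma descending_chains_finiteD:
  assumes "descending_chains_finite le P" "\<And>n. P (s n)" "\<And>n. le (s (Suc n)) (s n)"
  shows "\<exists>n. le (s n) (s (Suc n))"
proof (rule ccontr)
  assume "\<nexists>n. le (s n) (s (Suc n))"
  then have "\<forall>n. P (s n) \<and> le (s (Suc n)) (s n) \<and> \<not> le (s n) (s (Suc n))"
    using assms(2,3) by simp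
  then show False
    using assms(1) unfolding descending_chains_finite_def by (elim notE) (rule exI)
qed

lemma mono_morD:
  assumes "mono_mor C m" and m: "m \<in> hom C X Y" and "W \<in> Obj C"
    and "f \<in> hom C W X" "g \<in> hom C W X" "Comp C m f = Comp C m g"
  shows "f = g"
proof -
  have "Dom C m = X" using m by (simp add: hom_def)
  then show ?thesis using assms(1,3-) unfolding mono_mor_def by blast
qed

context presheaves
begin

subsection \<open>Sieves as subobjects of representable presheaves\<close>

text \<open>Presheaf values are subsets of \<open>'u\<close>, so morphisms of \<open>A\<close> can
  only occur in them through an injection, chosen once for the whole category.\<close>

definition encode :: "'m \<Rightarrow> 'u" where
  "encode = (SOME e. inj_on e (Mor A))"

definition decode :: "'u \<Rightarrow> 'm" where
  "decode = inv_into (Mor A) encode"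

lemma inj_on_encode: "inj_on encode (Mor A)"
  unfolding encode_def using small_embedding[OF small_Mor] by (metis someI_ex)

lemma decode_encode [simp]: "f \<in> Mor A \<Longrightarrow> decode (encode f) = f"
  unfolding decode_def by (rule inv_into_f_f[OF inj_on_encode])

text \<open>A sieve viewed as a subfunctor of a representable presheaf; for
  \<open>max_sieve a\<close> it is the representable presheaf of \<open>a\<close> itself.\<close>

definition sieve_psh :: "'m set \<Rightarrow> ('o, 'm, 'u) psh" where
  "sieve_psh S = mkpsh (\<lambda>b. encode ` {f \<in> S. Dom A f = b}) (\<lambda>g z. encode (Comp A (decode z) g))"

lemma sieve_Mor: "sieve A a S \<Longrightarrow> f \<in> S \<Longrightarrow> f \<in> Mor A \<and> Cod A f = a"
  by (auto simp: sieve_def)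

lemma sieve_Comp: "sieve A a S \<Longrightarrow> f \<in> S \<Longrightarrow> g \<in> Mor A \<Longrightarrow> Cod A g = Dom A f \<Longrightarrow> Comp A f g \<in> S"
  by (auto simp: sieve_def)

lemma sieve_psh_omap: "b \<in> Obj A \<Longrightarrow> omap (sieve_psh S) b = encode ` {f \<in> S. Dom A f = b}"
  by (simp add: sieve_psh_def omap_mkpsh)

lemma sieve_psh_act:
  assumes "sieve A a S" "f \<in> S" "g \<in> Mor A" "Cod A g = Dom A f"
  shows "act (sieve_psh S) g (encode f) = encode (Comp A f g)"
proof -
  have "act (sieve_psh S) g (encode f) = encode (Comp A (decode (encode f)) g)"
    unfolding sieve_psh_def using assms by (intro act_mkpsh) auto
  then show ?thesis using sieve_Mor[OF assms(1,2)] by simp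
qed

lemma sieve_psh_Obj:
  assumes S: "sieve A a S"
  shows "sieve_psh S \<in> Obj PSh"
  unfolding sieve_psh_def
proof (rule mkpsh_Obj)
  show "small U (encode ` {f \<in> S. Dom A f = b})" for b
    by (rule small_image, rule small_subset[OF small_Mor]) (use sieve_Mor[OF S] in auto)
  show "encode (Comp A (decode z) g) \<in> encode ` {f \<in> S. Dom A f = Dom A g}"
    if g: "g \<in> Mor A" "z \<in> encode ` {f \<in> S. Dom A f = Cod A g}" for g z
    using g sieve_Mor[OF S] sieve_Comp[OF S] by (auto simp: Dom_Comp)
  show "encode (Comp A (decode z) (Id A b)) = z"
    if "b \<in> Obj A" "z \<in> encode ` {f \<in> S. Dom A f = b}" for b z
    using that sieve_Mor[OF S] Id_right by (auto simp: hom_def)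
  show "encode (Comp A (decode z) (Comp A g f)) = encode (Comp A (decode (encode (Comp A (decode z) g))) f)"
    if fg: "f \<in> Mor A" "g \<in> Mor A" "Cod A f = Dom A g" and z: "z \<in> encode ` {f \<in> S. Dom A f = Cod A g}" for f g z
  proof -
    obtain h where h: "h \<in> S" "Dom A h = Cod A g" "z = encode h" using z by auto
    then have h': "h \<in> Mor A" using sieve_Mor[OF S] by auto
    have "Comp A h (Comp A g f) = Comp A (Comp A h g) f"
      using Comp_assoc[of f "Dom A f" "Dom A g" g "Cod A g" h "Cod A h"] fg h h' by (simp add: hom_def)
    then show ?thesis using h h' fg by (simp add: Comp_Mor)
  qed
qed

definition sieve_incl :: "'m set \<Rightarrow> 'm set \<Rightarrow> ('o, 'm, 'u) psh_mor" where
  "sieve_incl S T = mknt (sieve_psh S) (\<lambda>a x. x) (sieve_psh T)"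

lemma sieve_incl_hom:
  assumes S: "sieve A a S" and T: "sieve A a T" and "S \<subseteq> T"
  shows "sieve_incl S T \<in> hom PSh (sieve_psh S) (sieve_psh T)"
  unfolding sieve_incl_def
proof (rule mknt_hom[OF sieve_psh_Obj[OF S] sieve_psh_Obj[OF T]])
  show "x \<in> omap (sieve_psh T) b" if "b \<in> Obj A" "x \<in> omap (sieve_psh S) b" for b x
    using that \<open>S \<subseteq> T\<close> by (auto simp: sieve_psh_omap)
  show "act (sieve_psh S) f x = act (sieve_psh T) f x"
    if "f \<in> Mor A" "x \<in> omap (sieve_psh S) (Cod A f)" for f x
    using that \<open>S \<subseteq> T\<close> by (auto simp: sieve_psh_omap Cod_in sieve_psh_act[OF S] sieve_psh_act[OF T])
qed

lemma app_sieve_incl: "b \<in> Obj A \<Longrightarrow> x \<in> omap (sieve_psh S) b \<Longrightarrow> app (sieve_incl S T) b x = x"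
  by (simp add: sieve_incl_def app_mknt)

abbreviation max_sieve :: "'o \<Rightarrow> 'm set" where
  "max_sieve a \<equiv> {f \<in> Mor A. Cod A f = a}"

lemma sieve_max: "sieve A a (max_sieve a)"
  by (auto simp: sieve_def Comp_Mor Cod_Comp)

lemma sieve_subset_max: "sieve A a S \<Longrightarrow> S \<subseteq> max_sieve a"
  by (simp add: sieve_def)

definition yoneda :: "('o, 'm, 'u) psh \<Rightarrow> 'o \<Rightarrow> 'u \<Rightarrow> ('o, 'm, 'u) psh_mor" where
  "yoneda P a x = mknt (sieve_psh (max_sieve a)) (\<lambda>b z. act P (decode z) x) P"

lemma yoneda_hom:
  assumes P: "P \<in> Obj PSh" and a: "a \<in> Obj A" and x: "x \<in> omap P a"
  shows "yoneda P a x \<in> hom PSh (sieve_psh (max_sieve a)) P"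
  unfolding yoneda_def
proof (rule mknt_hom[OF sieve_psh_Obj[OF sieve_max] P])
  show "act P (decode z) x \<in> omap P b" if "b \<in> Obj A" "z \<in> omap (sieve_psh (max_sieve a)) b" for b z
    using that x by (auto simp: sieve_psh_omap act_in[OF P])
  show "act P (decode (act (sieve_psh (max_sieve a)) f z)) x = act P f (act P (decode z) x)"
    if "f \<in> Mor A" "z \<in> omap (sieve_psh (max_sieve a)) (Cod A f)" for f z
    using that x by (auto simp: sieve_psh_omap Cod_in sieve_psh_act[OF sieve_max] Comp_Mor act_Comp[OF P])
qed

lemma app_yoneda: "f \<in> hom A b a \<Longrightarrow> app (yoneda P a x) b (encode f) = act P f x"
  by (auto simp: yoneda_def hom_def app_mknt sieve_psh_omap Dom_in)

text \<open>Elements of \<open>P\<close> at \<open>a\<close> are morphisms into \<open>P\<close>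
  from the representable of \<open>a\<close>, and a monomorphism separates these.\<close>

lemma mono_mor_injective:
  assumes m: "m \<in> hom PSh P Q" and mono: "mono_mor PSh m" and a: "a \<in> Obj A"
    and xy: "x \<in> omap P a" "y \<in> omap P a" "app m a x = app m a y"
  shows "x = y"
proof -
  note P = psh_mor_Dom[OF m]
  note yx = yoneda_hom[OF P a xy(1)] and yy = yoneda_hom[OF P a xy(2)]
  have "Comp PSh m (yoneda P a x) = Comp PSh m (yoneda P a y)"
  proof (rule psh_mor_eqI[OF Comp_PSh_hom[OF yx m] Comp_PSh_hom[OF yy m]])
    fix b z assume b: "b \<in> Obj A" and z: "z \<in> omap (sieve_psh (max_sieve a)) b"
    then obtain f where f: "f \<in> hom A b a" "z = encode f"
      by (auto simp: sieve_psh_omap hom_def)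
    show "app (Comp PSh m (yoneda P a x)) b z = app (Comp PSh m (yoneda P a y)) b z"
      using app_act_hom[OF m f(1) xy(1)] app_act_hom[OF m f(1) xy(2)] xy(3) f(2)
      unfolding app_Comp[OF yx b z] app_Comp[OF yy b z] by (simp add: app_yoneda[OF f(1)])
  qed
  then have "yoneda P a x = yoneda P a y"
    by (rule mono_morD[OF mono m sieve_psh_Obj[OF sieve_max] yx yy])
  then have "act P (Id A a) x = act P (Id A a) y"
    using app_yoneda[OF Id_in[OF a]] by metis
  then show ?thesis using act_Id[OF P a] xy by simp
qed

lemma injective_mono_mor:
  assumes m: "m \<in> hom PSh P Q"
    and inj: "\<And>a x y. \<lbrakk>a \<in> Obj A; x \<in> omap P a; y \<in> omap P a; app m a x = app m a y\<rbrakk> \<Longrightarrow> x = y"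
  shows "mono_mor PSh m"
  unfolding mono_mor_def
proof (intro conjI ballI impI)
  show "m \<in> Mor PSh" using m by (simp add: hom_def)
  fix W f g assume f: "f \<in> hom PSh W (Dom PSh m)" and g: "g \<in> hom PSh W (Dom PSh m)"
    and eq: "Comp PSh m f = Comp PSh m g"
  have "Dom PSh m = P" using m by (simp add: hom_def)
  then have f: "f \<in> hom PSh W P" and g: "g \<in> hom PSh W P" using f g by simp_all
  show "f = g"
  proof (rule psh_mor_eqI[OF f g])
    fix a x assume a: "a \<in> Obj A" and x: "x \<in> omap W a"
    have "app m a (app f a x) = app m a (app g a x)"
      using app_Comp[OF f a x, of m] app_Comp[OF g a x, of m] eq by simp
    then show "app f a x = app g a x"
      by (rule inj[OF a app_in[OF f a x] app_in[OF g a x]])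
  qed
qed

text \<open>Pointwise inverses of \<open>j\<close> are natural because naturality may be tested
  after applying the injective \<open>j\<close>.\<close>

lemma lift_through_injective:
  assumes j: "j \<in> hom PSh P Y"
    and inj: "\<And>a x y. \<lbrakk>a \<in> Obj A; x \<in> omap P a; y \<in> omap P a; app j a x = app j a y\<rbrakk> \<Longrightarrow> x = y"
    and \<phi>: "\<phi> \<in> hom PSh Q Y"
    and img: "\<And>a z. a \<in> Obj A \<Longrightarrow> z \<in> omap Q a \<Longrightarrow> app \<phi> a z \<in> app j a ` omap P a"
  obtains \<mu> where "\<mu> \<in> hom PSh Q P" "Comp PSh j \<mu> = \<phi>"
proof -
  let ?\<eta> = "\<lambda>a z. inv_into (omap P a) (app j a) (app \<phi> a z)"
  have \<eta>_in: "?\<eta> a z \<in> omap P a" if "a \<in> Obj A" "z \<in> omap Q a" for a z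
    by (rule inv_into_into[OF img[OF that]])
  have j_\<eta>: "app j a (?\<eta> a z) = app \<phi> a z" if "a \<in> Obj A" "z \<in> omap Q a" for a z
    by (rule f_inv_into_f[OF img[OF that]])
  have \<mu>: "mknt Q ?\<eta> P \<in> hom PSh Q P"
  proof (rule mknt_hom[OF psh_mor_Dom[OF \<phi>] psh_mor_Dom[OF j] \<eta>_in])
    fix f z assume f: "f \<in> Mor A" and z: "z \<in> omap Q (Cod A f)"
    note fz = act_in[OF psh_mor_Dom[OF \<phi>] f z] and Ez = \<eta>_in[OF Cod_in[OF f] z]
    have "app j (Dom A f) (?\<eta> (Dom A f) (act Q f z)) = app j (Dom A f) (act P f (?\<eta> (Cod A f) z))"
      unfolding j_\<eta>[OF Dom_in[OF f] fz] app_act[OF j f Ez] j_\<eta>[OF Cod_in[OF f] z]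
      by (rule app_act[OF \<phi> f z])
    then show "?\<eta> (Dom A f) (act Q f z) = act P f (?\<eta> (Cod A f) z)"
      by (rule inj[OF Dom_in[OF f] \<eta>_in[OF Dom_in[OF f] fz] act_in[OF psh_mor_Dom[OF j] f Ez]])
  qed
  moreover have "Comp PSh j (mknt Q ?\<eta> P) = \<phi>"
    by (rule psh_mor_eqI[OF Comp_PSh_hom[OF \<mu> j] \<phi>]) (simp add: app_Comp[OF \<mu>] app_mknt j_\<eta>)
  ultimately show ?thesis using that by blast
qed

text \<open>The representable is free on the identity of \<open>a\<close>: equal restrictions of the
  identity come from equal morphisms. The trivial relation between the identity and itself thus
  yields all others, with \<open>t\<close> the common morphism.\<close>

lemma finitely_presentable_representable:
  assumes a: "a \<in> Obj A"
  shows "finitely_presentable U PSh (sieve_psh (max_sieve a))"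
proof -
  let ?y = "sieve_psh (max_sieve a)" and ?p = "(a, encode (Id A a))"
  have act: "act ?y f (encode (Id A a)) = encode f" if "f \<in> hom A b a" for f b
    using that Id_left[OF that] by (subst sieve_psh_act[OF sieve_max]) (auto simp: hom_def cat_simps)
  show ?thesis
  proof (rule finitely_presentable_PShI)
    show "?y \<in> Obj PSh" by (rule sieve_psh_Obj[OF sieve_max])
    show "generates ?y {?p}"
      unfolding generates_def
    proof (intro conjI ballI)
      show "{?p} \<subseteq> Sigma (Obj A) (omap ?y)"
        using a by (auto simp: sieve_psh_omap cat_simps)
      fix b z assume "b \<in> Obj A" "z \<in> omap ?y b"
      then obtain f where "f \<in> hom A b a" "z = encode f"
        by (auto simp: sieve_psh_omap hom_def)
      then show "\<exists>p\<in>{?p}. \<exists>f\<in>hom A b (fst p). z = act ?y f (snd p)"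
        using act by auto
    qed
    show "finite {(?p, Id A a, ?p, Id A a)}" by simp
    show "p \<in> {?p} \<and> q \<in> {?p} \<and> (\<exists>c. f \<in> hom A c (fst p) \<and> g \<in> hom A c (fst q)) \<and>
        act ?y f (snd p) = act ?y g (snd q)" if "(p, f, q, g) \<in> {(?p, Id A a, ?p, Id A a)}" for p f q g
      using that Id_in[OF a] by auto
    show "\<exists>f' g' t. (p, f', q, g') \<in> {(?p, Id A a, ?p, Id A a)} \<and> t \<in> hom A c (Dom A f') \<and>
        f = Comp A f' t \<and> g = Comp A g' t"
      if pq: "p \<in> {?p}" "q \<in> {?p}" and fg: "f \<in> hom A c (fst p)" "g \<in> hom A c (fst q)"
        and eq: "act ?y f (snd p) = act ?y g (snd q)" for p q c f g
    proof -
      have fg: "f \<in> hom A c a" "g \<in> hom A c a" using fg pq by auto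
      then have "encode f = encode g" using eq pq act by simp
      then have "f = g" using fg inj_onD[OF inj_on_encode] by (auto simp: hom_def)
      then show ?thesis using pq fg a by (auto simp: Id_left Dom_Id)
    qed
  qed simp
qed

subsection \<open>Directed unions\<close>

text \<open>Turns a directed family of subobjects, indexed in any type, into a diagram indexed
  inside \<open>'u\<close>, as the definitions demand. The \<open>P k\<close> are arbitrary
  presheaves embedded in \<open>Y\<close>; the transition maps come from the inclusions of
  images.\<close>

lemma directed_union_colimit:
  assumes small_K: "small U K" and dir: "directed_poset K R"
    and j: "\<And>k. k \<in> K \<Longrightarrow> j k \<in> hom PSh (P k) Y"
    and inj: "\<And>k a x y. \<lbrakk>k \<in> K; a \<in> Obj A; x \<in> omap (P k) a; y \<in> omap (P k) a;
           app (j k) a x = app (j k) a y\<rbrakk> \<Longrightarrow> x = y"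
    and mono: "\<And>k l a. (k, l) \<in> R \<Longrightarrow> a \<in> Obj A \<Longrightarrow>
           app (j k) a ` omap (P k) a \<subseteq> app (j l) a ` omap (P l) a"
    and surj: "\<And>a z. a \<in> Obj A \<Longrightarrow> z \<in> omap Y a \<Longrightarrow> \<exists>k\<in>K. z \<in> app (j k) a ` omap (P k) a"
  obtains I :: "'u set" and r D c where "small U I" "directed_poset I r"
    "is_functor (poset_cat I r) PSh D" "is_colimit (poset_cat I r) PSh D Y c"
    "\<And>i. i \<in> I \<Longrightarrow> \<exists>k\<in>K. omap D i = P k \<and> c i = j k"
proof -
  note R = directed_posetD[OF dir]
  interpret PSh: category PSh by (rule category_PSh)
  obtain e :: "'a \<Rightarrow> 'u" where e: "inj_on e K"
    using small_K by (rule small_embedding)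
  define d where "d = inv_into K e"
  have d_e [simp]: "d (e k) = k" if "k \<in> K" for k
    using that by (simp add: d_def inv_into_f_f[OF e])
  define I where "I = e ` K"
  define r where "r = {(i, i'). i \<in> I \<and> i' \<in> I \<and> (d i, d i') \<in> R}"
  have d: "d i \<in> K" "e (d i) = i" if "i \<in> I" for i
    using that by (auto simp: I_def)
  have "directed_poset I r"
    unfolding directed_poset_def partial_order_on_def preorder_on_def
  proof (intro conjI ballI)
    show "r \<subseteq> I \<times> I" by (auto simp: r_def)
    show "refl_on I r" using R(2) d by (auto simp: r_def refl_on_def)
    show "trans r" using R(3) by (auto simp: r_def trans_def)
    show "antisym r"
      using dir d unfolding directed_poset_def partial_order_on_def by (auto simp: r_def antisym_def) metis
    show "I \<noteq> {}" using R(5) by (simp add: I_def)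
    show "\<exists>k\<in>I. (i, k) \<in> r \<and> (i', k) \<in> r" if ii: "i \<in> I" "i' \<in> I" for i i'
    proof -
      obtain k where "k \<in> K" "(d i, k) \<in> R" "(d i', k) \<in> R"
        using R(4)[OF d(1)[OF ii(1)] d(1)[OF ii(2)]] by blast
      then show ?thesis
        using ii by (intro bexI[of _ "e k"]) (auto simp: r_def I_def)
    qed
  qed
  have "\<exists>\<mu>. (k, l) \<in> R \<longrightarrow> \<mu> \<in> hom PSh (P k) (P l) \<and> Comp PSh (j l) \<mu> = j k" for k l
  proof (cases "(k, l) \<in> R")
    case True
    then have kl: "k \<in> K" "l \<in> K" using R(1) by auto
    show ?thesis
      by (rule lift_through_injective[OF j[OF kl(2)] inj[OF kl(2)] j[OF kl(1)]]) (use mono[OF True] in blast)+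
  qed simp
  then obtain \<mu> where \<mu>: "\<And>k l. (k, l) \<in> R \<Longrightarrow> \<mu> k l \<in> hom PSh (P k) (P l) \<and> Comp PSh (j l) (\<mu> k l) = j k"
    by metis
  \<comment> \<open>The transition maps were merely chosen; cancelling the monomorphism into
    \<open>Y\<close> shows that they satisfy the functor laws.\<close>
  have j_cancel: "\<sigma> = \<tau>"
    if "k \<in> K" "\<sigma> \<in> hom PSh W (P k)" "\<tau> \<in> hom PSh W (P k)" "Comp PSh (j k) \<sigma> = Comp PSh (j k) \<tau>" for k \<sigma> \<tau> W
    by (rule mono_morD[OF injective_mono_mor[OF j[OF that(1)] inj[OF that(1)]] j[OF that(1)]
          psh_mor_Dom[OF that(2)] that(2-4)])
  let ?D = "\<lparr>omap = restrict (\<lambda>i. P (d i)) I, mmap = (\<lambda>k\<in>r. \<mu> (d (fst k)) (d (snd k)))\<rparr>"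
  have D: "is_functor (poset_cat I r) PSh ?D"
  proof (rule directed_functorI[OF \<open>directed_poset I r\<close> category_PSh])
    show "P (d i) \<in> Obj PSh" if "i \<in> I" for i
      using psh_mor_Dom[OF j] d that by blast
    show "\<mu> (d i) (d i') \<in> hom PSh (P (d i)) (P (d i'))" if "(i, i') \<in> r" for i i'
      using \<mu> that by (auto simp: r_def)
    show "\<mu> (d i) (d i) = Id PSh (P (d i))" if "i \<in> I" for i
    proof -
      note k = d(1)[OF that]
      show ?thesis
        by (rule j_cancel[OF k conjunct1[OF \<mu>[OF R(2)[OF k]]] Id_PSh_hom[OF psh_mor_Dom[OF j[OF k]]]])
          (simp only: conjunct2[OF \<mu>[OF R(2)[OF k]]] PSh.Id_right[OF j[OF k]])
    qed
    show "\<mu> (d i) (d i'') = Comp PSh (\<mu> (d i') (d i'')) (\<mu> (d i) (d i'))"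
      if "(i, i') \<in> r" "(i', i'') \<in> r" for i i' i''
    proof -
      have 1: "(d i, d i') \<in> R" "(d i', d i'') \<in> R" and k: "d i'' \<in> K"
        using that d by (auto simp: r_def)
      note m = \<mu>[OF 1(1)] \<mu>[OF 1(2)] \<mu>[OF R(3)[OF 1]]
      show ?thesis
        by (rule j_cancel[OF k conjunct1[OF m(3)] PSh.Comp_in[OF conjunct1[OF m(1)] conjunct1[OF m(2)]]])
          (simp only: PSh.Comp_assoc[OF conjunct1[OF m(1)] conjunct1[OF m(2)] j[OF k]] conjunct2[OF m(1)]
            conjunct2[OF m(2)] conjunct2[OF m(3)])
    qed
  qed
  have "cocone (poset_cat I r) PSh ?D Y (\<lambda>i. j (d i))"
    unfolding cocone_def
  proof (intro conjI ballI)
    obtain k where "k \<in> K" using R(5) by blast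
    then show "Y \<in> Obj PSh" using psh_mor_Cod[OF j] by blast
    show "j (d i) \<in> hom PSh (omap ?D i) Y" if "i \<in> Obj (poset_cat I r)" for i
      using that j d by simp
    show "Comp PSh (j (d (Cod (poset_cat I r) k))) (mmap ?D k) = j (d (Dom (poset_cat I r) k))"
      if "k \<in> Mor (poset_cat I r)" for k
      using that \<mu> by (auto simp: r_def)
  qed
  then have "is_colimit (poset_cat I r) PSh ?D Y (\<lambda>i. j (d i))"
  proof (rule directed_colimitI[OF \<open>directed_poset I r\<close> D])
    show "\<exists>i\<in>I. \<exists>x\<in>omap (omap ?D i) a. app (j (d i)) a x = z" if az: "a \<in> Obj A" "z \<in> omap Y a" for a z
    proof -
      obtain k x where "k \<in> K" "x \<in> omap (P k) a" "z = app (j k) a x"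
        using surj[OF az] by blast
      then show ?thesis
        by (intro bexI[of _ "e k"] bexI[of _ x]) (auto simp: I_def)
    qed
    show "x = y" if "a \<in> Obj A" "i \<in> I" "x \<in> omap (omap ?D i) a" "y \<in> omap (omap ?D i) a"
      "app (j (d i)) a x = app (j (d i)) a y" for a i x y
      using inj[OF d(1)[OF that(2)] that(1)] that by simp
  qed
  then show ?thesis
    using that[of I r ?D "\<lambda>i. j (d i)"] \<open>directed_poset I r\<close> D small_image[OF small_K] d
    by (auto simp: I_def)
qed

end

subsection \<open>A DCC presheaf category has finite sieve lattices\<close>

text \<open>Well-founded induction on \<open>S\<close>, with ACC supplying a maximal member
  \<open>M\<close> strictly below \<open>S\<close>. If some \<open>T\<close> properly below
  \<open>S\<close> is not contained in \<open>M\<close>, maximality forces the union of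
  \<open>M\<close> and \<open>T\<close> to be \<open>S\<close>, and by distributivity every member
  below \<open>S\<close> is a union of a member below \<open>M\<close> and one below
  \<open>T\<close>. Otherwise everything properly below \<open>S\<close> lies below
  \<open>M\<close>.\<close>

lemma finite_set_lattice:
  assumes Int: "\<And>S T. S \<in> \<F> \<Longrightarrow> T \<in> \<F> \<Longrightarrow> S \<inter> T \<in> \<F>"
    and Un: "\<And>S T. S \<in> \<F> \<Longrightarrow> T \<in> \<F> \<Longrightarrow> S \<union> T \<in> \<F>"
    and dcc: "\<nexists>s :: nat \<Rightarrow> 'a set. \<forall>n. s n \<in> \<F> \<and> s (Suc n) \<subset> s n"
    and acc: "\<nexists>s :: nat \<Rightarrow> 'a set. \<forall>n. s n \<in> \<F> \<and> s n \<subset> s (Suc n)"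
    and "S \<in> \<F>"
  shows "finite {T \<in> \<F>. T \<subseteq> S}"
proof -
  have wf: "wf {(X, Y). X \<in> \<F> \<and> Y \<in> \<F> \<and> X \<subset> Y}"
    using dcc unfolding wf_iff_no_infinite_down_chain by auto metis
  have wf_conv: "wf {(X, Y). X \<in> \<F> \<and> Y \<in> \<F> \<and> Y \<subset> X}"
    using acc unfolding wf_iff_no_infinite_down_chain by auto metis
  show ?thesis
    using wf \<open>S \<in> \<F>\<close>
  proof (induction S rule: wf_induct_rule)
    case (less S)
    let ?below = "\<lambda>S. {T \<in> \<F>. T \<subseteq> S}"
    have IH: "finite (?below T)" if "T \<in> \<F>" "T \<subset> S" for T
      using less that by blast
    show ?case
    proof (cases "\<exists>T. T \<in> \<F> \<and> T \<subset> S")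
      case False
      then have "?below S \<subseteq> {S}" by blast
      then show ?thesis by (rule finite_subset) simp
    next
      case True
      then obtain T0 where "T0 \<in> {T \<in> \<F>. T \<subset> S}" by blast
      from wf_conv[unfolded wf_eq_minimal, rule_format, OF this]
      obtain M where "M \<in> {T \<in> \<F>. T \<subset> S}"
        "\<forall>T. (T, M) \<in> {(X, Y). X \<in> \<F> \<and> Y \<in> \<F> \<and> Y \<subset> X} \<longrightarrow> T \<notin> {T \<in> \<F>. T \<subset> S}" ..
      then have M: "M \<in> \<F>" "M \<subset> S" "\<And>T. T \<in> \<F> \<Longrightarrow> M \<subset> T \<Longrightarrow> \<not> T \<subset> S"
        by auto
      show ?thesis
      proof (cases "\<exists>T\<in>\<F>. T \<subset> S \<and> \<not> T \<subseteq> M")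
        case True
        then obtain T where T: "T \<in> \<F>" "T \<subset> S" "\<not> T \<subseteq> M" by blast
        then have S: "M \<union> T = S" using M(3)[OF Un[OF M(1) T(1)]] M(2) by blast
        have "?below S \<subseteq> (\<lambda>(X, Y). X \<union> Y) ` (?below M \<times> ?below T)"
        proof
          fix X assume "X \<in> ?below S"
          then have "X = (X \<inter> M) \<union> (X \<inter> T)" "X \<inter> M \<in> ?below M" "X \<inter> T \<in> ?below T"
            using S Int M(1) T(1) by auto
          then show "X \<in> (\<lambda>(X, Y). X \<union> Y) ` (?below M \<times> ?below T)" by blast
        qed
        then show ?thesis
          using IH[OF M(1,2)] IH[OF T(1,2)] by (meson finite_SigmaI finite_imageI finite_subset)
      next
        case False
        then have "?below S \<subseteq> insert S (?below M)" by blast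
        then show ?thesis
          using IH[OF M(1,2)] by (meson finite_insert finite_subset)
      qed
    qed
  qed
qed

context presheaves
begin

lemma dcc_imp_finite_sieves:
  assumes dcc: "dcc_category U PSh" and a: "a \<in> Obj A"
  shows "finite {S. sieve A a S}"
proof -
  let ?M = "max_sieve a"
  note fp = finitely_presentable_representable[OF a]
  have incl: "sieve_incl S ?M \<in> hom PSh (sieve_psh S) (sieve_psh ?M)" if "sieve A a S" for S
    by (rule sieve_incl_hom[OF that sieve_max sieve_subset_max[OF that]])
  have sub: "subobject PSh (sieve_psh ?M) (sieve_incl S ?M)" if "sieve A a S" for S
    using injective_mono_mor[OF incl[OF that]] incl[OF that] by (auto simp: subobject_def app_sieve_incl hom_def)
  \<comment> \<open>This applies also to the union of an ascending chain of sieves, and is the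
    source of ACC: the chain conditions in the hypothesis only concern descending chains.\<close>
  have fp_sieve: "finitely_presentable U PSh (sieve_psh S)" if "sieve A a S" for S
  proof -
    have "finitely_presentable U PSh (Dom PSh (sieve_incl S ?M))"
      using dcc fp sub[OF that] unfolding dcc_category_def by blast
    then show ?thesis
      using incl[OF that] by (simp add: hom_def)
  qed
  have "finite {T \<in> {S. sieve A a S}. T \<subseteq> ?M}"
  proof (rule finite_set_lattice)
    show "S \<inter> T \<in> {S. sieve A a S}" "S \<union> T \<in> {S. sieve A a S}"
      if "S \<in> {S. sieve A a S}" "T \<in> {S. sieve A a S}" for S T
      using that by (auto simp: sieve_def)
    show "?M \<in> {S. sieve A a S}" by (simp add: sieve_max)
    show "\<nexists>s :: nat \<Rightarrow> 'm set. \<forall>n. s n \<in> {S. sieve A a S} \<and> s (Suc n) \<subset> s n"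
    proof
      assume "\<exists>s :: nat \<Rightarrow> 'm set. \<forall>n. s n \<in> {S. sieve A a S} \<and> s (Suc n) \<subset> s n"
      then obtain s where s: "\<And>n. sieve A a (s n)" "\<And>n. s (Suc n) \<subset> s n" by blast
      let ?i = "\<lambda>n. sieve_incl (s n) ?M"
      have dom: "Dom PSh (?i n) = sieve_psh (s n)" for n
        using incl[OF s(1)] by (simp add: hom_def)
      have le: "subobject_le PSh (?i (Suc n)) (?i n)" for n
      proof -
        have h: "sieve_incl (s (Suc n)) (s n) \<in> hom PSh (sieve_psh (s (Suc n))) (sieve_psh (s n))"
          by (rule sieve_incl_hom[OF s(1) s(1)]) (use s(2) in blast)
        have "?i (Suc n) = Comp PSh (?i n) (sieve_incl (s (Suc n)) (s n))"
        proof (rule psh_mor_eqI[OF incl[OF s(1)] Comp_PSh_hom[OF h incl[OF s(1)]]])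
          fix b x assume b: "b \<in> Obj A" and x: "x \<in> omap (sieve_psh (s (Suc n))) b"
          then have "x \<in> omap (sieve_psh (s n)) b"
            using app_in[OF h b x] by (simp add: app_sieve_incl)
          then show "app (?i (Suc n)) b x = app (Comp PSh (?i n) (sieve_incl (s (Suc n)) (s n))) b x"
            by (simp add: app_Comp[OF h b x] app_sieve_incl b x)
        qed
        then show ?thesis
          unfolding subobject_le_def dom using h by blast
      qed
      have not_le: "\<not> subobject_le PSh (?i n) (?i (Suc n))" for n
      proof
        assume "subobject_le PSh (?i n) (?i (Suc n))"
        then obtain h where h: "h \<in> hom PSh (sieve_psh (s n)) (sieve_psh (s (Suc n)))"
          and eq: "?i n = Comp PSh (?i (Suc n)) h"
          unfolding subobject_le_def dom by blast
        \<comment> \<open>Both inclusions into the maximal sieve act as the identity on elements, so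
          \<open>h\<close> fixes every \<open>encode f\<close> and carries it into the smaller
          sieve.\<close>
        have "s n \<subseteq> s (Suc n)"
        proof
          fix f assume f: "f \<in> s n"
          then have fM: "f \<in> Mor A" using sieve_Mor[OF s(1)] by blast
          have x: "encode f \<in> omap (sieve_psh (s n)) (Dom A f)"
            using f fM by (simp add: sieve_psh_omap Dom_in)
          have "encode f = app (?i n) (Dom A f) (encode f)"
            using app_sieve_incl[OF Dom_in[OF fM] x] by simp
          also have "\<dots> = app h (Dom A f) (encode f)"
            unfolding eq using app_Comp[OF h Dom_in[OF fM] x] app_sieve_incl[OF Dom_in[OF fM] app_in[OF h Dom_in[OF fM] x]]
            by simp
          also have "\<dots> \<in> omap (sieve_psh (s (Suc n))) (Dom A f)"
            by (rule app_in[OF h Dom_in[OF fM] x])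
          finally obtain g where g: "g \<in> s (Suc n)" "encode f = encode g"
            using fM by (auto simp: sieve_psh_omap Dom_in)
          then show "f \<in> s (Suc n)"
            using inj_onD[OF inj_on_encode g(2) fM] sieve_Mor[OF s(1) g(1)] by simp
        qed
        then show False using s(2)[of n] by blast
      qed
      have "descending_chains_finite (subobject_le PSh) (subobject PSh (sieve_psh ?M))"
        using dcc fp unfolding dcc_category_def by blast
      from descending_chains_finiteD[where s = ?i, OF this sub[OF s(1)] le] not_le show False
        by simp
    qed
    show "\<nexists>s :: nat \<Rightarrow> 'm set. \<forall>n. s n \<in> {S. sieve A a S} \<and> s n \<subset> s (Suc n)"
    proof
      assume "\<exists>s :: nat \<Rightarrow> 'm set. \<forall>n. s n \<in> {S. sieve A a S} \<and> s n \<subset> s (Suc n)"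
      then obtain s where s: "\<And>n. sieve A a (s n)" "\<And>n. s n \<subset> s (Suc n)" by blast
      have s_mono: "s m \<subseteq> s n" if "m \<le> n" for m n
        by (rule lift_Suc_mono_le[of s, OF psubset_imp_subset[OF s(2)] that])
      define V where "V = (\<Union>n. s n)"
      have V: "sieve A a V" 
        using sieve_Mor[OF s(1)] sieve_Comp[OF s(1)] unfolding V_def sieve_def by blast
      let ?j = "\<lambda>n. sieve_incl (s n) V"
      have j: "?j n \<in> hom PSh (sieve_psh (s n)) (sieve_psh V)" for n
        by (rule sieve_incl_hom[OF s(1) V]) (auto simp: V_def)
      have img: "app (?j n) b ` omap (sieve_psh (s n)) b = omap (sieve_psh (s n)) b" if "b \<in> Obj A" for n b
        using that by (auto simp: app_sieve_incl image_iff)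
      have dir: "directed_poset (UNIV :: nat set) {(m, n). m \<le> n}"
        unfolding directed_poset_def partial_order_on_def preorder_on_def
        by (auto simp: refl_on_def trans_def antisym_def intro: max.cobounded1 max.cobounded2)
      obtain I :: "'u set" and r D c where I: "small U I" "directed_poset I r"
        "is_functor (poset_cat I r) PSh D" "is_colimit (poset_cat I r) PSh D (sieve_psh V) c"
        and Ic: "\<And>i. i \<in> I \<Longrightarrow> \<exists>n\<in>UNIV. omap D i = sieve_psh (s n) \<and> c i = ?j n"
      proof (rule directed_union_colimit[OF small_nat[OF regular] dir, of ?j "\<lambda>n. sieve_psh (s n)" "sieve_psh V"])
        show "app (?j m) b ` omap (sieve_psh (s m)) b \<subseteq> app (?j n) b ` omap (sieve_psh (s n)) b"
          if "(m, n) \<in> {(m, n). m \<le> n}" "b \<in> Obj A" for m n b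
          unfolding img[OF that(2)] using that s_mono[of m n] by (auto simp: sieve_psh_omap)
        show "\<exists>n\<in>UNIV. z \<in> app (?j n) b ` omap (sieve_psh (s n)) b" if "b \<in> Obj A" "z \<in> omap (sieve_psh V) b" for b z
          unfolding img[OF that(1)] using that by (auto simp: sieve_psh_omap V_def)
      qed (use j in \<open>auto simp: app_sieve_incl\<close>)
      obtain i \<psi> where i: "i \<in> I" and \<psi>: "\<psi> \<in> hom PSh (sieve_psh V) (omap D i)"
        and id: "Comp PSh (c i) \<psi> = Id PSh (sieve_psh V)"
        using category.finitely_presentable_factor[OF category_PSh fp_sieve[OF V] I Id_PSh_hom[OF sieve_psh_Obj[OF V]]]
        by blast
      obtain n where n: "omap D i = sieve_psh (s n)" "c i = ?j n" using Ic[OF i] by blast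
      have \<psi>: "\<psi> \<in> hom PSh (sieve_psh V) (sieve_psh (s n))" using \<psi> n by simp
      have "V \<subseteq> s n"
      proof
        fix f assume f: "f \<in> V"
        then have fM: "f \<in> Mor A" using sieve_Mor[OF V] by blast
        note b = Dom_in[OF fM]
        have x: "encode f \<in> omap (sieve_psh V) (Dom A f)"
          using f b by (simp add: sieve_psh_omap)
        have "encode f = app (Comp PSh (?j n) \<psi>) (Dom A f) (encode f)"
          using id n(2) app_Id[OF b x] by simp
        also have "\<dots> = app \<psi> (Dom A f) (encode f)"
          using app_Comp[OF \<psi> b x] app_sieve_incl[OF b app_in[OF \<psi> b x]] by simp
        also have "\<dots> \<in> omap (sieve_psh (s n)) (Dom A f)"
          by (rule app_in[OF \<psi> b x])
        finally obtain g where g: "g \<in> s n" "encode f = encode g"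
          using b by (auto simp: sieve_psh_omap)
        then show "f \<in> s n"
          using inj_onD[OF inj_on_encode g(2) fM] sieve_Mor[OF s(1) g(1)] by simp
      qed
      then show False using s(2)[of n] unfolding V_def by blast
    qed
  qed
  moreover have "{S. sieve A a S} = {T \<in> {S. sieve A a S}. T \<subseteq> ?M}"
    using sieve_subset_max by auto
  ultimately show ?thesis by simp
qed

end

lemma strong_epi_morD:
  assumes "strong_epi_mor C e" "mono_mor C m" and e: "e \<in> hom C X Y" and m: "m \<in> hom C P Q"
    and "u \<in> hom C X P" "v \<in> hom C Y Q" "Comp C m u = Comp C v e"
  shows "\<exists>d\<in>hom C Y P. Comp C d e = u \<and> Comp C m d = v"
proof -
  have "Dom C e = X" "Cod C e = Y" "Dom C m = P" "Cod C m = Q"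
    using e m by (simp_all add: hom_def)
  then show ?thesis using assms(1,2,5-) unfolding strong_epi_mor_def by blast
qed

subsection \<open>Finitely generated presheaves over a category with finite sieve lattices\<close>

context presheaves
begin

section \<open>Subpresheaves, and strong epimorphisms and isomorphisms in terms of elements\<close>

definition subpsh :: "('o, 'm, 'u) psh \<Rightarrow> ('o \<Rightarrow> 'u set) \<Rightarrow> ('o, 'm, 'u) psh" where
  "subpsh Y S = mkpsh S (act Y)"

definition closed_family :: "('o, 'm, 'u) psh \<Rightarrow> ('o \<Rightarrow> 'u set) \<Rightarrow> bool" where
  "closed_family Y S \<longleftrightarrow> (\<forall>a\<in>Obj A. S a \<subseteq> omap Y a) \<and>
     (\<forall>f\<in>Mor A. \<forall>x\<in>S (Cod A f). act Y f x \<in> S (Dom A f))"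

lemma subpsh_Obj:
  assumes Y: "Y \<in> Obj PSh" and S: "closed_family Y S"
  shows "subpsh Y S \<in> Obj PSh"
  unfolding subpsh_def
proof (rule mkpsh_Obj)
  show "small U (S a)" if "a \<in> Obj A" for a
    using small_subset[OF small_psh[OF Y that]] S that by (simp add: closed_family_def)
  show "act Y f x \<in> S (Dom A f)" if "f \<in> Mor A" "x \<in> S (Cod A f)" for f x
    using S that by (simp add: closed_family_def)
  show "act Y (Id A a) x = x" if "a \<in> Obj A" "x \<in> S a" for a x
    using S that act_Id[OF Y that(1)] by (auto simp: closed_family_def)
  show "act Y (Comp A g f) x = act Y f (act Y g x)"
    if "f \<in> Mor A" "g \<in> Mor A" "Cod A f = Dom A g" "x \<in> S (Cod A g)" for f g x
    using S that Cod_in[OF that(2)] act_Comp[OF Y that(1-3)] by (auto simp: closed_family_def)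
qed

lemma subpsh_omap: "a \<in> Obj A \<Longrightarrow> omap (subpsh Y S) a = S a"
  by (simp add: subpsh_def omap_mkpsh)

lemma subpsh_act: "f \<in> Mor A \<Longrightarrow> x \<in> S (Cod A f) \<Longrightarrow> act (subpsh Y S) f x = act Y f x"
  by (simp add: subpsh_def act_mkpsh)

lemma subpsh_incl:
  assumes Y: "Y \<in> Obj PSh" and S: "closed_family Y S"
  shows "mknt (subpsh Y S) (\<lambda>a x. x) Y \<in> hom PSh (subpsh Y S) Y"
  by (rule mknt_hom[OF subpsh_Obj[OF Y S] Y])
    (use S in \<open>auto simp: subpsh_omap subpsh_act closed_family_def Cod_in\<close>)

text \<open>The morphism \<open>e\<close> factors through its pointwise image, whose inclusion is a
  monomorphism. The diagonal of the resulting square splits this inclusion, so the image is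
  everything.\<close>

lemma strong_epi_mor_surjective:
  assumes e: "e \<in> hom PSh P Q" and strong: "strong_epi_mor PSh e" and a: "a \<in> Obj A"
  shows "app e a ` omap P a = omap Q a"
proof
  show "app e a ` omap P a \<subseteq> omap Q a" using app_in[OF e a] by blast
  note Q = psh_mor_Cod[OF e]
  interpret PSh: category PSh by (rule category_PSh)
  let ?S = "\<lambda>a. app e a ` omap P a"
  let ?j = "mknt (subpsh Q ?S) (\<lambda>a x. x) Q"
  have S: "closed_family Q ?S"
    using app_in[OF e] act_in[OF psh_mor_Dom[OF e]] unfolding closed_family_def
    by (auto simp: app_act[OF e, symmetric])
  note j = subpsh_incl[OF Q S]
  have app_j: "app ?j b x = x" if "b \<in> Obj A" "x \<in> ?S b" for b x
    using that by (intro app_mknt) (auto simp: subpsh_omap)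
  have j_inj: "x = y" if "b \<in> Obj A" "x \<in> omap (subpsh Q ?S) b" "y \<in> omap (subpsh Q ?S) b"
    "app ?j b x = app ?j b y" for b x y
    using that app_j by (simp add: subpsh_omap)
  obtain u where u: "u \<in> hom PSh P (subpsh Q ?S)" "Comp PSh ?j u = e"
  proof (rule lift_through_injective[OF j j_inj e])
    show "app e b z \<in> app ?j b ` omap (subpsh Q ?S) b" if "b \<in> Obj A" "z \<in> omap P b" for b z
      using that by (intro image_eqI[of _ _ "app e b z"]) (auto simp: app_j subpsh_omap)
  qed (use that in blast)+
  have mono: "mono_mor PSh ?j" by (rule injective_mono_mor[OF j j_inj])
  have "Comp PSh ?j u = Comp PSh (Id PSh Q) e"
    using u(2) PSh.Id_left[OF e] by simp
  from strong_epi_morD[OF strong mono e j u(1) PSh.Id_in[OF Q] this]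
  obtain d where d: "d \<in> hom PSh Q (subpsh Q ?S)" "Comp PSh ?j d = Id PSh Q"
    by blast
  show "omap Q a \<subseteq> app e a ` omap P a"
  proof
    fix z assume z: "z \<in> omap Q a"
    have dz: "app d a z \<in> ?S a" using app_in[OF d(1) a z] a by (simp add: subpsh_omap)
    have "z = app ?j a (app d a z)"
      using app_Comp[OF d(1) a z, of ?j] d(2) app_Id[OF a z] by simp
    also have "\<dots> = app d a z" by (rule app_j[OF a dz])
    finally show "z \<in> app e a ` omap P a" using dz by simp
  qed
qed

lemma bijective_iso_mor:
  assumes \<sigma>: "\<sigma> \<in> hom PSh P Q"
    and inj: "\<And>a x y. \<lbrakk>a \<in> Obj A; x \<in> omap P a; y \<in> omap P a; app \<sigma> a x = app \<sigma> a y\<rbrakk> \<Longrightarrow> x = y"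
    and surj: "\<And>a z. a \<in> Obj A \<Longrightarrow> z \<in> omap Q a \<Longrightarrow> z \<in> app \<sigma> a ` omap P a"
  shows "iso_mor PSh \<sigma>"
proof -
  interpret PSh: category PSh by (rule category_PSh)
  note P = psh_mor_Dom[OF \<sigma>] and Q = psh_mor_Cod[OF \<sigma>]
  obtain \<mu> where \<mu>: "\<mu> \<in> hom PSh Q P" "Comp PSh \<sigma> \<mu> = Id PSh Q"
  proof (rule lift_through_injective[OF \<sigma> inj Id_PSh_hom[OF Q]])
    show "app (Id PSh Q) a z \<in> app \<sigma> a ` omap P a" if "a \<in> Obj A" "z \<in> omap Q a" for a z
      using surj[OF that] app_Id[OF that] by simp
  qed (use that in blast)+
  have mono: "mono_mor PSh \<sigma>" by (rule injective_mono_mor[OF \<sigma> inj])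
  have "Comp PSh \<sigma> (Comp PSh \<mu> \<sigma>) = Comp PSh \<sigma> (Id PSh P)"
    using PSh.Comp_assoc[OF \<sigma> \<mu>(1) \<sigma>] \<mu>(2) PSh.Id_left[OF \<sigma>] PSh.Id_right[OF \<sigma>] by simp
  then have "Comp PSh \<mu> \<sigma> = Id PSh P"
    by (rule mono_morD[OF mono \<sigma> P PSh.Comp_in[OF \<sigma> \<mu>(1)] Id_PSh_hom[OF P]])
  then show ?thesis
    using \<sigma> \<mu> unfolding iso_mor_def by (auto simp: hom_def)
qed

section \<open>Finite generation\<close>

definition finitely_generated :: "('o, 'm, 'u) psh \<Rightarrow> bool" where
  "finitely_generated P \<longleftrightarrow> P \<in> Obj PSh \<and> (\<exists>G. finite G \<and> generates P G)"

lemma finitely_generated_image: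
  assumes e: "e \<in> hom PSh P Q" and surj: "\<And>a z. a \<in> Obj A \<Longrightarrow> z \<in> omap Q a \<Longrightarrow> z \<in> app e a ` omap P a"
    and P: "finitely_generated P"
  shows "finitely_generated Q"
proof -
  obtain G where G: "finite G" "generates P G" using P unfolding finitely_generated_def by blast
  have "generates Q ((\<lambda>p. (fst p, app e (fst p) (snd p))) ` G)"
    unfolding generates_def
  proof (intro conjI ballI)
    show "(\<lambda>p. (fst p, app e (fst p) (snd p))) ` G \<subseteq> Sigma (Obj A) (omap Q)"
      using generatesD[OF G(2)] app_in[OF e] by auto
    fix a z assume a: "a \<in> Obj A" and "z \<in> omap Q a"
    then obtain x where x: "x \<in> omap P a" "z = app e a x" using surj by blast
    then obtain p f where p: "p \<in> G" "f \<in> hom A a (fst p)" "x = act P f (snd p)"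
      using G(2) a unfolding generates_def by blast
    then have "z = act Q f (app e (fst p) (snd p))"
      using app_act_hom[OF e p(2)] generatesD[OF G(2) p(1)] x(2) by simp
    then show "\<exists>p\<in>(\<lambda>p. (fst p, app e (fst p) (snd p))) ` G. \<exists>f\<in>hom A a (fst p). z = act Q f (snd p)"
      using p by auto
  qed
  then show ?thesis
    using psh_mor_Cod[OF e] G(1) unfolding finitely_generated_def by blast
qed

section \<open>Relations between generators and subobjects of squares\<close>

text \<open>\<open>precongruences N ob\<close> are the subpresheaves of the square of the coproduct of the
  representables on the objects \<open>ob i\<close>, \<open>i \<in> N\<close>: the pair of \<open>f\<close> in the summand \<open>i\<close> and \<open>g\<close> in the
  summand \<open>j\<close> is encoded by \<open>(i, f, j, g)\<close>.\<close>

definition precongruences :: "'n set \<Rightarrow> ('n \<Rightarrow> 'o) \<Rightarrow> ('n \<times> 'm \<times> 'n \<times> 'm) set set" where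
  "precongruences N ob = {K.
     (\<forall>(i, f, j, g)\<in>K. i \<in> N \<and> j \<in> N \<and> (\<exists>c. f \<in> hom A c (ob i) \<and> g \<in> hom A c (ob j))) \<and>
     (\<forall>(i, f, j, g)\<in>K. \<forall>t\<in>Mor A. Cod A t = Dom A f \<longrightarrow> (i, Comp A f t, j, Comp A g t) \<in> K)}"

lemma precongruencesD:
  assumes "K \<in> precongruences N ob" "(i, f, j, g) \<in> K"
  shows "i \<in> N" "j \<in> N" "f \<in> hom A (Dom A f) (ob i)" "g \<in> hom A (Dom A f) (ob j)"
    "t \<in> hom A d (Dom A f) \<Longrightarrow> (i, Comp A f t, j, Comp A g t) \<in> K"
  using assms by (fastforce simp: precongruences_def hom_def)+

lemma precongruence_generators:
  fixes N :: "'n set"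
  assumes fin: "finite (precongruences N ob)" and K: "K \<in> precongruences N ob"
  shows "\<exists>F\<subseteq>K. finite F \<and> (\<forall>i f j g. (i, f, j, g) \<in> K \<longrightarrow>
    (\<exists>f' g' t. (i, f', j, g') \<in> F \<and> t \<in> hom A (Dom A f) (Dom A f') \<and> f = Comp A f' t \<and> g = Comp A g' t))"
proof -
  \<comment> \<open>There are only finitely many principal subrelations, and one generator for each suffices.\<close>
  define pr where "pr = (\<lambda>(i :: 'n, f, j :: 'n, g). {(i, Comp A f t, j, Comp A g t) | t. t \<in> Mor A \<and> Cod A t = Dom A f})"
  have "pr ` K \<subseteq> precongruences N ob"
  proof (clarify)
    fix i f j g assume "(i, f, j, g) \<in> K"
    note k = precongruencesD[OF K this]
    show "pr (i, f, j, g) \<in> precongruences N ob"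
      unfolding precongruences_def
    proof (intro CollectI conjI ballI; clarify)
      fix i' f' j' g' assume "(i', f', j', g') \<in> pr (i, f, j, g)"
      then obtain t where t: "t \<in> hom A (Dom A t) (Dom A f)" "i' = i" "j' = j" "f' = Comp A f t" "g' = Comp A g t"
        by (auto simp: pr_def hom_def)
      note ft = Comp_in[OF t(1) k(3)] Comp_in[OF t(1) k(4)]
      show "i' \<in> N \<and> j' \<in> N \<and> (\<exists>c. f' \<in> hom A c (ob i') \<and> g' \<in> hom A c (ob j'))"
        using k(1,2) ft t(2-) by blast
      fix s assume "s \<in> Mor A" "Cod A s = Dom A f'"
      then have s: "s \<in> hom A (Dom A s) (Dom A t)" using ft(1) t(4) by (simp add: hom_def)
      have "Comp A t s \<in> Mor A \<and> Cod A (Comp A t s) = Dom A f"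
        using Comp_in[OF s t(1)] by (simp add: hom_def)
      then show "(i', Comp A f' s, j', Comp A g' s) \<in> pr (i, f, j, g)"
        using Comp_assoc[OF s t(1) k(3)] Comp_assoc[OF s t(1) k(4)] t(2-)
        unfolding pr_def by (auto intro!: exI[of _ "Comp A t s"])
    qed
  qed
  then have "finite (pr ` K)" using fin by (rule finite_subset)
  then obtain F where F: "F \<subseteq> K" "finite F" "pr ` K = pr ` F"
    using finite_subset_image[of "pr ` K" pr K] by blast
  have "\<exists>f' g' t. (i, f', j, g') \<in> F \<and> t \<in> hom A (Dom A f) (Dom A f') \<and> f = Comp A f' t \<and> g = Comp A g' t"
    if ifjg: "(i, f, j, g) \<in> K" for i f j g
  proof -
    note k = precongruencesD[OF K ifjg]
    have D: "Dom A f \<in> Obj A" by (rule hom_Obj(2)[OF k(3)])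
    \<comment> \<open>Composing with an identity puts each quadruple into its own principal
      subrelation, which equals that of a member of \<open>F\<close>; this membership yields the
      required \<open>t\<close>.\<close>
    have "(i, Comp A f (Id A (Dom A f)), j, Comp A g (Id A (Dom A f))) \<in> pr (i, f, j, g)"
      using D by (auto simp: pr_def cat_simps)
    then have "(i, f, j, g) \<in> pr (i, f, j, g)"
      by (simp add: Id_right[OF k(3)] Id_right[OF k(4)])
    moreover have "pr (i, f, j, g) \<in> pr ` F"
      using F(3) ifjg by blast
    ultimately obtain i' f' j' g' where *: "(i', f', j', g') \<in> F" "(i, f, j, g) \<in> pr (i', f', j', g')"
      by auto
    then obtain t where t: "t \<in> Mor A" "Cod A t = Dom A f'" "i = i'" "j = j'" "f = Comp A f' t" "g = Comp A g' t"
      by (auto simp: pr_def)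
    have "f' \<in> Mor A" using precongruencesD(3)[OF K, of i' f' j' g'] *(1) F(1) by (auto simp: hom_def)
    then have "Dom A f = Dom A t" using t Dom_Comp by simp
    then show ?thesis using t *(1) by (auto simp: hom_def)
  qed
  then show ?thesis using F(1,2) by blast
qed

text \<open>All relations that hold among the family \<open>x\<close> in \<open>P\<close>. The index
  set is kept free: it is a generating set for finite presentability, and the set of positions of a
  list in \<open>presentation\<close>, where repetitions may occur.\<close>

definition kernel :: "('o, 'm, 'u) psh \<Rightarrow> 'n set \<Rightarrow> ('n \<Rightarrow> 'o \<times> 'u) \<Rightarrow> ('n \<times> 'm \<times> 'n \<times> 'm) set" where
  "kernel P N x = {(i, f, j, g). i \<in> N \<and> j \<in> N \<and>
     (\<exists>c. f \<in> hom A c (fst (x i)) \<and> g \<in> hom A c (fst (x j))) \<and> act P f (snd (x i)) = act P g (snd (x j))}"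

lemma kernel_precongruence:
  assumes P: "P \<in> Obj PSh" and x: "\<And>i. i \<in> N \<Longrightarrow> x i \<in> Sigma (Obj A) (omap P)"
  shows "kernel P N x \<in> precongruences N (\<lambda>i. fst (x i))"
  unfolding precongruences_def
proof (intro CollectI conjI ballI; clarify)
  fix i f j g assume "(i, f, j, g) \<in> kernel P N x"
  then obtain c where k: "i \<in> N" "j \<in> N" "f \<in> hom A c (fst (x i))" "g \<in> hom A c (fst (x j))"
    "act P f (snd (x i)) = act P g (snd (x j))" by (auto simp: kernel_def)
  then show "i \<in> N \<and> j \<in> N \<and> (\<exists>c. f \<in> hom A c (fst (x i)) \<and> g \<in> hom A c (fst (x j)))"
    by blast
  fix t assume "t \<in> Mor A" "Cod A t = Dom A f"
  then have t: "t \<in> hom A (Dom A t) c" using k(3) by (simp add: hom_def)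
  have xs: "snd (x i) \<in> omap P (fst (x i))" "snd (x j) \<in> omap P (fst (x j))"
    using x[OF k(1)] x[OF k(2)] by auto
  show "(i, Comp A f t, j, Comp A g t) \<in> kernel P N x"
    using k Comp_in[OF t k(3)] Comp_in[OF t k(4)] act_Comp_hom[OF P t k(3) xs(1)] act_Comp_hom[OF P t k(4) xs(2)]
    unfolding kernel_def by auto
qed

text \<open>\<open>subrelations P\<close> are the subpresheaves of \<open>P \<times> P\<close>; their number is the grade of \<open>P\<close>.\<close>

definition subrelations :: "('o, 'm, 'u) psh \<Rightarrow> ('o \<times> 'u \<times> 'u) set set" where
  "subrelations P = {R. (\<forall>(a, x, y)\<in>R. a \<in> Obj A \<and> x \<in> omap P a \<and> y \<in> omap P a) \<and>
     (\<forall>(a, x, y)\<in>R. \<forall>b. \<forall>f\<in>hom A b a. (b, act P f x, act P f y) \<in> R)}"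

lemma subrelationsI:
  assumes "\<And>a x y. (a, x, y) \<in> R \<Longrightarrow> a \<in> Obj A \<and> x \<in> omap P a \<and> y \<in> omap P a"
    and "\<And>a x y b f. (a, x, y) \<in> R \<Longrightarrow> f \<in> hom A b a \<Longrightarrow> (b, act P f x, act P f y) \<in> R"
  shows "R \<in> subrelations P"
  using assms unfolding subrelations_def by blast

lemma subrelationsD:
  assumes "R \<in> subrelations P" "(a, x, y) \<in> R"
  shows "a \<in> Obj A" "x \<in> omap P a" "y \<in> omap P a" "f \<in> hom A b a \<Longrightarrow> (b, act P f x, act P f y) \<in> R"
  using assms unfolding subrelations_def by blast+

end

section \<open>Finiteness of squares when all sieve lattices are finite\<close>

locale presheaves_finite_sieves = presheaves A U
  for A :: "('o, 'm) cat" and U :: "'u itself" +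
  assumes products: "has_binary_products A"
    and finite_sieves: "a \<in> Obj A \<Longrightarrow> finite {S. sieve A a S}"
begin

lemma finite_precongruences:
  assumes N: "finite N" and ob: "\<And>i. i \<in> N \<Longrightarrow> ob i \<in> Obj A"
  shows "finite (precongruences N ob)"
proof -
  \<comment> \<open>The part of a precongruence in the summands \<open>i\<close> and \<open>j\<close> is a sieve on the product of \<open>ob i\<close> and
    \<open>ob j\<close>.\<close>
  have "\<exists>w. a \<in> Obj A \<longrightarrow> b \<in> Obj A \<longrightarrow> fst w \<in> Obj A \<and>
      fst (snd w) \<in> hom A (fst w) a \<and> snd (snd w) \<in> hom A (fst w) b \<and>
      (\<forall>x\<in>Obj A. \<forall>f\<in>hom A x a. \<forall>g\<in>hom A x b.
        \<exists>h\<in>hom A x (fst w). Comp A (fst (snd w)) h = f \<and> Comp A (snd (snd w)) h = g)" for a b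
  proof (cases "a \<in> Obj A \<and> b \<in> Obj A")
    case True
    with products have "\<exists>p\<in>Obj A. \<exists>\<pi>1\<in>hom A p a. \<exists>\<pi>2\<in>hom A p b. \<forall>x\<in>Obj A. \<forall>f\<in>hom A x a.
        \<forall>g\<in>hom A x b. \<exists>!h. h \<in> hom A x p \<and> Comp A \<pi>1 h = f \<and> Comp A \<pi>2 h = g"
      unfolding has_binary_products_def by simp
    then obtain p \<pi>1 \<pi>2 where *: "p \<in> Obj A" "\<pi>1 \<in> hom A p a" "\<pi>2 \<in> hom A p b"
      "\<forall>x\<in>Obj A. \<forall>f\<in>hom A x a. \<forall>g\<in>hom A x b. \<exists>!h. h \<in> hom A x p \<and> Comp A \<pi>1 h = f \<and> Comp A \<pi>2 h = g"
      by (elim bexE) (rule that)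
    have "\<exists>h\<in>hom A x p. Comp A \<pi>1 h = f \<and> Comp A \<pi>2 h = g"
      if "x \<in> Obj A" "f \<in> hom A x a" "g \<in> hom A x b" for x f g
      using *(4) that by blast
    then show ?thesis using *(1-3) by (intro exI[of _ "(p, \<pi>1, \<pi>2)"]) simp
  qed simp
  then obtain w where w: "\<And>a b. a \<in> Obj A \<Longrightarrow> b \<in> Obj A \<Longrightarrow> fst (w a b) \<in> Obj A \<and>
      fst (snd (w a b)) \<in> hom A (fst (w a b)) a \<and> snd (snd (w a b)) \<in> hom A (fst (w a b)) b \<and>
      (\<forall>x\<in>Obj A. \<forall>f\<in>hom A x a. \<forall>g\<in>hom A x b.
        \<exists>h\<in>hom A x (fst (w a b)). Comp A (fst (snd (w a b))) h = f \<and> Comp A (snd (snd (w a b))) h = g)"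
    by metis
  define pr where "pr i j = fst (w (ob i) (ob j))" for i j
  define p1 where "p1 i j = fst (snd (w (ob i) (ob j)))" for i j
  define p2 where "p2 i j = snd (snd (w (ob i) (ob j)))" for i j
  have pr: "pr i j \<in> Obj A" and p1: "p1 i j \<in> hom A (pr i j) (ob i)" and p2: "p2 i j \<in> hom A (pr i j) (ob j)"
    if "i \<in> N" "j \<in> N" for i j
    using w[OF ob ob, OF that] by (simp_all add: pr_def p1_def p2_def)
  have pair: "\<exists>h\<in>hom A c (pr i j). Comp A (p1 i j) h = f \<and> Comp A (p2 i j) h = g"
    if "i \<in> N" "j \<in> N" "f \<in> hom A c (ob i)" "g \<in> hom A c (ob j)" for i j f g c
    using w[OF ob ob, OF that(1,2)] that(3,4) hom_Obj(2)[OF that(3)]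
    unfolding pr_def p1_def p2_def by blast
  \<comment> \<open>Restricting to pairs of summands makes \<open>S K\<close> a member of a finite
    product of finite sets of sieves, so that injectivity of \<open>S\<close> bounds the
    precongruences.\<close>
  define S where "S K = (\<lambda>(i, j)\<in>N \<times> N.
      {h \<in> Mor A. Cod A h = pr i j \<and> (i, Comp A (p1 i j) h, j, Comp A (p2 i j) h) \<in> K})" for K
  have "finite ((\<Pi>\<^sub>E (i, j)\<in>N \<times> N. {S. sieve A (pr i j) S}))"
    using N by (intro finite_PiE) (auto intro: finite_sieves pr)
  moreover have "S ` precongruences N ob \<subseteq> (\<Pi>\<^sub>E (i, j)\<in>N \<times> N. {S. sieve A (pr i j) S})"
  proof (clarify)
    fix K assume K: "K \<in> precongruences N ob"
    have "sieve A (pr i j) {h \<in> Mor A. Cod A h = pr i j \<and> (i, Comp A (p1 i j) h, j, Comp A (p2 i j) h) \<in> K}"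
      if ij: "i \<in> N" "j \<in> N" for i j
      unfolding sieve_def
    proof (intro conjI ballI impI)
      fix h g assume h: "h \<in> {h \<in> Mor A. Cod A h = pr i j \<and> (i, Comp A (p1 i j) h, j, Comp A (p2 i j) h) \<in> K}"
        and g: "g \<in> Mor A" "Cod A g = Dom A h"
      have h': "h \<in> hom A (Dom A h) (pr i j)" and g': "g \<in> hom A (Dom A g) (Dom A h)"
        using h g by (simp_all add: hom_def)
      have "Dom A (Comp A (p1 i j) h) = Dom A h"
        using Comp_in[OF h' p1[OF ij]] by (simp add: hom_def)
      then have "(i, Comp A (Comp A (p1 i j) h) g, j, Comp A (Comp A (p2 i j) h) g) \<in> K"
        using precongruencesD(5)[OF K, of i "Comp A (p1 i j) h" j "Comp A (p2 i j) h" g "Dom A g"] h g' by simp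
      then show "Comp A h g \<in> {h \<in> Mor A. Cod A h = pr i j \<and> (i, Comp A (p1 i j) h, j, Comp A (p2 i j) h) \<in> K}"
        using Comp_assoc[OF g' h' p1[OF ij]] Comp_assoc[OF g' h' p2[OF ij]] Comp_in[OF g' h']
        by (simp add: hom_def)
    qed auto
    then show "S K \<in> (\<Pi>\<^sub>E (i, j)\<in>N \<times> N. {S. sieve A (pr i j) S})"
      by (auto simp: S_def)
  qed
  ultimately have "finite (S ` precongruences N ob)"
    by (rule finite_subset[rotated])
  moreover have "inj_on S (precongruences N ob)"
  proof -
    \<comment> \<open>A pair of morphisms with common domain is recovered from its pairing
      \<open>h\<close> into the product, so membership in \<open>K\<close> can be read off from the
      sieve at \<open>(i, j)\<close>.\<close>
    have le: "K \<subseteq> K'" if K: "K \<in> precongruences N ob" and eq: "S K = S K'" for K K'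
    proof (clarify)
      fix i f j g assume ifjg: "(i, f, j, g) \<in> K"
      note k = precongruencesD[OF K ifjg]
      obtain h where h: "h \<in> hom A (Dom A f) (pr i j)" "Comp A (p1 i j) h = f" "Comp A (p2 i j) h = g"
        using pair[OF k(1-4)] by blast
      have "h \<in> S K (i, j)" using h k(1,2) ifjg by (simp add: S_def hom_def)
      then have "h \<in> S K' (i, j)" by (simp only: eq)
      then show "(i, f, j, g) \<in> K'" using h k(1,2) by (simp add: S_def)
    qed
    show ?thesis
    proof (rule inj_onI)
      fix K K' assume "K \<in> precongruences N ob" "K' \<in> precongruences N ob" "S K = S K'"
      then show "K = K'" using le[of K K'] le[of K' K] by simp
    qed
  qed
  ultimately show ?thesis by (rule finite_imageD)
qed

text \<open>Generators give a pointwise surjection onto \<open>P\<close> from a finite coproduct of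
  representables. Pulling subrelations back along its square is injective and lands in the finite
  set of precongruences.\<close>

lemma finite_subrelations:
  assumes "finitely_generated P"
  shows "finite (subrelations P)"
proof -
  obtain G where P: "P \<in> Obj PSh" and G: "finite G" "generates P G"
    using assms unfolding finitely_generated_def by blast
  define \<Phi> where "\<Phi> R = {(p, f, q, g). p \<in> G \<and> q \<in> G \<and>
    (\<exists>c. f \<in> hom A c (fst p) \<and> g \<in> hom A c (fst q) \<and> (c, act P f (snd p), act P g (snd q)) \<in> R)}" for R
  have "\<Phi> ` subrelations P \<subseteq> precongruences G fst"
  proof (clarify)
    fix R assume R: "R \<in> subrelations P"
    show "\<Phi> R \<in> precongruences G fst"
      unfolding precongruences_def
    proof (intro CollectI conjI ballI; (simp only: split_paired_all case_prod_conv)?)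
      fix a x f b y g assume "((a, x), f, (b, y), g) \<in> \<Phi> R"
      then obtain c where k: "(a, x) \<in> G" "(b, y) \<in> G" "f \<in> hom A c a" "g \<in> hom A c b"
        "(c, act P f x, act P g y) \<in> R" by (auto simp: \<Phi>_def)
      then show "(a, x) \<in> G \<and> (b, y) \<in> G \<and> (\<exists>c. f \<in> hom A c (fst (a, x)) \<and> g \<in> hom A c (fst (b, y)))"
        by auto
      show "\<forall>t\<in>Mor A. Cod A t = Dom A f \<longrightarrow> ((a, x), Comp A f t, (b, y), Comp A g t) \<in> \<Phi> R"
      proof (intro ballI impI)
        fix t assume "t \<in> Mor A" "Cod A t = Dom A f"
        then have t: "t \<in> hom A (Dom A t) c" using k(3) by (simp add: hom_def)
        have xs: "x \<in> omap P a" "y \<in> omap P b"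
          using generatesD(2)[OF G(2) k(1)] generatesD(2)[OF G(2) k(2)] by auto
        have "(Dom A t, act P (Comp A f t) x, act P (Comp A g t) y) \<in> R"
          using subrelationsD(4)[OF R k(5) t] act_Comp_hom[OF P t k(3) xs(1)] act_Comp_hom[OF P t k(4) xs(2)]
          by simp
        then show "((a, x), Comp A f t, (b, y), Comp A g t) \<in> \<Phi> R"
          using k(1,2) Comp_in[OF t k(3)] Comp_in[OF t k(4)] by (auto simp: \<Phi>_def)
      qed
    qed
  qed
  moreover have "finite (precongruences G fst)"
    using G(1) generatesD(1)[OF G(2)] by (rule finite_precongruences)
  ultimately have "finite (\<Phi> ` subrelations P)"
    by (rule finite_subset)
  moreover have "inj_on \<Phi> (subrelations P)"
  proof -
    have le: "R \<subseteq> R'" if R: "R \<in> subrelations P" and eq: "\<Phi> R = \<Phi> R'" for R R'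
    proof (clarify)
      fix a x y assume axy: "(a, x, y) \<in> R"
      note r = subrelationsD[OF R axy]
      obtain p f where p: "p \<in> G" "f \<in> hom A a (fst p)" "x = act P f (snd p)"
        using G(2) r(1,2) unfolding generates_def by blast
      obtain q g where q: "q \<in> G" "g \<in> hom A a (fst q)" "y = act P g (snd q)"
        using G(2) r(1,3) unfolding generates_def by blast
      have "(p, f, q, g) \<in> \<Phi> R" using p q axy by (auto simp: \<Phi>_def)
      then have "(p, f, q, g) \<in> \<Phi> R'" by (simp only: eq)
      then show "(a, x, y) \<in> R'" using p q by (auto simp: \<Phi>_def hom_def)
    qed
    show ?thesis
    proof (rule inj_onI)
      fix K K' assume "K \<in> subrelations P" "K' \<in> subrelations P" "\<Phi> K = \<Phi> K'"
      then show "K = K'" using le[of K K'] le[of K' K] by simp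
    qed
  qed
  ultimately show ?thesis by (rule finite_imageD)
qed

lemma finitely_generated_imp_finitely_presentable:
  assumes "finitely_generated P"
  shows "finitely_presentable U PSh P"
proof -
  obtain G where P: "P \<in> Obj PSh" and G: "finite G" "generates P G"
    using assms unfolding finitely_generated_def by blast
  have K: "kernel P G (\<lambda>p. p) \<in> precongruences G fst"
    by (rule kernel_precongruence[OF P]) (use G(2) in \<open>auto simp: generates_def\<close>)
  have "finite (precongruences G fst)"
    using G(1) generatesD(1)[OF G(2)] by (rule finite_precongruences)
  from precongruence_generators[OF this K] obtain F where F: "F \<subseteq> kernel P G (\<lambda>p. p)" "finite F"
    "\<And>p f q g. (p, f, q, g) \<in> kernel P G (\<lambda>p. p) \<Longrightarrow>
      \<exists>f' g' t. (p, f', q, g') \<in> F \<and> t \<in> hom A (Dom A f) (Dom A f') \<and> f = Comp A f' t \<and> g = Comp A g' t"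
    by blast
  show ?thesis
  proof (rule finitely_presentable_PShI[OF P G(2,1) F(2)])
    show "p \<in> G \<and> q \<in> G \<and> (\<exists>c. f \<in> hom A c (fst p) \<and> g \<in> hom A c (fst q)) \<and> act P f (snd p) = act P g (snd q)"
      if "(p, f, q, g) \<in> F" for p f q g
    proof -
      have "(p, f, q, g) \<in> kernel P G (\<lambda>p. p)" using that F(1) by blast
      then show ?thesis unfolding kernel_def by simp
    qed
    show "\<exists>f' g' t. (p, f', q, g') \<in> F \<and> t \<in> hom A c (Dom A f') \<and> f = Comp A f' t \<and> g = Comp A g' t"
      if "p \<in> G" "q \<in> G" "f \<in> hom A c (fst p)" "g \<in> hom A c (fst q)" "act P f (snd p) = act P g (snd q)"
      for p q c f g
    proof -
      have "(p, f, q, g) \<in> kernel P G (\<lambda>p. p)" using that unfolding kernel_def by auto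
      from F(3)[OF this] show ?thesis using that(3) by (simp add: hom_def)
    qed
  qed
qed

text \<open>Each element of \<open>Z\<close> generates a principal subpresheaf, recorded through
  \<open>m\<close> as a set of diagonal pairs over \<open>P\<close>. Only finitely many such
  subrelations exist, and injectivity of \<open>m\<close> shows that one element for each generates
  \<open>Z\<close>.\<close>

lemma finitely_generated_subpresheaf:
  assumes m: "m \<in> hom PSh Z P"
    and inj: "\<And>a x y. \<lbrakk>a \<in> Obj A; x \<in> omap Z a; y \<in> omap Z a; app m a x = app m a y\<rbrakk> \<Longrightarrow> x = y"
    and P: "finitely_generated P"
  shows "finitely_generated Z"
proof -
  note Z = psh_mor_Dom[OF m]
  define pr where "pr p = {(b, app m b (act Z f (snd p)), app m b (act Z f (snd p))) | b f. f \<in> hom A b (fst p)}" for p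
  let ?E = "Sigma (Obj A) (omap Z)"
  have "pr ` ?E \<subseteq> subrelations P"
  proof (clarify)
    fix a z assume a: "a \<in> Obj A" and z: "z \<in> omap Z a"
    show "pr (a, z) \<in> subrelations P"
    proof (rule subrelationsI)
      fix b x y assume "(b, x, y) \<in> pr (a, z)"
      then obtain f where f: "f \<in> hom A b a" "x = app m b (act Z f z)" "y = app m b (act Z f z)"
        by (auto simp: pr_def)
      show "b \<in> Obj A \<and> x \<in> omap P b \<and> y \<in> omap P b"
        using app_in[OF m hom_Obj(2)[OF f(1)] act_hom[OF Z f(1) z]] hom_Obj(2)[OF f(1)] f by simp
      fix c g assume g: "g \<in> hom A c b"
      have "act P g x = app m c (act Z (Comp A f g) z)"
        using app_act_hom[OF m g act_hom[OF Z f(1) z]] act_Comp_hom[OF Z g f(1) z] f(2) by simp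
      then show "(c, act P g x, act P g y) \<in> pr (a, z)"
        using Comp_in[OF g f(1)] f(2,3) unfolding pr_def by auto
    qed
  qed
  then have "finite (pr ` ?E)"
    using finite_subrelations[OF P] by (rule finite_subset)
  then obtain F where F: "F \<subseteq> ?E" "finite F" "pr ` ?E = pr ` F"
    using finite_subset_image[of "pr ` ?E" pr ?E] by blast
  have "generates Z F"
    unfolding generates_def
  proof (intro conjI ballI F(1))
    fix a z assume a: "a \<in> Obj A" and z: "z \<in> omap Z a"
    then have "pr (a, z) \<in> pr ` F" using F(3) by blast
    then obtain p where p: "p \<in> F" "pr (a, z) = pr p" by blast
    have "(a, app m a (act Z (Id A a) z), app m a (act Z (Id A a) z)) \<in> pr (a, z)"
      using Id_in[OF a] unfolding pr_def by auto
    then have "(a, app m a z, app m a z) \<in> pr p"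
      using p(2) act_Id[OF Z a z] by simp
    then obtain f where f: "f \<in> hom A a (fst p)" "app m a z = app m a (act Z f (snd p))"
      unfolding pr_def by auto
    have "snd p \<in> omap Z (fst p)" using p(1) F(1) by auto
    then have "z = act Z f (snd p)"
      by (intro inj[OF a z _ f(2)] act_hom[OF Z f(1)])
    then show "\<exists>p\<in>F. \<exists>f\<in>hom A a (fst p). z = act Z f (snd p)"
      using p(1) f(1) by blast
  qed
  then show ?thesis using Z F(2) unfolding finitely_generated_def by blast
qed

section \<open>The grade of subobjects and quotients\<close>

lemma grade_subpresheaf:
  assumes m: "m \<in> hom PSh Z P"
    and inj: "\<And>a x y. \<lbrakk>a \<in> Obj A; x \<in> omap Z a; y \<in> omap Z a; app m a x = app m a y\<rbrakk> \<Longrightarrow> x = y"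
    and P: "finitely_generated P"
  shows "card (subrelations Z) \<le> card (subrelations P)"
    and "\<not> iso_mor PSh m \<Longrightarrow> card (subrelations Z) < card (subrelations P)"
proof -
  note Z = psh_mor_Dom[OF m] and P' = psh_mor_Cod[OF m]
  define \<Phi> where "\<Phi> R = (\<lambda>(a, x, y). (a, app m a x, app m a y)) ` R" for R
  have sub: "\<Phi> ` subrelations Z \<subseteq> subrelations P"
  proof (clarify)
    fix R assume R: "R \<in> subrelations Z"
    show "\<Phi> R \<in> subrelations P"
    proof (rule subrelationsI)
      fix a x y assume "(a, x, y) \<in> \<Phi> R"
      then obtain x' y' where xy: "(a, x', y') \<in> R" "x = app m a x'" "y = app m a y'"
        by (auto simp: \<Phi>_def)
      note r = subrelationsD[OF R xy(1)]
      show "a \<in> Obj A \<and> x \<in> omap P a \<and> y \<in> omap P a"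
        using r(1) app_in[OF m r(1,2)] app_in[OF m r(1,3)] xy by simp
      fix b f assume f: "f \<in> hom A b a"
      then show "(b, act P f x, act P f y) \<in> \<Phi> R"
        using r(4)[OF f] app_act_hom[OF m f r(2)] app_act_hom[OF m f r(3)] xy(2,3)
        unfolding \<Phi>_def by force
    qed
  qed
  have "inj_on \<Phi> (subrelations Z)"
  proof -
    have le: "R \<subseteq> R'" if R: "R \<in> subrelations Z" and R': "R' \<in> subrelations Z" and eq: "\<Phi> R = \<Phi> R'" for R R'
    proof (clarify)
      fix a x y assume axy: "(a, x, y) \<in> R"
      note r = subrelationsD[OF R axy]
      have "(a, app m a x, app m a y) \<in> \<Phi> R" using axy unfolding \<Phi>_def by force
      then have "(a, app m a x, app m a y) \<in> \<Phi> R'" by (simp only: eq)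
      then obtain x' y' where xy: "(a, x', y') \<in> R'" "app m a x = app m a x'" "app m a y = app m a y'"
        by (auto simp: \<Phi>_def)
      note r' = subrelationsD[OF R' xy(1)]
      show "(a, x, y) \<in> R'"
        using inj[OF r(1) r(2) r'(2) xy(2)] inj[OF r(1) r(3) r'(3) xy(3)] xy(1) by simp
    qed
    show ?thesis
    proof (rule inj_onI)
      fix K K' assume "K \<in> subrelations Z" "K' \<in> subrelations Z" "\<Phi> K = \<Phi> K'"
      then show "K = K'" using le[of K K'] le[of K' K] by simp
    qed
  qed
  then have card: "card (\<Phi> ` subrelations Z) = card (subrelations Z)"
    by (rule card_image)
  show "card (subrelations Z) \<le> card (subrelations P)"
    using card_mono[OF finite_subrelations[OF P] sub] card by simp
  assume not_iso: "\<not> iso_mor PSh m"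
  \<comment> \<open>The map \<Phi> takes direct images along the square of \<open>m\<close>. If the
    full relation were such an image, its diagonal pairs would put every element of \<open>P\<close>
    into the image of \<open>m\<close>.\<close>
  let ?full = "{(a, x, y). a \<in> Obj A \<and> x \<in> omap P a \<and> y \<in> omap P a}"
  have "?full \<in> subrelations P"
    by (rule subrelationsI) (auto simp: hom_Obj act_hom[OF P'])
  moreover have "?full \<notin> \<Phi> ` subrelations Z"
  proof
    assume "?full \<in> \<Phi> ` subrelations Z"
    then obtain R where R: "R \<in> subrelations Z" "\<Phi> R = ?full" by auto
    have surj: "z \<in> app m a ` omap Z a" if "a \<in> Obj A" "z \<in> omap P a" for a z
    proof -
      have "(a, z, z) \<in> \<Phi> R" using R(2) that by simp
      then obtain x y where "(a, x, y) \<in> R" "z = app m a x" by (auto simp: \<Phi>_def)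
      then show ?thesis using subrelationsD(2)[OF R(1)] by blast
    qed
    have "iso_mor PSh m" by (rule bijective_iso_mor[OF m inj surj])
    then show False using not_iso by blast
  qed
  ultimately have "\<Phi> ` subrelations Z \<subset> subrelations P" using sub by blast
  from psubset_card_mono[OF finite_subrelations[OF P] this]
  show "card (subrelations Z) < card (subrelations P)"
    by (simp only: card)
qed

lemma grade_quotient:
  assumes e: "e \<in> hom PSh P Q"
    and surj: "\<And>a z. a \<in> Obj A \<Longrightarrow> z \<in> omap Q a \<Longrightarrow> z \<in> app e a ` omap P a"
    and P: "finitely_generated P"
  shows "card (subrelations Q) \<le> card (subrelations P)"
    and "\<not> iso_mor PSh e \<Longrightarrow> card (subrelations Q) < card (subrelations P)"
proof -
  note P' = psh_mor_Dom[OF e]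
  define \<Phi> where "\<Phi> R = {(a, x, y). a \<in> Obj A \<and> x \<in> omap P a \<and> y \<in> omap P a \<and> (a, app e a x, app e a y) \<in> R}" for R
  have sub: "\<Phi> ` subrelations Q \<subseteq> subrelations P"
  proof (clarify)
    fix R assume R: "R \<in> subrelations Q"
    show "\<Phi> R \<in> subrelations P"
    proof (rule subrelationsI)
      fix a x y assume "(a, x, y) \<in> \<Phi> R"
      then have xy: "a \<in> Obj A" "x \<in> omap P a" "y \<in> omap P a" "(a, app e a x, app e a y) \<in> R"
        by (auto simp: \<Phi>_def)
      then show "a \<in> Obj A \<and> x \<in> omap P a \<and> y \<in> omap P a" by blast
      fix b f assume f: "f \<in> hom A b a"
      show "(b, act P f x, act P f y) \<in> \<Phi> R"
        using subrelationsD(4)[OF R xy(4) f] app_act_hom[OF e f xy(2)] app_act_hom[OF e f xy(3)]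
          act_hom[OF P' f xy(2)] act_hom[OF P' f xy(3)] hom_Obj(2)[OF f]
        by (simp add: \<Phi>_def)
    qed
  qed
  have "inj_on \<Phi> (subrelations Q)"
  proof -
    have le: "R \<subseteq> R'" if R: "R \<in> subrelations Q" and eq: "\<Phi> R = \<Phi> R'" for R R'
    proof (clarify)
      fix a x y assume axy: "(a, x, y) \<in> R"
      note r = subrelationsD[OF R axy]
      obtain x' y' where xy: "x' \<in> omap P a" "x = app e a x'" "y' \<in> omap P a" "y = app e a y'"
        using surj r(1-3) by blast
      have "(a, x', y') \<in> \<Phi> R" using axy xy r(1) by (simp add: \<Phi>_def)
      then have "(a, x', y') \<in> \<Phi> R'" by (simp only: eq)
      then show "(a, x, y) \<in> R'" using xy by (simp add: \<Phi>_def)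
    qed
    show ?thesis
    proof (rule inj_onI)
      fix K K' assume "K \<in> subrelations Q" "K' \<in> subrelations Q" "\<Phi> K = \<Phi> K'"
      then show "K = K'" using le[of K K'] le[of K' K] by simp
    qed
  qed
  then have card: "card (\<Phi> ` subrelations Q) = card (subrelations Q)"
    by (rule card_image)
  show "card (subrelations Q) \<le> card (subrelations P)"
    using card_mono[OF finite_subrelations[OF P] sub] card by simp
  assume not_iso: "\<not> iso_mor PSh e"
  \<comment> \<open>Here \<Phi> takes inverse images along the square of \<open>e\<close>. An
    inverse image containing \<open>(a, x, x)\<close> also contains \<open>(a, x, y)\<close>
    whenever \<open>e\<close> identifies \<open>x\<close> and \<open>y\<close>, so the diagonal is
    one only if \<open>e\<close> is injective.\<close>
  let ?diag = "{(a, x, y). a \<in> Obj A \<and> x \<in> omap P a \<and> y = x}"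
  have "?diag \<in> subrelations P"
    by (rule subrelationsI) (auto simp: hom_Obj act_hom[OF P'])
  moreover have "?diag \<notin> \<Phi> ` subrelations Q"
  proof
    assume "?diag \<in> \<Phi> ` subrelations Q"
    then obtain R where R: "\<Phi> R = ?diag" by auto
    have inj: "x = y" if a: "a \<in> Obj A" and xy: "x \<in> omap P a" "y \<in> omap P a" "app e a x = app e a y" for a x y
    proof -
      have "(a, x, x) \<in> \<Phi> R" using R a xy(1) by simp
      then have "(a, x, y) \<in> \<Phi> R" using xy by (simp add: \<Phi>_def)
      then show ?thesis using R by simp
    qed
    have "iso_mor PSh e" by (rule bijective_iso_mor[OF e inj surj])
    then show False using not_iso by blast
  qed
  ultimately have "\<Phi> ` subrelations Q \<subset> subrelations P" using sub by blast
  from psubset_card_mono[OF finite_subrelations[OF P] this]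
  show "card (subrelations Q) < card (subrelations P)"
    by (simp only: card)
qed

subsection \<open>Local finite presentability\<close>

text \<open>The elements are forgotten and only their objects and relations remain, which determines
  the presheaf up to isomorphism when the list generates it. Lists rather than sets keep distinct
  generators over the same object apart.\<close>

definition presentation :: "('o, 'm, 'u) psh \<Rightarrow> ('o \<times> 'u) list \<Rightarrow> 'o list \<times> (nat \<times> 'm \<times> nat \<times> 'm) set" where
  "presentation P xs = (map fst xs, kernel P {..<length xs} (\<lambda>i. xs ! i))"

definition presentations :: "('o list \<times> (nat \<times> 'm \<times> nat \<times> 'm) set) set" where
  "presentations = {presentation P xs | P xs. P \<in> Obj PSh \<and> generates P (set xs)}"

text \<open>One representative per presentation: by \<open>finitely_generated_presented\<close>,
  these represent all finitely generated presheaves up to isomorphism.\<close>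

definition presented_psh :: "'o list \<times> (nat \<times> 'm \<times> nat \<times> 'm) set \<Rightarrow> ('o, 'm, 'u) psh" where
  "presented_psh v = (SOME P. P \<in> Obj PSh \<and> (\<exists>xs. generates P (set xs) \<and> presentation P xs = v))"

text \<open>For each list of objects only finitely many relations are possible. Bounding them merely
  as subsets of a small set would require power sets of small sets to be small.\<close>

lemma small_presentations: "small U presentations"
proof -
  have sub: "presentations \<subseteq> Sigma (lists (Obj A)) (\<lambda>as. precongruences {..<length as} (\<lambda>i. as ! i))"
  proof
    fix v assume "v \<in> presentations"
    then obtain P xs where P: "P \<in> Obj PSh" "generates P (set xs)" "v = presentation P xs"
      by (auto simp: presentations_def)
    have xs: "set xs \<subseteq> Sigma (Obj A) (omap P)" using P(2) by (simp add: generates_def)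
    have "kernel P {..<length xs} (\<lambda>i. xs ! i) \<in> precongruences {..<length xs} (\<lambda>i. fst (xs ! i))"
      by (rule kernel_precongruence[OF P(1)]) (use xs in \<open>auto dest: nth_mem\<close>)
    also have "\<dots> = precongruences {..<length xs} (\<lambda>i. map fst xs ! i)"
      unfolding precongruences_def by (intro Collect_cong) (auto 0 4 split: prod.splits)
    finally show "v \<in> Sigma (lists (Obj A)) (\<lambda>as. precongruences {..<length as} (\<lambda>i. as ! i))"
      using generatesD(1)[OF P(2)] P(3) by (auto simp: presentation_def)
  qed
  have "small U (precongruences {..<length as} (\<lambda>i. as ! i))" if "as \<in> lists (Obj A)" for as
    using that by (intro small_finite[OF regular] finite_precongruences) auto
  then show ?thesis
    by (rule small_subset[OF small_Sigma[OF regular small_lists[OF regular small_Obj]] sub])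
qed

text \<open>Equal kernels mean that every relation among the generators \<open>xs\<close> also holds
  among \<open>ys\<close>, so sending the former to the latter extends to a morphism.\<close>

lemma presentation_morphism:
  assumes P: "P \<in> Obj PSh" "generates P (set xs)" and Q: "Q \<in> Obj PSh" "generates Q (set ys)"
    and eq: "presentation P xs = presentation Q ys"
  shows "\<exists>\<phi>\<in>hom PSh P Q. \<forall>i<length xs. app \<phi> (fst (xs ! i)) (snd (xs ! i)) = snd (ys ! i)"
proof -
  have fst_eq: "map fst xs = map fst ys"
    and ker: "kernel P {..<length xs} (\<lambda>i. xs ! i) = kernel Q {..<length ys} (\<lambda>i. ys ! i)"
    using eq by (simp_all add: presentation_def)
  have len: "length ys = length xs" using fst_eq by (metis length_map)
  have fst_nth: "fst (ys ! i) = fst (xs ! i)" if "i < length xs" for i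
    using fst_eq that len by (metis nth_map)
  have transfer: "act Q f (snd (ys ! i)) = act Q g (snd (ys ! j))"
    if "i < length xs" "j < length xs" "f \<in> hom A c (fst (xs ! i))" "g \<in> hom A c (fst (xs ! j))"
      "act P f (snd (xs ! i)) = act P g (snd (xs ! j))" for i j f g c
  proof -
    have "(i, f, j, g) \<in> kernel P {..<length xs} (\<lambda>i. xs ! i)"
      using that by (auto simp: kernel_def)
    then show ?thesis unfolding ker by (auto simp: kernel_def)
  qed
  have "\<exists>i<length xs. xs ! i = p" if "p \<in> set xs" for p
    using that by (simp add: in_set_conv_nth)
  then obtain idx where idx: "\<And>p. p \<in> set xs \<Longrightarrow> idx p < length xs \<and> xs ! idx p = p"
    by metis
  have ys: "snd (ys ! i) \<in> omap Q (fst (xs ! i))" if "i < length xs" for i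
    using generatesD(2)[OF Q(2), of "ys ! i"] that len fst_nth[OF that] by simp
  have "\<exists>\<phi>\<in>hom PSh P Q. \<forall>p\<in>set xs. app \<phi> (fst p) (snd p) = snd (ys ! idx p)"
  proof (rule extend_from_generators[OF P(2,1) Q(1)])
    show "snd (ys ! idx p) \<in> omap Q (fst p)" if "p \<in> set xs" for p
      using ys[of "idx p"] idx[OF that] by simp
    show "act Q f (snd (ys ! idx p)) = act Q g (snd (ys ! idx q))"
      if pq: "p \<in> set xs" "q \<in> set xs" and fg: "f \<in> hom A c (fst p)" "g \<in> hom A c (fst q)"
        and eq: "act P f (snd p) = act P g (snd q)" for p q c f g
      using transfer[of "idx p" "idx q" f c g] idx[OF pq(1)] idx[OF pq(2)] fg eq by simp
  qed
  then obtain \<phi> where \<phi>: "\<phi> \<in> hom PSh P Q" "\<And>p. p \<in> set xs \<Longrightarrow> app \<phi> (fst p) (snd p) = snd (ys ! idx p)"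
    by blast
  have "app \<phi> (fst (xs ! i)) (snd (xs ! i)) = snd (ys ! i)" if i: "i < length xs" for i
  proof -
    \<comment> \<open>If \<open>xs\<close> has repetitions, \<open>idx\<close> may return another
      position than \<open>i\<close>. That the two entries of \<open>xs\<close> agree is a relation
      between identities, and transferring it makes the entries of \<open>ys\<close> agree as
      well.\<close>
    let ?j = "idx (xs ! i)"
    have p: "xs ! i \<in> set xs" using i by simp
    have a: "fst (xs ! i) \<in> Obj A" by (rule generatesD(1)[OF P(2) p])
    have "act Q (Id A (fst (xs ! i))) (snd (ys ! ?j)) = act Q (Id A (fst (xs ! i))) (snd (ys ! i))"
      using idx[OF p] i Id_in[OF a] by (intro transfer[of _ _ _ "fst (xs ! i)"]) auto
    then have "snd (ys ! ?j) = snd (ys ! i)"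
      using act_Id[OF Q(1) a] ys[OF i] ys[of ?j] idx[OF p] by simp
    then show ?thesis using \<phi>(2)[OF p] by simp
  qed
  then show ?thesis using \<phi>(1) by blast
qed

text \<open>The two presheaves have generating lists with the same presentation, which gives
  morphisms in both directions, inverse to each other on generators. The isomorphism is recorded
  pointwise because directed unions are treated through injectivity and images.\<close>

lemma finitely_generated_presented:
  assumes "finitely_generated P"
  obtains v \<phi> where "v \<in> presentations" "\<phi> \<in> hom PSh (presented_psh v) P"
    "\<And>a x y. \<lbrakk>a \<in> Obj A; x \<in> omap (presented_psh v) a; y \<in> omap (presented_psh v) a;
       app \<phi> a x = app \<phi> a y\<rbrakk> \<Longrightarrow> x = y"
    "\<And>a. a \<in> Obj A \<Longrightarrow> app \<phi> a ` omap (presented_psh v) a = omap P a"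
proof -
  obtain G where P: "P \<in> Obj PSh" and G: "finite G" "generates P G"
    using assms unfolding finitely_generated_def by blast
  obtain xs where xs: "set xs = G" using finite_list[OF G(1)] by blast
  have gen: "generates P (set xs)" using G(2) xs by simp
  define v where "v = presentation P xs"
  let ?Q = "presented_psh v"
  have "?Q \<in> Obj PSh \<and> (\<exists>ys. generates ?Q (set ys) \<and> presentation ?Q ys = v)"
    unfolding presented_psh_def by (rule someI[of _ P]) (use P gen v_def in blast)
  then obtain ys where Q: "?Q \<in> Obj PSh" "generates ?Q (set ys)" "presentation ?Q ys = v"
    by blast
  obtain \<psi> where \<psi>: "\<psi> \<in> hom PSh P ?Q" "\<And>i. i < length xs \<Longrightarrow> app \<psi> (fst (xs ! i)) (snd (xs ! i)) = snd (ys ! i)"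
    using presentation_morphism[OF P gen Q(1,2)] Q(3) v_def by auto
  obtain \<phi> where \<phi>: "\<phi> \<in> hom PSh ?Q P" "\<And>i. i < length ys \<Longrightarrow> app \<phi> (fst (ys ! i)) (snd (ys ! i)) = snd (xs ! i)"
    using presentation_morphism[OF Q(1,2) P gen] Q(3) v_def by auto
  have "map fst xs = map fst ys"
    using Q(3) by (simp add: v_def presentation_def)
  then have len: "length ys = length xs" and fst_nth: "\<And>i. i < length xs \<Longrightarrow> fst (ys ! i) = fst (xs ! i)"
    using map_eq_imp_length_eq[of fst xs fst ys] nth_map[of _ xs fst] nth_map[of _ ys fst] by metis+
  have "Comp PSh \<psi> \<phi> = Id PSh ?Q"
  proof (rule psh_mor_eq_on_generators[OF Q(2) Comp_PSh_hom[OF \<phi>(1) \<psi>(1)] Id_PSh_hom[OF Q(1)]])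
    fix p assume p: "p \<in> set ys"
    then obtain i where i: "i < length xs" "ys ! i = p" using len by (auto simp: in_set_conv_nth)
    note g = generatesD[OF Q(2) p]
    have "app \<phi> (fst p) (snd p) = snd (xs ! i)" using \<phi>(2)[of i] i len by simp
    then have "app (Comp PSh \<psi> \<phi>) (fst p) (snd p) = app \<psi> (fst (xs ! i)) (snd (xs ! i))"
      using app_Comp[OF \<phi>(1) g] fst_nth[OF i(1)] i(2) by simp
    then show "app (Comp PSh \<psi> \<phi>) (fst p) (snd p) = app (Id PSh ?Q) (fst p) (snd p)"
      using \<psi>(2)[OF i(1)] i(2) app_Id[OF g] by simp
  qed
  then have left: "app \<psi> a (app \<phi> a x) = x" if "a \<in> Obj A" "x \<in> omap ?Q a" for a x
    using app_Comp[OF \<phi>(1) that, of \<psi>] app_Id[OF that] by simp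
  have "Comp PSh \<phi> \<psi> = Id PSh P"
  proof (rule psh_mor_eq_on_generators[OF gen Comp_PSh_hom[OF \<psi>(1) \<phi>(1)] Id_PSh_hom[OF P]])
    fix p assume p: "p \<in> set xs"
    then obtain i where i: "i < length xs" "xs ! i = p" by (auto simp: in_set_conv_nth)
    note g = generatesD[OF gen p]
    have "app \<psi> (fst p) (snd p) = snd (ys ! i)" using \<psi>(2)[of i] i by simp
    then have "app (Comp PSh \<phi> \<psi>) (fst p) (snd p) = app \<phi> (fst (ys ! i)) (snd (ys ! i))"
      using app_Comp[OF \<psi>(1) g] fst_nth[OF i(1)] i(2) by simp
    then show "app (Comp PSh \<phi> \<psi>) (fst p) (snd p) = app (Id PSh P) (fst p) (snd p)"
      using \<phi>(2)[of i] i len app_Id[OF g] by simp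
  qed
  then have right: "app \<phi> a (app \<psi> a x) = x" if "a \<in> Obj A" "x \<in> omap P a" for a x
    using app_Comp[OF \<psi>(1) that, of \<phi>] app_Id[OF that] by simp
  show ?thesis
  proof (rule that[of v \<phi>])
    show "v \<in> presentations" using P gen by (auto simp: presentations_def v_def)
    show "\<phi> \<in> hom PSh ?Q P" by (rule \<phi>(1))
    show "x = y" if "a \<in> Obj A" "x \<in> omap ?Q a" "y \<in> omap ?Q a" "app \<phi> a x = app \<phi> a y" for a x y
      using arg_cong[OF that(4), of "app \<psi> a"] unfolding left[OF that(1,2)] left[OF that(1,3)] .
    show "app \<phi> a ` omap ?Q a = omap P a" if a: "a \<in> Obj A" for a
    proof
      show "app \<phi> a ` omap ?Q a \<subseteq> omap P a" using app_in[OF \<phi>(1) a] by blast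
      show "omap P a \<subseteq> app \<phi> a ` omap ?Q a"
      proof
        fix z assume z: "z \<in> omap P a"
        show "z \<in> app \<phi> a ` omap ?Q a"
          using app_in[OF \<psi>(1) a z] right[OF a z] by (intro image_eqI[of _ _ "app \<psi> a z"]) simp_all
      qed
    qed
  qed
qed

lemma finitely_generated_presented_psh:
  assumes "v \<in> presentations"
  shows "finitely_generated (presented_psh v)"
proof -
  obtain P xs where "P \<in> Obj PSh" "generates P (set xs)" "v = presentation P xs"
    using assms by (auto simp: presentations_def)
  then have "\<exists>P. P \<in> Obj PSh \<and> (\<exists>xs. generates P (set xs) \<and> presentation P xs = v)"
    by blast
  from someI_ex[OF this] have "presented_psh v \<in> Obj PSh \<and> (\<exists>xs. generates (presented_psh v) (set xs))"
    unfolding presented_psh_def by blast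
  then show ?thesis unfolding finitely_generated_def by blast
qed

section \<open>Presheaves as directed unions of finitely generated subpresheaves\<close>

definition span :: "('o, 'm, 'u) psh \<Rightarrow> ('o \<times> 'u) set \<Rightarrow> 'o \<Rightarrow> 'u set" where
  "span Y F b = {act Y f (snd p) | p f. p \<in> F \<and> f \<in> hom A b (fst p)}"

lemma span_closed:
  assumes Y: "Y \<in> Obj PSh" and F: "F \<subseteq> Sigma (Obj A) (omap Y)"
  shows "closed_family Y (span Y F)"
  unfolding closed_family_def
proof (intro conjI ballI)
  show "span Y F a \<subseteq> omap Y a" for a
    using F act_hom[OF Y] by (force simp: span_def)
  show "act Y f x \<in> span Y F (Dom A f)" if f: "f \<in> Mor A" and x: "x \<in> span Y F (Cod A f)" for f x
  proof -
    obtain p g where p: "p \<in> F" "g \<in> hom A (Cod A f) (fst p)" "x = act Y g (snd p)"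
      using x by (auto simp: span_def)
    have f': "f \<in> hom A (Dom A f) (Cod A f)" using f by (simp add: hom_def)
    have "snd p \<in> omap Y (fst p)" using F p(1) by auto
    then have "act Y f x = act Y (Comp A g f) (snd p)"
      using act_Comp_hom[OF Y f' p(2)] p(3) by simp
    then show ?thesis
      using p(1) Comp_in[OF f' p(2)] unfolding span_def by blast
  qed
qed

lemma span_member:
  assumes Y: "Y \<in> Obj PSh" and F: "F \<subseteq> Sigma (Obj A) (omap Y)" and p: "p \<in> F"
  shows "snd p \<in> span Y F (fst p)"
proof -
  have "fst p \<in> Obj A" "snd p \<in> omap Y (fst p)" using F p by auto
  then have "snd p = act Y (Id A (fst p)) (snd p)" "Id A (fst p) \<in> hom A (fst p) (fst p)"
    using act_Id[OF Y] Id_in by simp_all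
  then show ?thesis using p unfolding span_def by blast
qed

lemma finitely_generated_span:
  assumes Y: "Y \<in> Obj PSh" and F: "F \<subseteq> Sigma (Obj A) (omap Y)" "finite F"
  shows "finitely_generated (subpsh Y (span Y F))"
proof -
  have "generates (subpsh Y (span Y F)) F"
    unfolding generates_def
  proof (intro conjI ballI)
    show "F \<subseteq> Sigma (Obj A) (omap (subpsh Y (span Y F)))"
      using F(1) span_member[OF Y F(1)] by (auto simp: subpsh_omap)
    fix a z assume "a \<in> Obj A" "z \<in> omap (subpsh Y (span Y F)) a"
    then obtain p f where p: "p \<in> F" "f \<in> hom A a (fst p)" "z = act Y f (snd p)"
      by (auto simp: subpsh_omap span_def)
    then have "z = act (subpsh Y (span Y F)) f (snd p)"
      using span_member[OF Y F(1) p(1)] by (subst subpsh_act) (auto simp: hom_def)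
    then show "\<exists>p\<in>F. \<exists>f\<in>hom A a (fst p). z = act (subpsh Y (span Y F)) f (snd p)"
      using p by blast
  qed
  then show ?thesis
    using subpsh_Obj[OF Y span_closed[OF Y F(1)]] F(2) unfolding finitely_generated_def by blast
qed

text \<open>Every presheaf is the directed union of the subpresheaves spanned by its finite sets of
  elements. Each of these is replaced by its chosen representative, embedded into
  \<open>Y\<close>.\<close>

lemma directed_colimit_of_presented:
  assumes Y: "Y \<in> Obj PSh"
  obtains I :: "'u set" and r D c where "small U I" "directed_poset I r"
    "is_functor (poset_cat I r) PSh D" "is_colimit (poset_cat I r) PSh D Y c"
    "\<forall>i\<in>I. omap D i \<in> presented_psh ` presentations"
proof -
  let ?T = "Sigma (Obj A) (omap Y)"
  \<comment> \<open>Indexing by the finite sets themselves makes unions provide upper bounds;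
    different sets may span the same subpresheaf.\<close>
  define K where "K = {F. finite F \<and> F \<subseteq> ?T}"
  have "small U ?T" using small_Sigma[OF regular small_Obj small_psh[OF Y]] .
  then have small_K: "small U K"
    unfolding K_def by (rule small_finite_subsets[OF regular])
  have dir: "directed_poset K {(F, F'). F \<in> K \<and> F' \<in> K \<and> F \<subseteq> F'}"
    unfolding directed_poset_def partial_order_on_def preorder_on_def
  proof (intro conjI ballI)
    show "\<exists>k\<in>K. (F, k) \<in> {(F, F'). F \<in> K \<and> F' \<in> K \<and> F \<subseteq> F'} \<and> (F', k) \<in> {(F, F'). F \<in> K \<and> F' \<in> K \<and> F \<subseteq> F'}"
      if "F \<in> K" "F' \<in> K" for F F'
      using that by (intro bexI[of _ "F \<union> F'"]) (auto simp: K_def)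
    show "K \<noteq> {}" by (auto simp: K_def)
  qed (auto simp: refl_on_def trans_def antisym_def)
  have "\<exists>w. F \<in> K \<longrightarrow> fst w \<in> presentations \<and> snd w \<in> hom PSh (presented_psh (fst w)) Y \<and>
      (\<forall>a\<in>Obj A. inj_on (app (snd w) a) (omap (presented_psh (fst w)) a) \<and>
        app (snd w) a ` omap (presented_psh (fst w)) a = span Y F a)" for F
  proof (cases "F \<in> K")
    case True
    then have F: "F \<subseteq> ?T" "finite F" by (auto simp: K_def)
    let ?S = "subpsh Y (span Y F)"
    note incl = subpsh_incl[OF Y span_closed[OF Y F(1)]]
    obtain v \<phi> where v: "v \<in> presentations" "\<phi> \<in> hom PSh (presented_psh v) ?S"
      and inj: "\<And>a x y. \<lbrakk>a \<in> Obj A; x \<in> omap (presented_psh v) a; y \<in> omap (presented_psh v) a;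
         app \<phi> a x = app \<phi> a y\<rbrakk> \<Longrightarrow> x = y"
      and img: "\<And>a. a \<in> Obj A \<Longrightarrow> app \<phi> a ` omap (presented_psh v) a = omap ?S a"
      using finitely_generated_presented[OF finitely_generated_span[OF Y F]] by metis
    let ?j = "Comp PSh (mknt ?S (\<lambda>a x. x) Y) \<phi>"
    have app_j: "app ?j a x = app \<phi> a x" if "a \<in> Obj A" "x \<in> omap (presented_psh v) a" for a x
      using app_Comp[OF v(2) that] app_mknt[OF that(1) app_in[OF v(2) that]] by simp
    have "inj_on (app ?j a) (omap (presented_psh v) a)" if "a \<in> Obj A" for a
      using inj[OF that] that by (auto simp: inj_on_def app_j)
    moreover have "app ?j a ` omap (presented_psh v) a = span Y F a" if "a \<in> Obj A" for a
      using img[OF that] that by (simp add: app_j subpsh_omap cong: image_cong)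
    ultimately show ?thesis
      using v(1) Comp_PSh_hom[OF v(2) incl] by (intro exI[of _ "(v, ?j)"]) simp
  qed simp
  then obtain w where w: "\<And>F. F \<in> K \<Longrightarrow> fst (w F) \<in> presentations \<and> snd (w F) \<in> hom PSh (presented_psh (fst (w F))) Y \<and>
      (\<forall>a\<in>Obj A. inj_on (app (snd (w F)) a) (omap (presented_psh (fst (w F))) a) \<and>
        app (snd (w F)) a ` omap (presented_psh (fst (w F))) a = span Y F a)"
    by metis
  define P where "P F = presented_psh (fst (w F))" for F
  define j where "j F = snd (w F)" for F
  have j: "j F \<in> hom PSh (P F) Y" and P: "P F \<in> presented_psh ` presentations"
    and j_inj: "\<And>a. a \<in> Obj A \<Longrightarrow> inj_on (app (j F) a) (omap (P F) a)"
    and j_img: "\<And>a. a \<in> Obj A \<Longrightarrow> app (j F) a ` omap (P F) a = span Y F a" if "F \<in> K" for F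
    using w[OF that] by (simp_all add: j_def P_def)
  obtain I :: "'u set" and r D c where I: "small U I" "directed_poset I r"
    "is_functor (poset_cat I r) PSh D" "is_colimit (poset_cat I r) PSh D Y c"
    and Ic: "\<And>i. i \<in> I \<Longrightarrow> \<exists>F\<in>K. omap D i = P F \<and> c i = j F"
  proof (rule directed_union_colimit[OF small_K dir, of j P Y])
    show "j F \<in> hom PSh (P F) Y" if "F \<in> K" for F by (rule j[OF that])
    show "x = y" if "F \<in> K" "a \<in> Obj A" "x \<in> omap (P F) a" "y \<in> omap (P F) a" "app (j F) a x = app (j F) a y"
      for F a x y
      using inj_onD[OF j_inj[OF that(1,2)]] that(3-5) by simp
    show "app (j F) a ` omap (P F) a \<subseteq> app (j F') a ` omap (P F') a"
      if FF: "(F, F') \<in> {(F, F'). F \<in> K \<and> F' \<in> K \<and> F \<subseteq> F'}" and a: "a \<in> Obj A" for F F' a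
    proof -
      have "F \<in> K" "F' \<in> K" "F \<subseteq> F'" using FF by auto
      then show ?thesis
        unfolding j_img[OF \<open>F \<in> K\<close> a] j_img[OF \<open>F' \<in> K\<close> a] by (auto simp: span_def)
    qed
    show "\<exists>F\<in>K. z \<in> app (j F) a ` omap (P F) a" if a: "a \<in> Obj A" and z: "z \<in> omap Y a" for a z
    proof (rule bexI)
      show F: "{(a, z)} \<in> K" using a z by (auto simp: K_def)
      show "z \<in> app (j {(a, z)}) a ` omap (P {(a, z)}) a"
        unfolding j_img[OF F a] using span_member[OF Y, of "{(a, z)}" "(a, z)"] a z by simp
    qed
  qed (rule that)
  have "omap D i \<in> presented_psh ` presentations" if "i \<in> I" for i
    using Ic[OF that] P by auto
  then show ?thesis using that I by blast
qed

lemma locally_finitely_presentable_PSh: "locally_finitely_presentable U PSh"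
  unfolding locally_finitely_presentable_def
proof (intro conjI exI[of _ "presented_psh ` presentations"] ballI category_PSh cocomplete_PSh)
  show "small U (presented_psh ` presentations)"
    by (rule small_image[OF small_presentations])
  show "finitely_presentable U PSh X" if "X \<in> presented_psh ` presentations" for X
    using that finitely_generated_presented_psh finitely_generated_imp_finitely_presentable by blast
  fix Y assume Y: "Y \<in> Obj PSh"
  obtain I :: "'u set" and r D c where "small U I" "directed_poset I r"
    "is_functor (poset_cat I r) PSh D" "is_colimit (poset_cat I r) PSh D Y c"
    "\<forall>i\<in>I. omap D i \<in> presented_psh ` presentations"
    using directed_colimit_of_presented[OF Y] .
  then show "\<exists>(I :: 'u set) r D c. small U I \<and> directed_poset I r \<and> is_functor (poset_cat I r) PSh D \<and>
      (\<forall>i\<in>I. omap D i \<in> presented_psh ` presentations) \<and> is_colimit (poset_cat I r) PSh D Y c"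
    by (intro exI[of _ I] exI[of _ r] exI[of _ D] exI[of _ c]) simp
qed

text \<open>For the direction from left to right, the identity of \<open>X\<close> factors through a
  stage of its canonical directed union, so the cocone map of that finitely generated stage is
  pointwise surjective.\<close>

lemma finitely_presentable_iff_finitely_generated:
  "finitely_presentable U PSh X \<longleftrightarrow> finitely_generated X"
proof
  assume fp: "finitely_presentable U PSh X"
  then have X: "X \<in> Obj PSh" by (simp add: finitely_presentable_def)
  obtain I :: "'u set" and r D c where I: "small U I" "directed_poset I r"
    "is_functor (poset_cat I r) PSh D" "is_colimit (poset_cat I r) PSh D X c"
    and D: "\<forall>i\<in>I. omap D i \<in> presented_psh ` presentations"
    using directed_colimit_of_presented[OF X] .
  obtain i \<psi> where i: "i \<in> I" and \<psi>: "\<psi> \<in> hom PSh X (omap D i)" "Comp PSh (c i) \<psi> = Id PSh X"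
    using category.finitely_presentable_factor[OF category_PSh fp I Id_PSh_hom[OF X]] by blast
  have c: "c i \<in> hom PSh (omap D i) X"
    using I(4) i by (simp add: is_colimit_def cocone_def)
  show "finitely_generated X"
  proof (rule finitely_generated_image[OF c])
    from bspec[OF D i] show "finitely_generated (omap D i)"
      by (rule imageE) (simp add: finitely_generated_presented_psh)
    show "z \<in> app (c i) a ` omap (omap D i) a" if "a \<in> Obj A" "z \<in> omap X a" for a z
      using app_Comp[OF \<psi>(1) that, of "c i"] \<psi>(2) app_Id[OF that] app_in[OF \<psi>(1) that]
      by (intro image_eqI[of _ _ "app \<psi> a z"]) simp_all
  qed
qed (rule finitely_generated_imp_finitely_presentable)

lemma graduated_PSh: "graduated U PSh"
  unfolding graduated_def
proof (intro conjI locally_finitely_presentable_PSh exI[of _ "\<lambda>P. card (subrelations P)"] allI impI)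
  fix X assume "finitely_presentable U PSh X"
  then have X: "finitely_generated X"
    by (simp add: finitely_presentable_iff_finitely_generated)
  {
    fix m assume "subobject PSh X m"
    then have m: "m \<in> hom PSh (Dom PSh m) X" and mono: "mono_mor PSh m"
      by (auto simp: subobject_def mono_mor_def hom_def)
    note inj = mono_mor_injective[OF m mono]
    show "finitely_presentable U PSh (Dom PSh m)"
      unfolding finitely_presentable_iff_finitely_generated
      by (rule finitely_generated_subpresheaf[OF m inj X])
    show "card (subrelations (Dom PSh m)) \<le> card (subrelations X)"
      by (rule grade_subpresheaf(1)[OF m inj X])
    show "card (subrelations (Dom PSh m)) < card (subrelations X)" if "\<not> iso_mor PSh m"
      by (rule grade_subpresheaf(2)[OF m inj X that])
  }
  {
    fix e assume "strong_quotient PSh X e"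
    then have e: "e \<in> hom PSh X (Cod PSh e)" and strong: "strong_epi_mor PSh e"
      by (auto simp: strong_quotient_def strong_epi_mor_def epi_mor_def hom_def)
    have surj: "z \<in> app e a ` omap X a" if "a \<in> Obj A" "z \<in> omap (Cod PSh e) a" for a z
      using strong_epi_mor_surjective[OF e strong that(1)] that(2) by simp
    show "finitely_presentable U PSh (Cod PSh e)"
      unfolding finitely_presentable_iff_finitely_generated
      by (rule finitely_generated_image[OF e surj X])
    show "card (subrelations (Cod PSh e)) \<le> card (subrelations X)"
      by (rule grade_quotient(1)[OF e surj X])
    show "card (subrelations (Cod PSh e)) < card (subrelations X)" if "\<not> iso_mor PSh e"
      by (rule grade_quotient(2)[OF e surj X that])
  }
qed

end

theorem theorem5p2:
  fixes A :: "('o, 'm) cat"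
  assumes "regular_universe TYPE('u)"
    and "small_category TYPE('u) A"
    and "has_binary_products A"
  shows "(graduated TYPE('u) (presheaf_cat TYPE('u) A)
            \<longleftrightarrow> dcc_category TYPE('u) (presheaf_cat TYPE('u) A)) \<and>
         (dcc_category TYPE('u) (presheaf_cat TYPE('u) A)
            \<longleftrightarrow> (\<forall>a\<in>Obj A. finite {S. sieve A a S}))"
proof -
  interpret presheaves A "TYPE('u)"
    using assms(1,2) by (simp add: presheaves_def presheaves_axioms_def small_category_def)
  have "graduated TYPE('u) PSh" if "\<forall>a\<in>Obj A. finite {S. sieve A a S}"
  proof -
    interpret presheaves_finite_sieves A "TYPE('u)"
      by unfold_locales (use assms(3) that in auto)
    show ?thesis by (rule graduated_PSh)
  qed
  \<comment> \<open>The implications form a cycle: (3) yields (1), (1) yields (2), and (2) yields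
    (3).\<close>
  then show ?thesis
    using graduated_imp_dcc_category dcc_imp_finite_sieves by blast
qed

end
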